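(* In the standing setup, consider any full rate linear dispersive code that is DMT optimal, i.e. whose diversity gain $d(r)$ equals the optimal tradeoff $d^*(r)$ for all $r\in[0,n_t]$. Then for integer multiplexing gain $r=k\in\{0,\dots,n_t\}$, $c(k)\le\bar c(k)=\frac{Tk(n_t-k)}{n_t}$, and for general $0\le r\le n_t$, $c(r)\le\bar c(r)$ with $$\bar c(r)=\frac{T}{n_t}\Big(r(n_t-\lfloor r\rfloor-1)+\big(n_t\lfloor r\rfloor-r(n_t-1)\big)^+\Big),$$ where $\bar c(r)$ is the value of the optimization problem $\max_{\boldsymbol\alpha}\sum_{i=1}^{n_t}T\min(\frac{r}{n_t}-1+\alpha_i,\frac{r}{n_t})^+$ subject to $\sum_{i}(n_r-n_t+2i-1)\alpha_i\le d(r)$, $\alpha_1\ge\dots\ge\alpha_{n_t}\ge0$.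
   Context: $(a)^+=\max(a,0)$. The optimal DMT $d^*(r)$ is the piecewise linear function connecting the points $(k,(n_t-k)(n_r-k))$, $k=0,\dots,n_t$. Standing setup. Let $\rho\to\infty$; $\log$ base 2; $f(\rho)\doteq\rho^a$ means $\lim\log f/\log\rho=a$. Channel $\mathbf Y=\mathbf H\mathbf X+\mathbf W$, $\mathbf H\in\mathbb C^{n_r\times n_t}$ ($n_r\ge n_t$) i.i.d. $\mathcal{CN}(0,1)$, $\mathbf W\in\mathbb C^{n_r\times T}$ i.i.d. $\mathcal{CN}(0,1)$, independent. Full rate linear dispersive code: $\kappa=n_tT$, $\mathrm{vec}(\mathbf X)=\theta\mathbf G\mathbf s$, full rank generator $\mathbf G\in\mathbb C^{\kappa\times\kappa}$, $\mathbf s$ uniform on $\mathcal Q_\eta^\kappa$, $\mathcal Q_\eta=\{s:\Re s,\Im s\in\mathbb Z\cap[-\eta,\eta]\}$, with $\eta\doteq\rho^{rT/(2\kappa)}$, $\theta^2\doteq\rho^{1-rT/\kappa}$ for multiplexing gain $r$. Diversity $d(r)=-\lim\log\Pr(\hat{\mathbf X}_{\mathrm{ML}}\ne\mathbf X)/\log\rho$ under ML decoding. Sphere decoder: $\mathbf M=\theta(\mathbf I_T\otimes\mathbf H)\mathbf G=\mathbf Q\mathbf R$ (thin QR), $\mathbf r=\mathbf Q^H\mathrm{vec}(\mathbf Y)$, $\mathbf r_k$ last $k$ entries, $\mathbf R_k$ lower-right $k\times k$ block, $N=\sum_{k=1}^\kappa|\{\hat{\mathbf s}_k\in\mathcal Q_\eta^k:\|\mathbf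 r_k-\mathbf R_k\hat{\mathbf s}_k\|^2\le\xi^2\}|$, radius $\xi^2=z\log\rho$, $z>d(r)$. $\Psi(x)=-\lim\log\Pr(N\ge\rho^x)/\log\rho$, SD complexity exponent $c(r)=\inf\{x:\Psi(x)>d(r)\}$ (limits assumed to exist). *)

theory Defs
  imports "HOL-Probability.Probability" "Jordan_Normal_Form.Determinant"
begin

definition dot_eq :: "(real \<Rightarrow> real) \<Rightarrow> real \<Rightarrow> bool" where
  "dot_eq f a \<longleftrightarrow> (\<forall>\<^sub>F \<rho> in at_top. f \<rho> > 0) \<and>
     ((\<lambda>\<rho>. log 2 (f \<rho>) / log 2 \<rho>) \<longlongrightarrow> a) at_top"

definition neg_exp :: "real \<Rightarrow> real \<Rightarrow> ereal" where
  "neg_exp p \<rho> = (if p = 0 then \<infinity> else ereal (- log 2 p / log 2 \<rho>))"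

definition exponent :: "(real \<Rightarrow> real) \<Rightarrow> ereal" where
  "exponent f = Lim at_top (\<lambda>\<rho>. neg_exp (f \<rho>) \<rho>)"

text \<open>Piecewise linear function through the points (k, (nt-k)(nr-k)), k = 0..nt.\<close>
definition dstar :: "nat \<Rightarrow> nat \<Rightarrow> real \<Rightarrow> real" where
  "dstar nt nr r = (let k = real_of_int \<lfloor>r\<rfloor> in
     (real nt - k) * (real nr - k) +
     (r - k) * ((real nt - k - 1) * (real nr - k - 1) - (real nt - k) * (real nr - k)))"

definition CN :: "complex measure" where
  "CN = density lborel (\<lambda>z. ennreal (exp (- (cmod z * cmod z)) / pi))"

definition gauss_mat :: "nat \<Rightarrow> nat \<Rightarrow> (nat \<times> nat \<Rightarrow> complex) measure" where
  "gauss_mat m n = PiM ({..<m} \<times> {..<n}) (\<lambda>_. CN)"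

text \<open>Joint law of (H, W): H (nr x nt) and W (nr x T) independent, i.i.d. CN(0,1) entries.\<close>
definition chan_space :: "nat \<Rightarrow> nat \<Rightarrow> nat \<Rightarrow>
    ((nat \<times> nat \<Rightarrow> complex) \<times> (nat \<times> nat \<Rightarrow> complex)) measure" where
  "chan_space nt nr T = gauss_mat nr nt \<Otimes>\<^sub>M gauss_mat nr T"

definition Qalph :: "real \<Rightarrow> complex set" where
  "Qalph \<eta> = {s. Re s \<in> \<int> \<and> Im s \<in> \<int> \<and> \<bar>Re s\<bar> \<le> \<eta> \<and> \<bar>Im s\<bar> \<le> \<eta>}"

definition Qvecs :: "real \<Rightarrow> nat \<Rightarrow> complex vec set" where
  "Qvecs \<eta> k = {v. dim_vec v = k \<and> (\<forall>i<k. v $ i \<in> Qalph \<eta>)}"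

definition cadj :: "complex mat \<Rightarrow> complex mat" where
  "cadj A = mat (dim_col A) (dim_row A) (\<lambda>(i,j). cnj (A $$ (j,i)))"

definition sqnorm :: "complex vec \<Rightarrow> real" where
  "sqnorm v = (\<Sum>i<dim_vec v. cmod (v $ i) * cmod (v $ i))"

definition kron_I :: "nat \<Rightarrow> complex mat \<Rightarrow> complex mat" where
  "kron_I T H = mat (T * dim_row H) (T * dim_col H)
     (\<lambda>(a,b). if a div dim_row H = b div dim_col H
              then H $$ (a mod dim_row H, b mod dim_col H) else 0)"

text \<open>Column-stacking vectorisation vec(X).\<close>
definition vecm :: "complex mat \<Rightarrow> complex vec" where
  "vecm X = vec (dim_row X * dim_col X) (\<lambda>a. X $$ (a mod dim_row X, a div dim_row X))"

definition unvec :: "nat \<Rightarrow> nat \<Rightarrow> complex vec \<Rightarrow> complex mat" where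
  "unvec m n v = mat m n (\<lambda>(i,j). v $ (j * m + i))"

definition Hmat :: "nat \<Rightarrow> nat \<Rightarrow> (nat \<times> nat \<Rightarrow> complex) \<Rightarrow> complex mat" where
  "Hmat m n h = mat m n h"

definition thin_QR :: "complex mat \<Rightarrow> complex mat \<Rightarrow> complex mat \<Rightarrow> bool" where
  "thin_QR M Q R \<longleftrightarrow> Q \<in> carrier_mat (dim_row M) (dim_col M) \<and>
     R \<in> carrier_mat (dim_col M) (dim_col M) \<and>
     cadj Q * Q = 1\<^sub>m (dim_col M) \<and> upper_triangular R \<and> M = Q * R"

definition last_k :: "nat \<Rightarrow> complex vec \<Rightarrow> complex vec" where
  "last_k k v = vec k (\<lambda>i. v $ (dim_vec v - k + i))"

definition lr_block :: "nat \<Rightarrow> complex mat \<Rightarrow> complex mat" where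
  "lr_block k R = mat k k (\<lambda>(i,j). R $$ (dim_row R - k + i, dim_col R - k + j))"

text \<open>A full rate linear dispersive code for nt transmit antennas and block length T:
  a full rank kappa x kappa generator G (kappa = nt T) together with, for every
  multiplexing gain r, constellation size eta r rho and scaling theta r rho with
  eta doteq rho^(rT/(2 kappa)) and theta^2 doteq rho^(1 - rT/kappa).\<close>
definition LD_code :: "nat \<Rightarrow> nat \<Rightarrow> complex mat \<Rightarrow> (real \<Rightarrow> real \<Rightarrow> real) \<Rightarrow>
    (real \<Rightarrow> real \<Rightarrow> real) \<Rightarrow> bool" where
  "LD_code nt T G \<eta> \<theta> \<longleftrightarrow> G \<in> carrier_mat (nt * T) (nt * T) \<and> Determinant.det G \<noteq> 0 \<and>
     (\<forall>r. 0 \<le> r \<and> r \<le> real nt \<longrightarrow>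
        dot_eq (\<eta> r) (r * T / (2 * real (nt * T))) \<and>
        dot_eq (\<lambda>\<rho>. \<theta> r \<rho> * \<theta> r \<rho>) (1 - r * T / real (nt * T)))"

definition Mmat :: "nat \<Rightarrow> complex mat \<Rightarrow> real \<Rightarrow> complex mat \<Rightarrow> complex mat" where
  "Mmat T G th H = complex_of_real th \<cdot>\<^sub>m (kron_I T H * G)"

definition recv :: "nat \<Rightarrow> nat \<Rightarrow> nat \<Rightarrow> complex mat \<Rightarrow> real \<Rightarrow> complex vec \<Rightarrow>
    (nat \<times> nat \<Rightarrow> complex) \<times> (nat \<times> nat \<Rightarrow> complex) \<Rightarrow> complex vec" where
  "recv nt nr T G th s hw =
     vecm (Hmat nr nt (fst hw) * unvec nt T (complex_of_real th \<cdot>\<^sub>v (G *\<^sub>v s))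
           + Hmat nr T (snd hw))"

text \<open>Probability of an event E s (H,W) when s is uniform on Q_eta^kappa and
  independent of (H,W).\<close>
definition Prob :: "nat \<Rightarrow> nat \<Rightarrow> nat \<Rightarrow> real \<Rightarrow>
    (complex vec \<Rightarrow> (nat \<times> nat \<Rightarrow> complex) \<times> (nat \<times> nat \<Rightarrow> complex) \<Rightarrow> bool) \<Rightarrow> real" where
  "Prob nt nr T \<eta> E =
     (\<Sum>s\<in>Qvecs \<eta> (nt * T). measure (chan_space nt nr T)
          {hw \<in> space (chan_space nt nr T). E s hw}) / real (card (Qvecs \<eta> (nt * T)))"

text \<open>ML decoding error event: some other codeword is at least as close to Y
  (ties counted as errors; ties have probability zero).\<close>
definition decoding_error :: "nat \<Rightarrow> nat \<Rightarrow> nat \<Rightarrow> complex mat \<Rightarrow> real \<Rightarrow> real \<Rightarrow>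
    complex vec \<Rightarrow> (nat \<times> nat \<Rightarrow> complex) \<times> (nat \<times> nat \<Rightarrow> complex) \<Rightarrow> bool" where
  "decoding_error nt nr T G \<eta> th s hw =
     (let y = recv nt nr T G th s hw; M = Mmat T G th (Hmat nr nt (fst hw)) in
      \<exists>s'\<in>Qvecs \<eta> (nt * T). s' \<noteq> s \<and> sqnorm (y - M *\<^sub>v s') \<le> sqnorm (y - M *\<^sub>v s))"

definition diversity :: "nat \<Rightarrow> nat \<Rightarrow> nat \<Rightarrow> complex mat \<Rightarrow> (real \<Rightarrow> real \<Rightarrow> real) \<Rightarrow>
    (real \<Rightarrow> real \<Rightarrow> real) \<Rightarrow> real \<Rightarrow> ereal" where
  "diversity nt nr T G \<eta> \<theta> r =
     exponent (\<lambda>\<rho>. Prob nt nr T (\<eta> r \<rho>) (decoding_error nt nr T G (\<eta> r \<rho>) (\<theta> r \<rho>)))"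

definition SD_count :: "nat \<Rightarrow> nat \<Rightarrow> nat \<Rightarrow> complex mat \<Rightarrow> real \<Rightarrow> real \<Rightarrow> real \<Rightarrow>
    complex vec \<Rightarrow> (nat \<times> nat \<Rightarrow> complex) \<times> (nat \<times> nat \<Rightarrow> complex) \<Rightarrow> nat" where
  "SD_count nt nr T G \<eta> th xi2 s hw =
     (let M = Mmat T G th (Hmat nr nt (fst hw));
          QR = (SOME QR. thin_QR M (fst QR) (snd QR));
          rv = cadj (fst QR) *\<^sub>v recv nt nr T G th s hw
      in \<Sum>k\<in>{1..nt * T}. card {sk \<in> Qvecs \<eta> k.
             sqnorm (last_k k rv - lr_block k (snd QR) *\<^sub>v sk) \<le> xi2})"

definition Psi_seq :: "nat \<Rightarrow> nat \<Rightarrow> nat \<Rightarrow> complex mat \<Rightarrow> (real \<Rightarrow> real \<Rightarrow> real) \<Rightarrow>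
    (real \<Rightarrow> real \<Rightarrow> real) \<Rightarrow> real \<Rightarrow> real \<Rightarrow> real \<Rightarrow> real \<Rightarrow> real" where
  "Psi_seq nt nr T G \<eta> \<theta> r z x \<rho> =
     Prob nt nr T (\<eta> r \<rho>)
       (\<lambda>s hw. real (SD_count nt nr T G (\<eta> r \<rho>) (\<theta> r \<rho>) (z * log 2 \<rho>) s hw) \<ge> \<rho> powr x)"

definition Psi :: "nat \<Rightarrow> nat \<Rightarrow> nat \<Rightarrow> complex mat \<Rightarrow> (real \<Rightarrow> real \<Rightarrow> real) \<Rightarrow>
    (real \<Rightarrow> real \<Rightarrow> real) \<Rightarrow> real \<Rightarrow> real \<Rightarrow> real \<Rightarrow> ereal" where
  "Psi nt nr T G \<eta> \<theta> r z x = exponent (Psi_seq nt nr T G \<eta> \<theta> r z x)"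

definition SD_exp :: "nat \<Rightarrow> nat \<Rightarrow> nat \<Rightarrow> complex mat \<Rightarrow> (real \<Rightarrow> real \<Rightarrow> real) \<Rightarrow>
    (real \<Rightarrow> real \<Rightarrow> real) \<Rightarrow> real \<Rightarrow> real \<Rightarrow> ereal" where
  "SD_exp nt nr T G \<eta> \<theta> r z =
     Inf (ereal ` {x. Psi nt nr T G \<eta> \<theta> r z x > diversity nt nr T G \<eta> \<theta> r})"

definition cbar :: "nat \<Rightarrow> nat \<Rightarrow> real \<Rightarrow> real" where
  "cbar nt T r = real T / real nt *
     (r * (real nt - real_of_int \<lfloor>r\<rfloor> - 1) + max (real nt * real_of_int \<lfloor>r\<rfloor> - r * (real nt - 1)) 0)"

definition opt_feasible :: "nat \<Rightarrow> nat \<Rightarrow> ereal \<Rightarrow> (nat \<Rightarrow> real) \<Rightarrow> bool" where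
  "opt_feasible nt nr dr \<alpha> \<longleftrightarrow>
     ereal (\<Sum>i=1..nt. (real nr - real nt + 2 * real i - 1) * \<alpha> i) \<le> dr \<and>
     (\<forall>i\<in>{1..<nt}. \<alpha> (i+1) \<le> \<alpha> i) \<and> \<alpha> nt \<ge> 0"

definition opt_obj :: "nat \<Rightarrow> nat \<Rightarrow> real \<Rightarrow> (nat \<Rightarrow> real) \<Rightarrow> real" where
  "opt_obj nt T r \<alpha> = (\<Sum>i=1..nt. real T * max (min (r / real nt - 1 + \<alpha> i) (r / real nt)) 0)"

end

theory Submission
  imports Defs "HOL-Real_Asymp.Real_Asymp"
begin

text \<open>
  Two lattice points inside the decoder's sphere differ by a vector whose image under the channel is
  small, so the number of visited nodes is bounded uniformly in the noise and in the transmitted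
  symbol by a function of the channel matrix alone. Instead of the singular values of the channel we
  use the pivots of Gaussian elimination with complete pivoting. The triangular factors are then
  bounded together with their inverses, so the pivots control the count like singular values would.
  They also admit an elementary large deviation bound: if all entries of the \<open>m\<close>-th Schur complement
  are at most \<open>\<rho> powr (- \<alpha>\<^sub>m / 2)\<close>, each entry \<open>(a, b)\<close> of the channel matrix lies in a disc of that
  radius, \<open>m = min a b\<close>, whose centre depends only on entries with a smaller value of \<open>min a b\<close>. Since
  \<open>nr + nt - 2 m - 1\<close> entries belong to level \<open>m\<close>, the probability is at most
  \<open>\<rho> powr (- (\<Sum>m<nt. (nr + nt - 2 m - 1) \<alpha>\<^sub>m))\<close>, which is the exponent of the eigenvalue density.
  A finite grid of exponents \<open>\<alpha>\<close> and a union bound reduce the theorem to the optimisation problem.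
\<close>

section \<open>Sequential Gaussian bounds and Schur complements\<close>

text \<open>Three obstacles shape the argument. The generator mixes antennas and time slots, so the
  constellation box is not aligned with the pivot directions. The factor min(W, D) per direction,
  with W the range allowed by the sphere and D the diameter of the box, therefore needs a count of
  separated points in a skew box, and it must hold even for k < \<kappa> symbols described by all
  \<kappa> directions. Secondly, the blocks R_k have no direct relation to the pivots of the
  channel; a difference of two partial candidates is instead extended to a full vector with the same
  residual. Thirdly, complete pivoting does not make the pivots exactly decreasing, so the exponents
  read off from them may be unordered; the upper bound on the objective is therefore proved for
  arbitrary nonnegative exponents, while the attaining point is an ordered one.\<close>

lemma CN_sets [measurable_cong, simp]: "sets CN = sets borel"
  and CN_space [simp]: "space CN = UNIV"
  by (simp_all add: CN_def)

text \<open>The density is the product of two centred normal densities of variance 1/2, one in the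
  real and one in the imaginary part.\<close>

lemma prob_space_CN: "prob_space CN"
proof
  define g where "g = normal_density 0 (1 / sqrt 2)"
  have g: "g x = exp (- x\<^sup>2) / sqrt pi" for x
    by (simp add: g_def normal_density_def power_divide)
  have Basis: "(\<Prod>b\<in>Basis. f b) = f 1 * f \<i>" for f :: "complex \<Rightarrow> 'b::comm_monoid_mult"
    by (simp add: Basis_complex_def)
  have one: "(\<integral>\<^sup>+x. ennreal (g x) \<partial>lborel) = 1"
    using prob_space.emeasure_space_1[OF prob_space_normal_density[of "1/sqrt 2" 0]]
    by (simp add: emeasure_density g_def)
  have "emeasure CN (space CN) = (\<integral>\<^sup>+z. ennreal (exp (- (cmod z * cmod z)) / pi) \<partial>lborel)"
    by (simp add: CN_def emeasure_density)
  also have "\<dots> = (\<integral>\<^sup>+z. (\<Prod>b\<in>Basis. ennreal (g (z \<bullet> b))) \<partial>(lborel :: complex measure))"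
  proof (rule nn_integral_cong)
    fix z :: complex
    have "cmod z * cmod z = (Re z)\<^sup>2 + (Im z)\<^sup>2"
      by (metis cmod_power2 power2_eq_square)
    then have "exp (- (cmod z * cmod z)) / pi = g (Re z) * g (Im z)"
      by (simp add: g exp_add[symmetric] real_sqrt_mult[symmetric] field_simps)
    then show "ennreal (exp (- (cmod z * cmod z)) / pi) = (\<Prod>b\<in>Basis. ennreal (g (z \<bullet> b)))"
      by (simp add: Basis ennreal_mult[symmetric] g)
  qed
  also have "\<dots> = (\<Prod>b\<in>(Basis::complex set). (\<integral>\<^sup>+x. ennreal (g x) \<partial>lborel))"
    by (rule nn_integral_lborel_prod) (auto simp: g_def)
  also have "\<dots> = 1" by (simp add: one)
  finally show "emeasure CN (space CN) = 1" .
qed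

text \<open>The density never exceeds 1 / pi, and the disc has area pi times
  \<open>d\<^sup>2\<close>. The bound is uniform in the centre, which may thus depend on other
  coordinates.\<close>

lemma emeasure_CN_disc:
  assumes "0 \<le> d"
  shows "emeasure CN {z. cmod (z - c) \<le> d} \<le> ennreal (d\<^sup>2)"
proof -
  have eq: "{z. cmod (z - c) \<le> d} = cball c d" by (auto simp: dist_norm norm_minus_commute)
  have "emeasure CN (cball c d) = (\<integral>\<^sup>+z. ennreal (exp (- (cmod z * cmod z)) / pi) * indicator (cball c d) z \<partial>lborel)"
    by (simp add: CN_def emeasure_density)
  also have "\<dots> \<le> (\<integral>\<^sup>+z. ennreal (1 / pi) * indicator (cball c d) z \<partial>lborel)"
    by (intro nn_integral_mono mult_right_mono ennreal_leI divide_right_mono) auto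
  also have "\<dots> = ennreal (1 / pi) * emeasure lborel (cball c d)"
    by (simp add: nn_integral_cmult_indicator)
  also have "\<dots> = ennreal (d\<^sup>2)"
    using assms by (simp add: emeasure_cball unit_ball_vol_2 ennreal_mult[symmetric])
  finally show ?thesis unfolding eq .
qed

text \<open>For an index outside \<open>J\<close> every point of the product takes the value
  \<open>undefined\<close>. Centre functions are thereby measurable on all the partial products met
  when coordinates are integrated out one by one.\<close>

lemma measurable_PiM_CN_component [measurable]:
  "(\<lambda>h. h j) \<in> borel_measurable (PiM J (\<lambda>_. CN))"
proof (cases "j \<in> J")
  case True
  then show ?thesis by measurable
next
  case False
  have "(\<lambda>h. h j) \<in> borel_measurable (PiM J (\<lambda>_. CN)) \<longleftrightarrow>
     (\<lambda>h. undefined::complex) \<in> borel_measurable (PiM J (\<lambda>_. CN))"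
    using False by (intro measurable_cong) (auto simp: space_PiM PiE_def extensional_def)
  then show ?thesis by simp
qed

text \<open>If each coordinate is confined to a disc whose centre depends only on coordinates of smaller
  rank, integrating out the coordinates in order of decreasing rank bounds the probability.\<close>

lemma emeasure_sequential_discs:
  fixes f :: "'i \<Rightarrow> nat" and c :: "'i \<Rightarrow> ('i \<Rightarrow> complex) \<Rightarrow> complex" and \<delta> :: "'i \<Rightarrow> real"
  assumes "finite I"
    and "\<And>i j h y. i \<in> I \<Longrightarrow> j \<in> I \<Longrightarrow> f i \<le> f j \<Longrightarrow> c i (h(j := y)) = c i h"
    and "\<And>i J. i \<in> I \<Longrightarrow> c i \<in> borel_measurable (PiM J (\<lambda>_. CN))"
    and "\<And>i. i \<in> I \<Longrightarrow> 0 \<le> \<delta> i"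
  shows "emeasure (PiM I (\<lambda>_. CN))
      {h \<in> space (PiM I (\<lambda>_. CN)). \<forall>i\<in>I. \<delta> i < 1 \<longrightarrow> cmod (h i - c i h) \<le> \<delta> i}
    \<le> (\<Prod>i\<in>I. ennreal (min 1 ((\<delta> i)\<^sup>2)))"
  using assms
\<comment> \<open>The inserted index \<open>x\<close> has the largest rank so far, so no centre, not
  even its own, depends on coordinate \<open>x\<close>.\<close>
proof (induction I rule: finite_ranking_induct[where f = f])
  case empty
  show ?case
    by (simp add: space_PiM PiM_empty)
next
  case (insert x S)
  show ?case
  proof (cases "x \<in> S")
    case True
    then show ?thesis using insert by (simp add: insert_absorb)
  next
    case False
    interpret CN: prob_space CN by (rule prob_space_CN)
    interpret P: product_prob_space "\<lambda>_::'i. CN" by unfold_locales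
    let ?M = "\<lambda>I. PiM I (\<lambda>_::'i. CN)"
    let ?E = "\<lambda>I. {h \<in> space (?M I). \<forall>i\<in>I. \<delta> i < 1 \<longrightarrow> cmod (h i - c i h) \<le> \<delta> i}"
    have meas: "?E I \<in> sets (?M I)" if "I \<subseteq> insert x S" for I
    proof -
      have "finite I" using that insert.hyps(1) finite_subset by blast
      moreover have [measurable]: "c i \<in> borel_measurable (?M I)" if "i \<in> I" for i
        using that \<open>I \<subseteq> insert x S\<close> insert.prems(2) by blast
      ultimately show ?thesis by measurable
    qed
    have c_upd: "c i (h(x := y)) = c i h" if "i \<in> insert x S" for i h y
      using insert.prems(1)[OF that] insert.hyps(2) that by blast
    have "emeasure (?M (insert x S)) (?E (insert x S)) =
        (\<integral>\<^sup>+h. indicator (?E (insert x S)) h \<partial>?M (insert x S))"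
      by (rule nn_integral_indicator[OF meas[OF order_refl], symmetric])
    also have "\<dots> = (\<integral>\<^sup>+h. (\<integral>\<^sup>+y. indicator (?E (insert x S)) (h(x := y)) \<partial>CN) \<partial>?M S)"
      by (intro P.product_nn_integral_insert insert.hyps(1) False borel_measurable_indicator meas order_refl)
    also have "\<dots> \<le> (\<integral>\<^sup>+h. ennreal (min 1 ((\<delta> x)\<^sup>2)) * indicator (?E S) h \<partial>?M S)"
    proof (rule nn_integral_mono)
      fix h assume h: "h \<in> space (?M S)"
      have h': "h(x := y) \<in> space (?M (insert x S))" for y
        using h by (auto simp: space_PiM PiE_def extensional_def)
      have ind: "indicator (?E (insert x S)) (h(x := y)) =
         (indicator (?E S) h * indicator {y. \<delta> x < 1 \<longrightarrow> cmod (y - c x h) \<le> \<delta> x} y :: ennreal)" for y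
        using h h' False by (auto simp: c_upd indicator_def)
      have D[measurable]: "{y. \<delta> x < 1 \<longrightarrow> cmod (y - c x h) \<le> \<delta> x} \<in> sets CN"
        by simp
      have "emeasure CN {y. \<delta> x < 1 \<longrightarrow> cmod (y - c x h) \<le> \<delta> x} \<le> ennreal (min 1 ((\<delta> x)\<^sup>2))"
      proof (cases "\<delta> x < 1")
        case True
        have "0 \<le> \<delta> x" using insert.prems(3) by blast
        then have "(\<delta> x)\<^sup>2 \<le> 1" using True by (simp add: power_le_one)
        then show ?thesis using True emeasure_CN_disc[of "\<delta> x" "c x h"] \<open>0 \<le> \<delta> x\<close> by simp
      next
        case False
        then have "1 \<le> (\<delta> x)\<^sup>2" by (simp add: one_le_power)
        then show ?thesis using False CN.emeasure_space_1 by simp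
      qed
      note le = this
      have "(\<integral>\<^sup>+y. indicator (?E (insert x S)) (h(x := y)) \<partial>CN) =
          indicator (?E S) h * emeasure CN {y. \<delta> x < 1 \<longrightarrow> cmod (y - c x h) \<le> \<delta> x}"
        unfolding ind by (rule nn_integral_cmult_indicator[OF D])
      also have "\<dots> \<le> indicator (?E S) h * ennreal (min 1 ((\<delta> x)\<^sup>2))"
        by (rule mult_left_mono[OF le]) simp
      finally show "(\<integral>\<^sup>+y. indicator (?E (insert x S)) (h(x := y)) \<partial>CN) \<le>
          ennreal (min 1 ((\<delta> x)\<^sup>2)) * indicator (?E S) h"
        by (subst mult.commute)
    qed
    also have "\<dots> = ennreal (min 1 ((\<delta> x)\<^sup>2)) * emeasure (?M S) (?E S)"
      using meas[of S] by (simp add: nn_integral_cmult_indicator subset_insertI)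
    also have "\<dots> \<le> ennreal (min 1 ((\<delta> x)\<^sup>2)) * (\<Prod>i\<in>S. ennreal (min 1 ((\<delta> i)\<^sup>2)))"
      using insert.IH insert.prems by (intro mult_left_mono) auto
    also have "\<dots> = (\<Prod>i\<in>insert x S. ennreal (min 1 ((\<delta> i)\<^sup>2)))"
      using False insert.hyps(1) by simp
    finally show ?thesis .
  qed
qed

text \<open>\<open>schur A m\<close> is the array after \<open>m\<close> elimination steps without
  exchanges; its entry at \<open>(m, m)\<close> is the next pivot. Indices are not shifted:
  processed rows and columns become zero as long as the pivots are nonzero.\<close>

fun schur :: "(nat \<Rightarrow> nat \<Rightarrow> complex) \<Rightarrow> nat \<Rightarrow> nat \<Rightarrow> nat \<Rightarrow> complex" where
  "schur A 0 a b = A a b"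
| "schur A (Suc m) a b = schur A m a b - schur A m a m * schur A m m b / schur A m m m"

lemma schur_measurable [measurable]:
  assumes [measurable]: "\<And>a b. (\<lambda>h. A h a b) \<in> borel_measurable M"
  shows "(\<lambda>h. schur (A h) m a b) \<in> borel_measurable M"
  by (induction m arbitrary: a b) auto

text \<open>What \<open>m\<close> steps subtract from an entry is built from the first
  \<open>m\<close> rows and columns alone. This correction is the centre of the disc confining the
  entry.\<close>

lemma schur_cong_low_rank:
  assumes "\<And>a b. min a b < m \<Longrightarrow> A a b = A' a b"
  shows "A a b - schur A m a b = A' a b - schur A' m a b"
  using assms
proof (induction m arbitrary: a b)
  case (Suc m)
  have IH: "A a b - schur A m a b = A' a b - schur A' m a b" for a b
    using Suc by (meson less_SucI)
  have eq: "schur A m a b = schur A' m a b" if "a = m \<or> b = m" for a b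
    using IH[of a b] Suc.prems[of a b] that by (auto simp: min_def)
  show ?case using IH[of a b] by (simp add: eq algebra_simps)
qed simp

text \<open>The cells with \<open>min a b = m\<close> form a hook, the rest of row \<open>m\<close>
  and of column \<open>m\<close> joined at the diagonal, with k + n - 2m - 1 cells. These sizes
  become the weights of the budget.\<close>

lemma sum_min_rectangle:
  fixes g :: "nat \<Rightarrow> real"
  assumes "n \<le> k"
  shows "(\<Sum>(a,b)\<in>{..<k} \<times> {..<n}. g (min a b)) = (\<Sum>m<n. (real k + real n - 2 * real m - 1) * g m)"
  using assms
proof (induction n)
  case (Suc n)
  have "(\<Sum>a<k. g (min a n)) = (\<Sum>a<n. g (min a n)) + (\<Sum>a\<in>{n..<k}. g (min a n))"
    using Suc.prems sum.union_disjoint[of "{..<n}" "{n..<k}" "\<lambda>a. g (min a n)"]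
    by (simp add: ivl_disj_un ivl_disj_int)
  also have "\<dots> = (\<Sum>a<n. g a) + (real k - real n) * g n"
    using Suc.prems sum.cong[OF refl, of "{n..<k}" "\<lambda>a. g (min a n)" "\<lambda>_. g n"]
      sum.cong[OF refl, of "{..<n}" "\<lambda>a. g (min a n)" g] by simp
  finally have col: "(\<Sum>a<k. g (min a n)) = (\<Sum>a<n. g a) + (real k - real n) * g n" .
  have IH: "(\<Sum>a<k. \<Sum>b<n. g (min a b)) = (\<Sum>m<n. (real k + real n - 2 * real m - 1) * g m)"
    using Suc by (simp add: sum.cartesian_product)
  have "(\<Sum>m<n. (real k + real (Suc n) - 2 * real m - 1) * g m) =
      (\<Sum>m<n. (real k + real n - 2 * real m - 1) * g m) + (\<Sum>m<n. g m)"
    unfolding sum.distrib[symmetric] by (intro sum.cong) (auto simp: algebra_simps)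
  then show ?case
    unfolding sum.cartesian_product[symmetric]
    by (simp add: sum.distrib col IH algebra_simps)
qed simp

text \<open>Levels with \<open>\<delta> m \<ge> 1\<close> are left unconstrained.\<close>

definition small_schur :: "nat \<Rightarrow> nat \<Rightarrow> (nat \<Rightarrow> nat) \<Rightarrow> (nat \<Rightarrow> nat) \<Rightarrow> (nat \<Rightarrow> real) \<Rightarrow>
    (nat \<times> nat \<Rightarrow> complex) set" where
  "small_schur k n \<sigma> \<tau> \<delta> = {h \<in> space (gauss_mat k n). \<forall>a<k. \<forall>b<n. \<delta> (min a b) < 1 \<longrightarrow>
     cmod (schur (\<lambda>a b. h (\<sigma> a, \<tau> b)) (min a b) a b) \<le> \<delta> (min a b)}"

lemma small_schur_measurable [measurable]: "small_schur k n \<sigma> \<tau> \<delta> \<in> sets (gauss_mat k n)"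
  unfolding small_schur_def gauss_mat_def by measurable

lemma prob_space_gauss_mat: "prob_space (gauss_mat k n)"
  unfolding gauss_mat_def by (intro prob_space_PiM prob_space_CN)

text \<open>Each entry of the permuted array is its Schur complement plus a correction from entries
  of lower level. The level is taken as rank and minus the Schur complement leaves the centre, both
  pulled back along the permutations; the sequential disc bound then applies.\<close>

lemma emeasure_small_schur:
  assumes \<sigma>: "\<sigma> permutes {..<k}" and \<tau>: "\<tau> permutes {..<n}" and \<delta>: "\<And>m. 0 \<le> \<delta> m"
  shows "emeasure (gauss_mat k n) (small_schur k n \<sigma> \<tau> \<delta>) \<le>
     ennreal (\<Prod>(a,b)\<in>{..<k} \<times> {..<n}. min 1 ((\<delta> (min a b))\<^sup>2))"
proof -
  let ?I = "{..<k} \<times> {..<n}"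
  define f where "f = (\<lambda>(i,j). min (inv_into UNIV \<sigma> i) (inv_into UNIV \<tau> j))"
  define A where "A = (\<lambda>h a b. h (\<sigma> a, \<tau> b) :: complex)"
  define c where "c = (\<lambda>(i,j) h. A h (inv_into UNIV \<sigma> i) (inv_into UNIV \<tau> j) - schur (A h) (f (i,j)) (inv_into UNIV \<sigma> i) (inv_into UNIV \<tau> j))"
  have inv: "\<sigma> (inv_into UNIV \<sigma> i) = i" "\<tau> (inv_into UNIV \<tau> i) = i" "inv_into UNIV \<sigma> (\<sigma> i) = i" "inv_into UNIV \<tau> (\<tau> i) = i" for i
    using \<sigma> \<tau> by (simp_all add: permutes_inverses)
  have lt: "\<sigma> i < k \<longleftrightarrow> i < k" "\<tau> j < n \<longleftrightarrow> j < n" for i j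
    using permutes_in_image[OF \<sigma>] permutes_in_image[OF \<tau>] by auto
  have cupd: "c i (h(j := y)) = c i h" if "f i \<le> f j" for i j h y
  proof -
    obtain i1 i2 j1 j2 where ij: "i = (i1,i2)" "j = (j1,j2)" by fastforce
    show ?thesis
      unfolding ij c_def prod.case
    proof (rule schur_cong_low_rank)
      fix a b assume "min a b < f (i1,i2)"
      then have "min a b < f (j1, j2)" using that ij by simp
      then have "(\<sigma> a, \<tau> b) \<noteq> (j1,j2)" by (auto simp: f_def inv)
      then show "A (h((j1, j2) := y)) a b = A h a b" by (auto simp: A_def)
    qed
  qed
  have "emeasure (PiM ?I (\<lambda>_. CN)) {h \<in> space (PiM ?I (\<lambda>_. CN)).
      \<forall>i\<in>?I. \<delta> (f i) < 1 \<longrightarrow> cmod (h i - c i h) \<le> \<delta> (f i)}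
    \<le> (\<Prod>i\<in>?I. ennreal (min 1 ((\<delta> (f i))\<^sup>2)))"
  proof (rule emeasure_sequential_discs[where f = f])
    show "c i \<in> borel_measurable (PiM J (\<lambda>_. CN))" for i J
      unfolding c_def A_def by (cases i) simp
  qed (use cupd \<delta> in auto)
  also have "{h \<in> space (PiM ?I (\<lambda>_. CN)). \<forall>i\<in>?I. \<delta> (f i) < 1 \<longrightarrow> cmod (h i - c i h) \<le> \<delta> (f i)}
     = small_schur k n \<sigma> \<tau> \<delta>"
  proof -
    have "(\<forall>i\<in>?I. \<delta> (f i) < 1 \<longrightarrow> cmod (h i - c i h) \<le> \<delta> (f i)) \<longleftrightarrow>
      (\<forall>a<k. \<forall>b<n. \<delta> (min a b) < 1 \<longrightarrow> cmod (schur (A h) (min a b) a b) \<le> \<delta> (min a b))" for h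
    proof -
      have "(\<forall>i\<in>?I. \<delta> (f i) < 1 \<longrightarrow> cmod (h i - c i h) \<le> \<delta> (f i)) \<longleftrightarrow>
        (\<forall>i\<in>map_prod \<sigma> \<tau> ` ?I. \<delta> (f i) < 1 \<longrightarrow> cmod (h i - c i h) \<le> \<delta> (f i))"
        by (simp add: map_prod_surj_on permutes_image[OF \<sigma>] permutes_image[OF \<tau>])
      also have "\<dots> \<longleftrightarrow> (\<forall>a<k. \<forall>b<n. \<delta> (min a b) < 1 \<longrightarrow> cmod (schur (A h) (min a b) a b) \<le> \<delta> (min a b))"
        by (auto simp: f_def inv c_def A_def)
      finally show ?thesis .
    qed
    then show ?thesis by (auto simp: small_schur_def gauss_mat_def A_def)
  qed
  also have "(\<Prod>i\<in>?I. ennreal (min 1 ((\<delta> (f i))\<^sup>2))) = (\<Prod>i\<in>?I. ennreal (min 1 ((\<delta> (min (fst i) (snd i)))\<^sup>2)))"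
  proof (rule prod.reindex_bij_betw[symmetric, of "map_prod \<sigma> \<tau>" ?I ?I, THEN trans])
    show "bij_betw (map_prod \<sigma> \<tau>) ?I ?I"
      using permutes_imp_bij[OF \<sigma>] permutes_imp_bij[OF \<tau>] by (rule bij_betw_map_prod)
  qed (auto simp: f_def inv intro!: prod.cong)
  also have "\<dots> = ennreal (\<Prod>(a,b)\<in>?I. min 1 ((\<delta> (min a b))\<^sup>2))"
    by (subst prod_ennreal) (auto simp: case_prod_beta)
  finally show ?thesis by (simp add: gauss_mat_def)
qed

text \<open>Threshold 1 means no constraint, so only level \<open>m\<close> is restricted, and the
  cell \<open>(m, m)\<close> contributes a factor 0. Under complete pivoting a zero pivot forces
  this event, so all pivots may be taken nonzero outside a null set.\<close>

lemma null_small_schur: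
  assumes "\<sigma> permutes {..<k}" "\<tau> permutes {..<n}" "m < n" "n \<le> k"
  shows "emeasure (gauss_mat k n) (small_schur k n \<sigma> \<tau> (\<lambda>l. if l = m then 0 else 1)) = 0"
proof -
  have zero: "(\<Prod>(a,b)\<in>{..<k} \<times> {..<n}. min 1 (((if min a b = m then 0 else 1)::real)\<^sup>2)) = 0"
    using assms by (intro prod_zero bexI[of _ "(m,m)"]) auto
  have "emeasure (gauss_mat k n) (small_schur k n \<sigma> \<tau> (\<lambda>l. if l = m then 0 else 1)) \<le>
      ennreal (\<Prod>(a,b)\<in>{..<k} \<times> {..<n}. min 1 (((if min a b = m then 0 else 1)::real)\<^sup>2))"
    by (rule emeasure_small_schur[OF assms(1,2)]) auto
  then show ?thesis unfolding zero by simp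
qed

lemma measure_small_schur_powr:
  assumes "\<sigma> permutes {..<k}" "\<tau> permutes {..<n}" "n \<le> k" "1 < \<rho>" "\<And>m. 0 \<le> a m"
  shows "measure (gauss_mat k n) (small_schur k n \<sigma> \<tau> (\<lambda>m. \<rho> powr (- a m / 2))) \<le>
     \<rho> powr (- (\<Sum>m<n. (real k + real n - 2 * real m - 1) * a m))"
proof -
  interpret prob_space "gauss_mat k n" by (rule prob_space_gauss_mat)
  have "(\<Prod>(i,j)\<in>{..<k} \<times> {..<n}. min 1 ((\<rho> powr (- a (min i j) / 2))\<^sup>2)) \<le>
      (\<Prod>(i,j)\<in>{..<k} \<times> {..<n}. \<rho> powr (- a (min i j)))"
    using assms(4) by (intro prod_mono) (auto simp: powr_power)
  also have "\<dots> = \<rho> powr (- (\<Sum>(i,j)\<in>{..<k} \<times> {..<n}. a (min i j)))"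
    using assms(4) by (simp add: powr_sum case_prod_beta sum_negf[symmetric])
  also have "\<dots> = \<rho> powr (- (\<Sum>m<n. (real k + real n - 2 * real m - 1) * a m))"
    using sum_min_rectangle[OF assms(3), of a] by simp
  finally have "emeasure (gauss_mat k n) (small_schur k n \<sigma> \<tau> (\<lambda>m. \<rho> powr (- a m / 2))) \<le>
     ennreal (\<rho> powr (- (\<Sum>m<n. (real k + real n - 2 * real m - 1) * a m)))"
    using emeasure_small_schur[OF assms(1,2), of "\<lambda>m. \<rho> powr (- a m / 2)"]
    by (meson ennreal_leI order_trans powr_ge_zero)
  then show ?thesis
    by (simp add: emeasure_eq_measure)
qed

section \<open>Gaussian elimination with complete pivoting\<close>

lemma schur_permute:
  assumes "\<And>l. l < m \<Longrightarrow> \<sigma> l = l" "\<And>l. l < m \<Longrightarrow> \<tau> l = l"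
  shows "schur (\<lambda>a b. A (\<sigma> a) (\<tau> b)) m a b = schur A m (\<sigma> a) (\<tau> b)"
  using assms by (induction m arbitrary: a b) auto

text \<open>The next pivot is a largest entry of the remaining block. Swapping it to
  \<open>(m, m)\<close> fixes the indices below \<open>m\<close> and only permutes the remaining
  rows and columns, so the earlier pivots and their maximality survive.\<close>

lemma complete_pivoting_upto:
  assumes "n \<le> k" "m \<le> n"
  shows "\<exists>\<sigma> \<tau>. \<sigma> permutes {..<k} \<and> \<tau> permutes {..<n} \<and>
    (\<forall>l<m. \<forall>a\<in>{l..<k}. \<forall>b\<in>{l..<n}.
      cmod (schur (\<lambda>a b. A (\<sigma> a) (\<tau> b)) l a b) \<le> cmod (schur (\<lambda>a b. A (\<sigma> a) (\<tau> b)) l l l))"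
  using assms(2)
proof (induction m)
  case 0
  show ?case using permutes_id by blast
next
  case (Suc m)
  then obtain \<sigma> \<tau> where \<sigma>: "\<sigma> permutes {..<k}" and \<tau>: "\<tau> permutes {..<n}"
    and max: "\<And>l a b. l < m \<Longrightarrow> a \<in> {l..<k} \<Longrightarrow> b \<in> {l..<n} \<Longrightarrow>
      cmod (schur (\<lambda>a b. A (\<sigma> a) (\<tau> b)) l a b) \<le> cmod (schur (\<lambda>a b. A (\<sigma> a) (\<tau> b)) l l l)"
    by (auto simp: Suc_le_eq)
  define B where "B = (\<lambda>a b. A (\<sigma> a) (\<tau> b))"
  let ?F = "{m..<k} \<times> {m..<n}" and ?g = "\<lambda>(a,b). cmod (schur B m a b)"
  have ne: "?F \<noteq> {}" using Suc.prems assms(1) by auto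
  then have "Max (?g ` ?F) \<in> ?g ` ?F" by (intro Max_in) auto
  then obtain a0 b0 where ab0: "a0 \<in> {m..<k}" "b0 \<in> {m..<n}" "Max (?g ` ?F) = cmod (schur B m a0 b0)"
    by auto
  have ge: "cmod (schur B m a b) \<le> cmod (schur B m a0 b0)" if "a \<in> {m..<k}" "b \<in> {m..<n}" for a b
    unfolding ab0(3)[symmetric] using that by (intro Max_ge) auto
  let ?s = "Transposition.transpose m a0" and ?t = "Transposition.transpose m b0"
  have s: "?s permutes {..<k}" and t: "?t permutes {..<n}"
    using ab0 Suc.prems assms(1) by (auto intro!: permutes_swap_id)
  have fix_s: "?s l = l" and fix_t: "?t l = l" if "l < m" for l
    using that ab0 by (auto simp: Transposition.transpose_def)
  have s_in: "?s a \<in> {l..<k}" if "a \<in> {l..<k}" "l \<le> m" for a l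
    using that ab0 by (auto simp: Transposition.transpose_def)
  have t_in: "?t b \<in> {l..<n}" if "b \<in> {l..<n}" "l \<le> m" for b l
    using that ab0 by (auto simp: Transposition.transpose_def)
  have perm: "schur (\<lambda>a b. A ((\<sigma> \<circ> ?s) a) ((\<tau> \<circ> ?t) b)) l a b = schur B l (?s a) (?t b)" if "l \<le> m" for l a b
    using schur_permute[of l ?s ?t B a b] fix_s fix_t that by (simp add: B_def)
  show ?case
  proof (intro exI conjI allI impI ballI)
    show "\<sigma> \<circ> ?s permutes {..<k}" "\<tau> \<circ> ?t permutes {..<n}"
      using \<sigma> \<tau> s t by (simp_all add: permutes_compose)
    fix l a b assume l: "l < Suc m" and a: "a \<in> {l..<k}" and b: "b \<in> {l..<n}"
    show "cmod (schur (\<lambda>a b. A ((\<sigma> \<circ> ?s) a) ((\<tau> \<circ> ?t) b)) l a b) \<le>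
      cmod (schur (\<lambda>a b. A ((\<sigma> \<circ> ?s) a) ((\<tau> \<circ> ?t) b)) l l l)"
    proof (cases "l = m")
      case True
      then show ?thesis using ge[OF s_in t_in] a b by (simp add: perm[unfolded o_def])
    next
      case False
      then have "l < m" using l by simp
      then show ?thesis
        using max[of l "?s a" "?t b"] s_in[OF a] t_in[OF b]
        by (simp add: perm[unfolded o_def] fix_s fix_t B_def)
    qed
  qed
qed

definition pivoted :: "nat \<Rightarrow> nat \<Rightarrow> (nat \<Rightarrow> nat \<Rightarrow> complex) \<Rightarrow> bool" where
  "pivoted k n B \<longleftrightarrow> (\<forall>l<n. \<forall>a\<in>{l..<k}. \<forall>b\<in>{l..<n}. cmod (schur B l a b) \<le> cmod (schur B l l l))"

lemma complete_pivoting: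
  assumes "n \<le> k"
  obtains \<sigma> \<tau> where "\<sigma> permutes {..<k}" "\<tau> permutes {..<n}" "pivoted k n (\<lambda>a b. A (\<sigma> a) (\<tau> b))"
  using complete_pivoting_upto[OF assms order_refl, of A] unfolding pivoted_def by blast

text \<open>With the factorisation B = L D U, where D carries the pivots, this is coordinate
  \<open>m\<close> of U x.\<close>

definition elim_coord :: "nat \<Rightarrow> (nat \<Rightarrow> nat \<Rightarrow> complex) \<Rightarrow> (nat \<Rightarrow> complex) \<Rightarrow> nat \<Rightarrow> complex" where
  "elim_coord n B x m = (\<Sum>b\<in>{m..<n}. schur B m m b / schur B m m m * x b)"

lemma schur_row_sum:
  assumes nz: "\<And>l. l < n \<Longrightarrow> schur B l l l \<noteq> 0" and "m \<le> n"
  shows "(\<Sum>b\<in>{m..<n}. schur B m a b * x b) =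
    (\<Sum>b<n. B a b * x b) - (\<Sum>l<m. schur B l a l * elim_coord n B x l)"
  using assms(2)
proof (induction m)
  case 0
  show ?case by (simp add: lessThan_atLeast0)
next
  case (Suc m)
  \<comment> \<open>Column \<open>m\<close> of the next Schur complement vanishes because the pivot
    does not, so the sum may start at \<open>m\<close> again.\<close>
  have "(\<Sum>b\<in>{Suc m..<n}. schur B (Suc m) a b * x b) = (\<Sum>b\<in>{m..<n}. schur B (Suc m) a b * x b)"
    using Suc.prems nz[of m] by (simp add: sum.atLeast_Suc_lessThan[of m n])
  also have "\<dots> = (\<Sum>b\<in>{m..<n}. schur B m a b * x b) - schur B m a m * elim_coord n B x m"
    by (simp add: elim_coord_def sum_distrib_left sum_subtractf[symmetric] algebra_simps)
  finally show ?case using Suc by simp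
qed

text \<open>Forward substitution: complete pivoting bounds the entries below a pivot by the pivot,
  so the products u_m of pivot and coordinate satisfy |u_m| \<le> Y + (sum of |u_l| over l < m). The
  constant is 1 + (1 + 2 + ... + 2^(m-1)) = 2^m.\<close>

lemma elim_coord_bound:
  assumes piv: "pivoted k n B" and nz: "\<And>l. l < n \<Longrightarrow> schur B l l l \<noteq> 0" and "n \<le> k"
    and Y: "\<And>a. a < k \<Longrightarrow> cmod (\<Sum>b<n. B a b * x b) \<le> Y" and "m < n"
  shows "cmod (elim_coord n B x m) \<le> 2 ^ m * Y / cmod (schur B m m m)"
proof -
  have "cmod (schur B m m m) * cmod (elim_coord n B x m) \<le> 2 ^ m * Y"
    using \<open>m < n\<close>
  proof (induction m rule: less_induct)
    case (less m)
    have "schur B m m m * elim_coord n B x m = (\<Sum>b\<in>{m..<n}. schur B m m b * x b)"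
      using nz[OF less.prems] by (simp add: elim_coord_def sum_distrib_left)
    also have "\<dots> = (\<Sum>b<n. B m b * x b) - (\<Sum>l<m. schur B l m l * elim_coord n B x l)"
      using less.prems nz by (intro schur_row_sum) auto
    finally have "cmod (schur B m m m) * cmod (elim_coord n B x m) =
        cmod ((\<Sum>b<n. B m b * x b) - (\<Sum>l<m. schur B l m l * elim_coord n B x l))"
      by (simp only: norm_mult[symmetric])
    also have "\<dots> \<le> cmod (\<Sum>b<n. B m b * x b) + cmod (\<Sum>l<m. schur B l m l * elim_coord n B x l)"
      by (rule norm_triangle_ineq4)
    also have "\<dots> \<le> Y + (\<Sum>l<m. 2 ^ l * Y)"
    proof (intro add_mono sum_norm_le)
      show "cmod (\<Sum>b<n. B m b * x b) \<le> Y" using Y less.prems \<open>n \<le> k\<close> by simp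
      fix l assume l: "l \<in> {..<m}"
      then have "cmod (schur B l m l) \<le> cmod (schur B l l l)"
        using piv less.prems \<open>n \<le> k\<close> by (auto simp: pivoted_def)
      then have "cmod (schur B l m l * elim_coord n B x l) \<le> cmod (schur B l l l) * cmod (elim_coord n B x l)"
        by (simp add: norm_mult mult_right_mono)
      also have "\<dots> \<le> 2 ^ l * Y" using less l by auto
      finally show "cmod (schur B l m l * elim_coord n B x l) \<le> 2 ^ l * Y" .
    qed
    also have "\<dots> = Y * (1 + (\<Sum>l<m. 2 ^ l))" by (simp add: sum_distrib_left algebra_simps)
    also have "(1 + (\<Sum>l<m. 2 ^ l)) = (2 ^ m :: real)" by (induction m) auto
    finally show ?case by (simp add: mult.commute)
  qed
  then show ?thesis using nz[OF \<open>m < n\<close>] by (simp add: field_simps)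
qed

text \<open>The rows of the inverse are built from the last one upwards; \<open>k\<close> counts the
  rows already found. A new row is a unit vector minus a combination of later rows with coefficients
  of modulus at most 1, which costs a factor n + 1.\<close>

lemma unit_upper_triangular_inverse:
  fixes U :: "nat \<Rightarrow> nat \<Rightarrow> complex"
  assumes U: "\<And>i j. i < j \<Longrightarrow> j < n \<Longrightarrow> cmod (U i j) \<le> 1" and U1: "\<And>i. i < n \<Longrightarrow> U i i = 1"
  obtains V where "\<And>i j. i < n \<Longrightarrow> cmod (V i j) \<le> (real n + 1) ^ n"
    "\<And>x i. i < n \<Longrightarrow> (\<Sum>j<n. V i j * (\<Sum>b\<in>{j..<n}. U j b * x b)) = x i"
proof -
  have "\<exists>V. (\<forall>i\<in>{n-k..<n}. \<forall>j. cmod (V i j) \<le> (real n + 1) ^ k) \<and>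
      (\<forall>x. \<forall>i\<in>{n-k..<n}. x i = (\<Sum>j<n. V i j * (\<Sum>b\<in>{j..<n}. U j b * x b)))" if "k \<le> n" for k
    using that
  proof (induction k)
    case 0
    show ?case by simp
  next
    case (Suc k)
    from Suc.IH[OF Suc_leD[OF Suc.prems]]
    obtain V where V: "\<And>i j. i \<in> {n-k..<n} \<Longrightarrow> cmod (V i j) \<le> (real n + 1) ^ k"
      "\<And>x i. i \<in> {n-k..<n} \<Longrightarrow> x i = (\<Sum>j<n. V i j * (\<Sum>b\<in>{j..<n}. U j b * x b))"
      by blast
    define r where "r = n - Suc k"
    have r: "r < n" "Suc r = n - k" using Suc.prems by (auto simp: r_def)
    define v where "v = (\<lambda>j. (if j = r then 1 else 0) - (\<Sum>b\<in>{Suc r..<n}. U r b * V b j))"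
    have split: "{n - Suc k..<n} = insert r {n-k..<n}" using r by (auto simp: r_def)
    have notin: "r \<notin> {n-k..<n}" using r by auto
    have "cmod (v j) \<le> (real n + 1) ^ Suc k" for j
    proof -
      have "cmod (v j) \<le> 1 + (\<Sum>b\<in>{Suc r..<n}. cmod (U r b * V b j))"
        unfolding v_def by (rule norm_triangle_le_diff) (intro add_mono norm_sum, auto)
      also have "(\<Sum>b\<in>{Suc r..<n}. cmod (U r b * V b j)) \<le> (\<Sum>b\<in>{Suc r..<n}. (real n + 1) ^ k)"
      proof (rule sum_mono)
        fix b assume b: "b \<in> {Suc r..<n}"
        then show "cmod (U r b * V b j) \<le> (real n + 1) ^ k"
          using mult_mono[OF U[of r b] V(1)[of b j]] r by (simp add: norm_mult)
      qed
      also have "\<dots> \<le> real n * (real n + 1) ^ k"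
        by (simp add: mult_right_mono)
      also have "1 + real n * (real n + 1) ^ k \<le> (real n + 1) ^ Suc k"
        using one_le_power[of "real n + 1" k] by (simp add: algebra_simps)
      finally show ?thesis by simp
    qed
    moreover have xr: "x r = (\<Sum>j<n. v j * (\<Sum>b\<in>{j..<n}. U j b * x b))" for x
    proof -
      define w where "w = (\<lambda>j. \<Sum>b\<in>{j..<n}. U j b * x b)"
      have "w r = x r + (\<Sum>b\<in>{Suc r..<n}. U r b * x b)"
        using r U1 by (simp add: w_def sum.atLeast_Suc_lessThan[of r n])
      also have "(\<Sum>b\<in>{Suc r..<n}. U r b * x b) = (\<Sum>b\<in>{Suc r..<n}. U r b * (\<Sum>j<n. V b j * w j))"
        using V(2)[of _ x, folded w_def] r by (intro sum.cong) (auto simp: w_def)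
      also have "\<dots> = (\<Sum>j<n. (\<Sum>b\<in>{Suc r..<n}. U r b * V b j) * w j)"
        by (simp add: sum_distrib_left sum_distrib_right mult.assoc sum.swap[of _ "{..<n}"])
      finally have "x r = w r - (\<Sum>j<n. (\<Sum>b\<in>{Suc r..<n}. U r b * V b j) * w j)"
        by simp
      also have "w r = (\<Sum>j<n. (if j = r then 1 else 0) * w j)"
        using r by (simp add: mult_delta_left)
      finally show ?thesis
        unfolding v_def by (simp only: w_def left_diff_distrib sum_subtractf)
    qed
    moreover have "cmod (V i j) \<le> (real n + 1) ^ Suc k" if "i \<in> {n-k..<n}" for i j
      by (rule order_trans[OF V(1)[OF that]], rule power_increasing) auto
    ultimately have "\<forall>i\<in>{n - Suc k..<n}. \<forall>j. cmod ((V(r := v)) i j) \<le> (real n + 1) ^ Suc k"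
      using notin unfolding split by (simp del: power_Suc)
    moreover have "x i = (\<Sum>j<n. (V(r := v)) i j * (\<Sum>b\<in>{j..<n}. U j b * x b))"
      if "i \<in> {n - Suc k..<n}" for x i
    proof (cases "i = r")
      case True
      show ?thesis unfolding True fun_upd_same by (rule xr[of x])
    next
      case False
      then have "i \<in> {n-k..<n}" using that split by blast
      from V(2)[OF this, of x] show ?thesis unfolding fun_upd_other[OF False] .
    qed
    ultimately show ?case by blast
  qed
  from this[OF order_refl] obtain V where V: "\<forall>i\<in>{n-n..<n}. \<forall>j. cmod (V i j) \<le> (real n + 1) ^ n"
      "\<forall>x. \<forall>i\<in>{n-n..<n}. x i = (\<Sum>j<n. V i j * (\<Sum>b\<in>{j..<n}. U j b * x b))" by blast
  show thesis
  proof (rule that[of V])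
    show "(\<Sum>j<n. V i j * (\<Sum>b\<in>{j..<n}. U j b * x b)) = x i" if "i < n" for x i
      by (rule V(2)[rule_format, of i x, symmetric]) (use that in simp)
  qed (use V(1) in simp)
qed

text \<open>Complete pivoting bounds the entries of the upper factor by 1, so its inverse is bounded
  independently of the matrix. All dependence on the size of the channel stays in the
  pivots.\<close>

lemma elim_coord_inverse:
  assumes piv: "pivoted k n B" and nz: "\<And>l. l < n \<Longrightarrow> schur B l l l \<noteq> 0" and "n \<le> k"
  obtains V where "\<And>i j. i < n \<Longrightarrow> cmod (V i j) \<le> (real n + 1) ^ n"
    "\<And>x i. i < n \<Longrightarrow> (\<Sum>j<n. V i j * elim_coord n B x j) = x i"
proof (rule unit_upper_triangular_inverse[of n "\<lambda>m b. schur B m m b / schur B m m m"])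
  show "cmod (schur B i i j / schur B i i i) \<le> 1" if "i < j" "j < n" for i j
    using piv nz[of i] that \<open>n \<le> k\<close> by (auto simp: pivoted_def norm_divide)
qed (use nz that in \<open>auto simp: elim_coord_def\<close>)

section \<open>Counting separated points\<close>

text \<open>The range of \<open>g\<close> is cut into squares of side \<open>e\<close>; two values
  in one square differ by at most \<open>2 * e\<close>. Per axis there are at most 2 * ceiling(R /
  e) + 1 \<le> 2 R / e + 3 intervals.\<close>

lemma card_le_cells:
  fixes g :: "'a \<Rightarrow> complex"
  assumes "finite S" "0 < e" "0 \<le> R" "0 \<le> K"
    and R: "\<And>d d'. d \<in> S \<Longrightarrow> d' \<in> S \<Longrightarrow> cmod (g d - g d') \<le> R"
    and K: "\<And>S'. S' \<subseteq> S \<Longrightarrow> (\<And>d d'. d \<in> S' \<Longrightarrow> d' \<in> S' \<Longrightarrow> cmod (g d - g d') \<le> 2 * e) \<Longrightarrow> real (card S') \<le> K"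
  shows "real (card S) \<le> (2 * R / e + 3)\<^sup>2 * K"
proof (cases "S = {}")
  case False
  then obtain d0 where d0: "d0 \<in> S" by auto
  define q where "q d = (\<lfloor>Re (g d - g d0) / e\<rfloor>, \<lfloor>Im (g d - g d0) / e\<rfloor>)" for d
  define N where "N = \<lceil>R / e\<rceil>"
  have "0 \<le> R / e" using assms(2,3) by simp
  then have N0: "0 \<le> N" unfolding N_def by linarith
  have "q ` S \<subseteq> {-N..N} \<times> {-N..N}"
  proof
    fix p assume "p \<in> q ` S"
    then obtain d where d: "d \<in> S" "p = q d" by auto
    have rng: "\<lfloor>t / e\<rfloor> \<in> {-N..N}" if "\<bar>t\<bar> \<le> R" for t
    proof -
      have "t / e \<le> R / e" "- (R / e) \<le> t / e"
        using that \<open>0 < e\<close> by (auto simp: field_simps)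
      then have "\<lfloor>t / e\<rfloor> \<le> \<lceil>R / e\<rceil>" "- \<lceil>R / e\<rceil> \<le> \<lfloor>t / e\<rfloor>" by linarith+
      then show ?thesis by (simp add: N_def)
    qed
    have "\<bar>Re (g d - g d0)\<bar> \<le> R" "\<bar>Im (g d - g d0)\<bar> \<le> R"
      using R[OF d(1) d0] abs_Re_le_cmod abs_Im_le_cmod order_trans by blast+
    then show "p \<in> {-N..N} \<times> {-N..N}"
      using rng unfolding d(2) q_def by blast
  qed
  then have "card (q ` S) \<le> card ({-N..N} \<times> {-N..N})" by (intro card_mono) auto
  also have "\<dots> = nat (2 * N + 1) ^ 2" using N0 by (simp add: card_cartesian_product power2_eq_square algebra_simps)
  finally have "real (card (q ` S)) \<le> real (nat (2 * N + 1) ^ 2)" by (simp only: of_nat_le_iff)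
  also have "\<dots> = (2 * real_of_int N + 1)\<^sup>2"
    using N0 by simp
  also have "\<dots> \<le> (2 * R / e + 3)\<^sup>2"
  proof (rule power_mono)
    have "real_of_int N \<le> R / e + 1" unfolding N_def by linarith
    then show "2 * real_of_int N + 1 \<le> 2 * R / e + 3" by simp
  qed (use N0 in auto)
  finally have cells: "real (card (q ` S)) \<le> (2 * R / e + 3)\<^sup>2" .
  have fib: "real (card {d \<in> S. q d = p}) \<le> K" for p
  proof (rule K)
    fix d d' assume "d \<in> {d \<in> S. q d = p}" "d' \<in> {d \<in> S. q d = p}"
    then have eq: "q d = q d'" by simp
    have close: "\<bar>t - t'\<bar> \<le> e" if "\<lfloor>t / e\<rfloor> = \<lfloor>t' / e\<rfloor>" for t t'
    proof -
      have "\<bar>t / e - t' / e\<bar> \<le> 1" using that by linarith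
      then show ?thesis using \<open>0 < e\<close> by (simp add: diff_divide_distrib[symmetric] field_simps)
    qed
    have "\<bar>Re (g d - g d0) - Re (g d' - g d0)\<bar> \<le> e" "\<bar>Im (g d - g d0) - Im (g d' - g d0)\<bar> \<le> e"
      using eq unfolding q_def prod.inject by (auto intro: close simp del: minus_complex.simps)
    then show "cmod (g d - g d') \<le> 2 * e"
      using cmod_le[of "g d - g d'"] by simp
  qed auto
  have "card S = (\<Sum>p\<in>q ` S. card {d \<in> S. q d = p})"
    using sum.image_gen[OF \<open>finite S\<close>, of "\<lambda>_. 1::nat" q] by simp
  then have "real (card S) = (\<Sum>p\<in>q ` S. real (card {d \<in> S. q d = p}))" by simp
  also have "\<dots> \<le> (\<Sum>p\<in>q ` S. K)" by (intro sum_mono fib)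
  also have "\<dots> \<le> (2 * R / e + 3)\<^sup>2 * K"
    using cells \<open>0 \<le> K\<close> by (simp add: mult_right_mono)
  finally show ?thesis .
qed (use assms in auto)

definition separated :: "nat \<Rightarrow> real \<Rightarrow> real \<Rightarrow> (nat \<Rightarrow> complex) set \<Rightarrow> bool" where
  "separated k s D S \<longleftrightarrow> finite S \<and> (\<forall>d\<in>S. \<forall>d'\<in>S. d \<noteq> d' \<longrightarrow> (\<exists>i<k. s \<le> cmod (d i - d' i))) \<and>
     (\<forall>d\<in>S. \<forall>d'\<in>S. \<forall>i<k. cmod (d i - d' i) \<le> D)"

lemma separatedD:
  assumes "separated k s D S" "d \<in> S" "d' \<in> S"
  shows "d \<noteq> d' \<Longrightarrow> \<exists>i<k. s \<le> cmod (d i - d' i)" "i < k \<Longrightarrow> cmod (d i - d' i) \<le> D"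
  using assms by (simp_all add: separated_def)

definition spanned :: "nat \<Rightarrow> 'j set \<Rightarrow> (nat \<Rightarrow> complex) \<Rightarrow> ('j \<Rightarrow> nat \<Rightarrow> complex) \<Rightarrow> ('j \<Rightarrow> real) \<Rightarrow>
    (nat \<Rightarrow> complex) \<Rightarrow> bool" where
  "spanned k J c b W d \<longleftrightarrow> (\<exists>w. (\<forall>j\<in>J. cmod (w j) \<le> W j) \<and> (\<forall>i<k. d i = c i + (\<Sum>j\<in>J. w j * b j i)))"

text \<open>Removing a direction within one cell is such a map \<open>T\<close>. Differences change
  by less than the separation, so no two points merge and the count is preserved.\<close>

lemma separated_perturb:
  assumes S: "separated k s D S" and "0 < t" "2 * t \<le> s"
    and T: "\<And>d d' i. d \<in> S \<Longrightarrow> d' \<in> S \<Longrightarrow> i < k \<Longrightarrow> cmod ((T d i - T d' i) - (d i - d' i)) \<le> t"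
  shows "separated k (s - t) (D + t) (T ` S)" "inj_on T S"
proof -
  have low: "cmod (d i - d' i) - t \<le> cmod (T d i - T d' i)"
    and up: "cmod (T d i - T d' i) \<le> cmod (d i - d' i) + t" if "d \<in> S" "d' \<in> S" "i < k" for d d' i
    using T[OF that] norm_triangle_ineq3[of "T d i - T d' i" "d i - d' i"] by (auto simp: abs_le_iff)
  have sep: "\<exists>i<k. s - t \<le> cmod (T d i - T d' i)" if d: "d \<in> S" "d' \<in> S" and ne: "d \<noteq> d'" for d d'
  proof -
    obtain i where "i < k" "s \<le> cmod (d i - d' i)" using separatedD(1)[OF S d ne] by blast
    then show ?thesis using low[OF d, of i] by (intro exI[of _ i]) auto
  qed
  show "inj_on T S"
  proof (rule inj_onI, rule ccontr)
    fix d d' assume "d \<in> S" "d' \<in> S" "T d = T d'" "d \<noteq> d'"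
    then show False using sep[of d d'] assms by auto
  qed
  have "cmod (T d i - T d' i) \<le> D + t" if "d \<in> S" "d' \<in> S" "i < k" for d d' i
  proof -
    have "cmod (d i - d' i) \<le> D" using separatedD(2)[OF S that] .
    then show ?thesis using up[OF that] by simp
  qed
  moreover have "\<exists>i<k. s - t \<le> cmod (T d i - T d' i)" if "d \<in> S" "d' \<in> S" "T d \<noteq> T d'" for d d'
    using that by (intro sep) auto
  ultimately show "separated k (s - t) (D + t) (T ` S)"
    using S by (simp add: separated_def)
qed

lemma separated_mono: "separated k s D S \<Longrightarrow> s' \<le> s \<Longrightarrow> D \<le> D' \<Longrightarrow> S' \<subseteq> S \<Longrightarrow> separated k s' D' S'"
  unfolding separated_def by (meson finite_subset order_trans subsetD)

text \<open>A coordinate direction can be eliminated in two ways: cut its coefficient (cost the square of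
  its range), or cut one coordinate of the points and project along the direction (cost the square
  of the diameter). Both perturb the points by less than their separation.\<close>

lemma card_separated_spanned:
  assumes "finite J" "0 < s" "0 \<le> \<beta>"
  shows "\<exists>C>0. \<forall>S b W D c k. 0 < k \<longrightarrow> 0 \<le> D \<longrightarrow> separated k s D S \<longrightarrow> (\<forall>j\<in>J. 0 \<le> W j) \<longrightarrow>
      (\<forall>j\<in>J. \<forall>i<k. cmod (b j i) \<le> \<beta>) \<longrightarrow> (\<forall>d\<in>S. spanned k J c b W d) \<longrightarrow>
      real (card S) \<le> C * (\<Prod>j\<in>J. (1 + min (W j) D)\<^sup>2)"
  using assms
proof (induction J arbitrary: s \<beta> rule: finite_induct)
  case (empty s \<beta>)
  have one: "card S \<le> 1" if "separated k s D S" "\<forall>d\<in>S. spanned k {} c b W d"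
    for S W D and k :: nat and c :: "nat \<Rightarrow> complex" and b :: "'a \<Rightarrow> nat \<Rightarrow> complex"
  proof -
    have "d = d'" if "d \<in> S" "d' \<in> S" for d d'
    proof (rule ccontr)
      assume "d \<noteq> d'"
      then obtain i where i: "i < k" "s \<le> cmod (d i - d' i)"
        using separatedD(1)[OF \<open>separated k s D S\<close> \<open>d \<in> S\<close> \<open>d' \<in> S\<close>] by blast
      have "spanned k {} c b W d" "spanned k {} c b W d'"
        using \<open>\<forall>d\<in>S. spanned k {} c b W d\<close> that by blast+
      then have "d i = c i" "d' i = c i"
        using i(1) by (auto simp: spanned_def)
      then show False using i(2) \<open>0 < s\<close> by simp
    qed
    then show ?thesis using \<open>separated k s D S\<close> by (auto simp: separated_def card_le_Suc0_iff_eq)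
  qed
  show ?case
  proof (intro exI[of _ 1] conjI allI impI)
    fix S c and D :: real and k :: nat and W :: "'a \<Rightarrow> real" and b :: "'a \<Rightarrow> nat \<Rightarrow> complex"
    assume "0 < k" "0 \<le> D"
    assume "separated k s D S" "\<forall>d\<in>S. spanned k {} c b W d"
    from one[OF this] show "real (card S) \<le> 1 * (\<Prod>j\<in>{}. (1 + min (W j) D)\<^sup>2)"
      by simp
  qed simp
next
  case (insert j0 J s \<beta>)
  \<comment> \<open>Cells are fine enough for both ways: the change of a difference is at most
    \<open>2 * e * \<beta>\<close> when a coefficient is cut and \<open>2 * e\<close> when a
    coordinate is cut, and both stay within \<open>s / 2\<close>.\<close>
  define e where "e = s / (4 * (\<beta> + 1))"
  have e: "0 < e" "2 * e \<le> s / 2" "2 * e * \<beta> \<le> s / 2"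
    using insert.prems by (auto simp: e_def field_simps)
  \<comment> \<open>The induction hypothesis is used with half the separation, lost in the
    perturbation, and twice the bound on the directions, since projecting along a direction may
    double the others.\<close>
  obtain C where "C > 0" and C: "\<And>S b W D c k. 0 < k \<Longrightarrow> 0 \<le> D \<Longrightarrow> separated k (s/2) D S \<Longrightarrow> (\<forall>j\<in>J. 0 \<le> W j) \<Longrightarrow>
      (\<forall>j\<in>J. \<forall>i<k. cmod (b j i) \<le> 2 * \<beta>) \<Longrightarrow> (\<forall>d\<in>S. spanned k J c b W d) \<Longrightarrow>
      real (card S) \<le> C * (\<Prod>j\<in>J. (1 + min (W j) D)\<^sup>2)"
    using insert.IH[of "s/2" "2*\<beta>"] insert.prems by auto
  \<comment> \<open>The diameter grows to \<open>D + s / 2\<close>, which costs at most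
    \<open>(1 + s / 2)\<^sup>2\<close> for each remaining direction.\<close>
  define C1 where "C1 = C * (1 + s / 2) ^ (2 * card J)"
  have C1: "C1 > 0" using \<open>C > 0\<close> insert.prems by (simp add: C1_def)
  show ?case
  proof (intro exI[of _ "C1 * (4 / e + 3)\<^sup>2"] conjI allI impI)
    have "0 < 4 / e + 3" using e(1) by (simp add: add_pos_pos)
    then show "0 < C1 * (4 / e + 3)\<^sup>2" using C1 by simp
    fix S :: "(nat \<Rightarrow> complex) set" and b W D c and k :: nat
    assume k: "0 < k" and D: "0 \<le> D" and S: "separated k s D S" and W: "\<forall>j\<in>insert j0 J. 0 \<le> W j"
      and b: "\<forall>j\<in>insert j0 J. \<forall>i<k. cmod (b j i) \<le> \<beta>"
      and span: "\<forall>d\<in>S. spanned k (insert j0 J) c b W d"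
    let ?P = "\<Prod>j\<in>J. (1 + min (W j) D)\<^sup>2"
    have P0: "0 \<le> ?P" by (intro prod_nonneg) auto
    obtain w where w: "\<And>d j. d \<in> S \<Longrightarrow> j \<in> insert j0 J \<Longrightarrow> cmod (w d j) \<le> W j"
      "\<And>d i. d \<in> S \<Longrightarrow> i < k \<Longrightarrow> d i = c i + (\<Sum>j\<in>insert j0 J. w d j * b j i)"
      using span unfolding spanned_def by metis
    have eq: "d i = c i + w d j0 * b j0 i + (\<Sum>j\<in>J. w d j * b j i)" if "d \<in> S" "i < k" for d i
      using w(2)[OF that] insert.hyps by (simp add: algebra_simps)
    \<comment> \<open>Common end of both ways: \<open>T\<close> has removed direction
      \<open>j0\<close> from the points of one cell while keeping their coefficients
      \<open>w\<close> in the other directions.\<close>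
    have reduce: "real (card S') \<le> C1 * ?P"
      if S': "S' \<subseteq> S" and T: "\<And>d d' i. d \<in> S' \<Longrightarrow> d' \<in> S' \<Longrightarrow> i < k \<Longrightarrow> cmod ((T d i - T d' i) - (d i - d' i)) \<le> s / 2"
        and b': "\<forall>j\<in>J. \<forall>i<k. cmod (b' j i) \<le> 2 * \<beta>"
        and rep: "\<And>d i. d \<in> S' \<Longrightarrow> i < k \<Longrightarrow> T d i = c' i + (\<Sum>j\<in>J. w d j * b' j i)"
      for S' and T :: "(nat \<Rightarrow> complex) \<Rightarrow> nat \<Rightarrow> complex" and b' c'
    proof -
      have sep': "separated k s D S'" using separated_mono[OF S] S' by simp
      have s2: "0 < s / 2" "2 * (s / 2) \<le> s" using insert.prems by auto
      note pert = separated_perturb[where T = T and t = "s / 2", OF sep' s2 T]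
      have "real (card S') = real (card (T ` S'))"
        using pert(2) by (simp add: card_image)
      also have "\<dots> \<le> C * (\<Prod>j\<in>J. (1 + min (W j) (D + s / 2))\<^sup>2)"
      proof (rule C[OF k])
        show "separated k (s/2) (D + s/2) (T ` S')"
          using pert(1) by simp
        show "\<forall>d\<in>T ` S'. spanned k J c' b' W d"
        proof
          fix d assume "d \<in> T ` S'"
          then obtain d1 where d1: "d1 \<in> S'" "d = T d1" by blast
          then show "spanned k J c' b' W d"
            unfolding spanned_def using rep w(1) S' by (intro exI[of _ "w d1"]) auto
        qed
      qed (use D W insert.prems b' in auto)
      also have "(\<Prod>j\<in>J. (1 + min (W j) (D + s / 2))\<^sup>2) \<le> (\<Prod>j\<in>J. (1 + s/2)\<^sup>2 * (1 + min (W j) D)\<^sup>2)"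
      proof (rule prod_mono)
        fix j assume j: "j \<in> J"
        have "1 + min (W j) (D + s / 2) \<le> 1 + min (W j) D + s / 2" using insert.prems by auto
        also have "\<dots> \<le> (1 + s/2) * (1 + min (W j) D)"
          using W D j insert.prems by (simp add: algebra_simps)
        finally show "0 \<le> (1 + min (W j) (D + s / 2))\<^sup>2 \<and>
          (1 + min (W j) (D + s / 2))\<^sup>2 \<le> (1 + s/2)\<^sup>2 * (1 + min (W j) D)\<^sup>2"
          using W D j insert.prems by (auto simp: power_mult_distrib[symmetric] intro!: power_mono)
      qed
      also have "\<dots> = (1 + s/2) ^ (2 * card J) * ?P"
        by (simp add: prod.distrib power_mult)
      finally show ?thesis using \<open>C > 0\<close> by (simp add: C1_def mult.assoc)
    qed
    have "real (card S) \<le> (4 / e + 3)\<^sup>2 * (1 + min (W j0) D)\<^sup>2 * (C1 * ?P)"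
    proof (cases "W j0 \<le> D")
      case True
      have "real (card S) \<le> (2 * (2 * W j0) / e + 3)\<^sup>2 * (C1 * ?P)"
      proof (rule card_le_cells[where g = "\<lambda>d. w d j0"])
        show "cmod (w d j0 - w d' j0) \<le> 2 * W j0" if "d \<in> S" "d' \<in> S" for d d'
          using norm_triangle_ineq4[of "w d j0" "w d' j0"] w(1)[of d j0] w(1)[of d' j0] that by simp
        fix S' assume S': "S' \<subseteq> S" and cl: "\<And>d d'. d \<in> S' \<Longrightarrow> d' \<in> S' \<Longrightarrow> cmod (w d j0 - w d' j0) \<le> 2 * e"
        show "real (card S') \<le> C1 * ?P"
        proof (rule reduce[OF S', of "\<lambda>d i. d i - w d j0 * b j0 i" b c])
          fix d d' i assume d: "d \<in> S'" "d' \<in> S'" "i < k"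
          have "cmod (w d j0 - w d' j0) * cmod (b j0 i) \<le> 2 * e * \<beta>"
            using cl[OF d(1,2)] b d(3) e by (intro mult_mono) auto
          then show "cmod ((d i - w d j0 * b j0 i) - (d' i - w d' j0 * b j0 i) - (d i - d' i)) \<le> s / 2"
            using e(3) by (simp add: norm_mult[symmetric] left_diff_distrib norm_minus_commute algebra_simps)
        next
          show "\<forall>j\<in>J. \<forall>i<k. cmod (b j i) \<le> 2 * \<beta>"
            using b insert.prems by fastforce
        next
          fix d i assume "d \<in> S'" "i < k"
          then show "d i - w d j0 * b j0 i = c i + (\<Sum>j\<in>J. w d j * b j i)"
            using eq[of d i] S' by auto
        qed
      qed (use S W e C1 P0 in \<open>auto simp: separated_def\<close>)
      also have "(2 * (2 * W j0) / e + 3)\<^sup>2 \<le> ((4 / e + 3) * (1 + W j0))\<^sup>2"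
        using W e by (intro power_mono) (auto simp: field_simps)
      finally show ?thesis
        using True C1 P0 by (simp add: power_mult_distrib mult_right_mono)
    next
      case False
      \<comment> \<open>Cutting the coordinate in which the direction is largest keeps the ratios
        \<open>q\<close> at modulus at most 1.\<close>
      have "\<exists>i. i < k \<and> (\<forall>i'<k. cmod (b j0 i') \<le> cmod (b j0 i))"
      proof -
        have "Max ((\<lambda>i. cmod (b j0 i)) ` {..<k}) \<in> (\<lambda>i. cmod (b j0 i)) ` {..<k}"
          using k by (intro Max_in) auto
        then obtain i where "i < k" "Max ((\<lambda>i. cmod (b j0 i)) ` {..<k}) = cmod (b j0 i)" by auto
        then show ?thesis by (intro exI[of _ i]) (metis Max_ge finite_imageI finite_lessThan image_eqI lessThan_iff)
      qed
      then obtain i0 where i0: "i0 < k" "\<And>i. i < k \<Longrightarrow> cmod (b j0 i) \<le> cmod (b j0 i0)"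
        by blast
      define q where "q i = b j0 i / b j0 i0" for i
      have q: "cmod (q i) \<le> 1" "b j0 i = b j0 i0 * q i" if "i < k" for i
        using i0(2)[OF that] by (auto simp: q_def norm_divide divide_le_eq)
      have "real (card S) \<le> (2 * D / e + 3)\<^sup>2 * (C1 * ?P)"
      proof (rule card_le_cells[where g = "\<lambda>d. d i0"])
        show "cmod (d i0 - d' i0) \<le> D" if "d \<in> S" "d' \<in> S" for d d'
          using separatedD(2)[OF S that i0(1)] .
        fix S' assume S': "S' \<subseteq> S" and cl: "\<And>d d'. d \<in> S' \<Longrightarrow> d' \<in> S' \<Longrightarrow> cmod (d i0 - d' i0) \<le> 2 * e"
        show "real (card S') \<le> C1 * ?P"
        \<comment> \<open>Projection along direction \<open>j0\<close> onto the hyperplane where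
          coordinate \<open>i0\<close> vanishes: direction \<open>j0\<close> itself is sent to
          zero.\<close>
        proof (rule reduce[OF S', of "\<lambda>d i. d i - d i0 * q i" "\<lambda>j i. b j i - b j i0 * q i" "\<lambda>i. c i - c i0 * q i"])
          fix d d' i assume d: "d \<in> S'" "d' \<in> S'" "i < k"
          have "cmod (d i0 - d' i0) * cmod (q i) \<le> 2 * e * 1"
            using cl[OF d(1,2)] q(1)[OF d(3)] e by (intro mult_mono) auto
          then show "cmod ((d i - d i0 * q i) - (d' i - d' i0 * q i) - (d i - d' i)) \<le> s / 2"
            using e(2) by (simp add: norm_mult[symmetric] left_diff_distrib norm_minus_commute algebra_simps)
        next
          show "\<forall>j\<in>J. \<forall>i<k. cmod (b j i - b j i0 * q i) \<le> 2 * \<beta>"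
          proof (intro ballI allI impI)
            fix j i assume ji: "j \<in> J" "i < k"
            have "cmod (b j i0 * q i) \<le> \<beta> * 1"
              unfolding norm_mult using b ji q(1)[OF ji(2)] i0(1) insert.prems by (intro mult_mono) auto
            then show "cmod (b j i - b j i0 * q i) \<le> 2 * \<beta>"
              using b ji norm_triangle_ineq4[of "b j i" "b j i0 * q i"] by fastforce
          qed
        next
          fix d i assume d: "d \<in> S'" "i < k"
          have "d i - d i0 * q i = c i + w d j0 * (b j0 i0 * q i) + (\<Sum>j\<in>J. w d j * b j i) -
              (c i0 + w d j0 * b j0 i0 + (\<Sum>j\<in>J. w d j * b j i0)) * q i"
            using eq[of d i] eq[of d i0] q(2)[OF d(2)] i0(1) d S' by auto
          then show "d i - d i0 * q i = c i - c i0 * q i + (\<Sum>j\<in>J. w d j * (b j i - b j i0 * q i))"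
            by (simp add: sum_subtractf sum_distrib_right sum_distrib_left right_diff_distrib algebra_simps)
        qed
      qed (use S D e C1 P0 in \<open>auto simp: separated_def\<close>)
      also have "(2 * D / e + 3)\<^sup>2 \<le> ((4 / e + 3) * (1 + D))\<^sup>2"
        using D e by (intro power_mono) (auto simp: field_simps)
      finally show ?thesis
        using False C1 P0 by (simp add: power_mult_distrib mult_right_mono)
    qed
    then show "real (card S) \<le> C1 * (4 / e + 3)\<^sup>2 * (\<Prod>j\<in>insert j0 J. (1 + min (W j) D)\<^sup>2)"
      using insert.hyps by (simp add: algebra_simps)
  qed
qed

section \<open>Thin QR factorisation\<close>

text \<open>Gram-Schmidt, one column at a time. The coefficients \<open>s\<close> record the
  orthonormal vectors in terms of the given columns; through them linear independence shows that the
  next residual is nonzero.\<close>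

lemma gram_schmidt_coordinates:
  fixes v :: "nat \<Rightarrow> nat \<Rightarrow> complex"
  assumes "\<forall>c. (\<forall>i<N. (\<Sum>j<n. c j * v j i) = 0) \<longrightarrow> (\<forall>j<n. c j = 0)"
  shows "\<exists>q r s. (\<forall>a<n. \<forall>b<n. (\<Sum>i<N. cnj (q a i) * q b i) = (if a = b then 1 else 0)) \<and>
     (\<forall>j<n. \<forall>i<N. v j i = (\<Sum>a<Suc j. r a j * q a i)) \<and>
     (\<forall>a<n. \<forall>i<N. q a i = (\<Sum>j<n. s a j * v j i))"
  using assms
proof (induction n)
  case 0
  show ?case by simp
next
  case (Suc n)
  have "\<forall>j<n. c j = 0" if "\<forall>i<N. (\<Sum>j<n. c j * v j i) = 0" for c
  proof -
    have "\<forall>j<Suc n. (c(n := 0)) j = 0"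
      using that by (intro Suc.prems[THEN spec, THEN mp]) simp
    then show ?thesis by (metis fun_upd_other less_SucI nat_neq_iff)
  qed
  then have "\<forall>c. (\<forall>i<N. (\<Sum>j<n. c j * v j i) = 0) \<longrightarrow> (\<forall>j<n. c j = 0)" by blast
  from Suc.IH[OF this] obtain q r s where
    "\<forall>a<n. \<forall>b<n. (\<Sum>i<N. cnj (q a i) * q b i) = (if a = b then 1 else 0)"
    "\<forall>j<n. \<forall>i<N. v j i = (\<Sum>a<Suc j. r a j * q a i)"
    "\<forall>a<n. \<forall>i<N. q a i = (\<Sum>j<n. s a j * v j i)"
    by (elim exE conjE)
  note q = this(1)[rule_format] and r = this(2)[rule_format] and s = this(3)[rule_format]
  define h where "h a = (\<Sum>i<N. cnj (q a i) * v n i)" for a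
  define u where "u i = v n i - (\<Sum>a<n. h a * q a i)" for i
  \<comment> \<open>Coefficients of the residual \<open>u\<close> in the given columns; the
    coefficient 1 of column \<open>n\<close> rules out \<open>u = 0\<close>.\<close>
  define c where "c j = (if j = n then 1 else - (\<Sum>a<n. h a * s a j))" for j
  have u_c: "u i = (\<Sum>j<Suc n. c j * v j i)" if "i < N" for i
  proof -
    have "(\<Sum>a<n. h a * q a i) = (\<Sum>a<n. \<Sum>j<n. h a * s a j * v j i)"
      using s[OF _ that] by (intro sum.cong) (auto simp: sum_distrib_left mult.assoc)
    also have "\<dots> = (\<Sum>j<n. (\<Sum>a<n. h a * s a j) * v j i)"
      by (subst sum.swap) (simp add: sum_distrib_right)
    finally show ?thesis by (simp add: u_def c_def sum_negf)
  qed
  define \<nu> where "\<nu> = sqrt (\<Sum>i<N. (cmod (u i))\<^sup>2)"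
  have "\<exists>i<N. u i \<noteq> 0"
  proof (rule ccontr)
    assume "\<not> (\<exists>i<N. u i \<noteq> 0)"
    then have "(\<Sum>j<Suc n. c j * v j i) = 0" if "i < N" for i using u_c[OF that] that by metis
    then have "c n = 0" using Suc.prems by blast
    then show False by (simp add: c_def)
  qed
  then have "0 < (\<Sum>i<N. (cmod (u i))\<^sup>2)"
    by (auto intro!: sum_pos2)
  then have \<nu>: "0 < \<nu>" "\<nu>\<^sup>2 = (\<Sum>i<N. (cmod (u i))\<^sup>2)" by (auto simp: \<nu>_def)
  have orth: "(\<Sum>i<N. cnj (q a i) * u i) = 0" if "a < n" for a
  proof -
    have "(\<Sum>i<N. cnj (q a i) * u i) = h a - (\<Sum>i<N. \<Sum>b<n. h b * (cnj (q a i) * q b i))"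
      by (simp add: u_def right_diff_distrib sum_subtractf h_def sum_distrib_left mult_ac)
    also have "(\<Sum>i<N. \<Sum>b<n. h b * (cnj (q a i) * q b i)) = (\<Sum>b<n. h b * (\<Sum>i<N. cnj (q a i) * q b i))"
      by (subst sum.swap) (simp add: sum_distrib_left)
    also have "\<dots> = (\<Sum>b<n. if b = a then h a else 0)" using q[OF that] by (intro sum.cong) auto
    also have "\<dots> = h a" using that by simp
    finally show ?thesis by simp
  qed
  have orth': "(\<Sum>i<N. cnj (u i) * q a i) = 0" if "a < n" for a
  proof -
    have "(\<Sum>i<N. cnj (u i) * q a i) = cnj (\<Sum>i<N. cnj (q a i) * u i)"
      by (simp add: mult.commute)
    then show ?thesis using orth[OF that] by simp
  qed
  have uu: "(\<Sum>i<N. cnj (u i) * u i) = of_real \<nu> * of_real \<nu>"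
  proof -
    have "(\<Sum>i<N. cnj (u i) * u i) = of_real (\<Sum>i<N. (cmod (u i))\<^sup>2)"
      by (simp add: complex_norm_square[symmetric] mult.commute[of "cnj _"] del: of_real_power)
    also have "\<dots> = of_real \<nu> * of_real \<nu>" unfolding \<nu>(2)[symmetric] by (simp add: power2_eq_square)
    finally show ?thesis .
  qed
  define q' where "q' = q(n := (\<lambda>i. u i / of_real \<nu>))"
  define r' where "r' = (\<lambda>a j. if j = n then (if a = n then of_real \<nu> else h a) else r a j)"
  define s' where "s' = (\<lambda>a j. if a = n then c j / of_real \<nu> else if j = n then 0 else s a j)"
  have "(\<Sum>i<N. cnj (q' a i) * q' b i) = (if a = b then 1 else 0)" if "a < Suc n" "b < Suc n" for a b
  proof -
    consider "a < n" "b < n" | "a = n" "b < n" | "a < n" "b = n" | "a = n" "b = n"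
      using \<open>a < Suc n\<close> \<open>b < Suc n\<close> by linarith
    then show ?thesis
    proof cases
      case 1
      then show ?thesis using q by (simp add: q'_def)
    next
      case 2
      then show ?thesis using orth'[of b] by (simp add: q'_def sum_divide_distrib[symmetric])
    next
      case 3
      then show ?thesis using orth[of a] by (simp add: q'_def sum_divide_distrib[symmetric])
    next
      case 4
      then show ?thesis using uu \<nu>(1) by (simp add: q'_def sum_divide_distrib[symmetric])
    qed
  qed
  moreover have "v j i = (\<Sum>a<Suc j. r' a j * q' a i)" if "j < Suc n" "i < N" for j i
  proof (cases "j = n")
    case True
    have "(\<Sum>a<Suc n. r' a n * q' a i) = (\<Sum>a<n. h a * q a i) + u i"
      using \<nu>(1) by (simp add: r'_def q'_def)
    then show ?thesis by (simp add: True u_def)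
  next
    case False
    then have "j < n" using that by simp
    have "(\<Sum>a<Suc j. r' a j * q' a i) = (\<Sum>a<Suc j. r a j * q a i)"
      using \<open>j < n\<close> by (intro sum.cong) (auto simp: r'_def q'_def)
    then show ?thesis using r[OF \<open>j < n\<close> that(2)] by simp
  qed
  moreover have "q' a i = (\<Sum>j<Suc n. s' a j * v j i)" if "a < Suc n" "i < N" for a i
  proof (cases "a = n")
    case True
    then show ?thesis using u_c[OF that(2)]
      by (simp add: q'_def s'_def sum_divide_distrib[symmetric] add_divide_distrib)
  next
    case False
    then show ?thesis using s[of a i] that by (simp add: q'_def s'_def)
  qed
  ultimately show ?case by blast
qed

lemma mult_mat_vec_index:
  assumes "A \<in> carrier_mat m n" "v \<in> carrier_vec n" "i < m"
  shows "(A *\<^sub>v v) $ i = (\<Sum>j<n. A $$ (i,j) * v $ j)"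
  using assms by (auto simp: scalar_prod_def lessThan_atLeast0)

lemma mult_mat_index:
  assumes "A \<in> carrier_mat m n" "B \<in> carrier_mat n p" "i < m" "j < p"
  shows "(A * B) $$ (i,j) = (\<Sum>l<n. A $$ (i,l) * B $$ (l,j))"
  using assms by (auto simp: scalar_prod_def lessThan_atLeast0)

text \<open>The decoder picks its factorisation by \<open>SOME\<close>; existence guarantees that
  the pick is a genuine thin QR factorisation.\<close>

lemma thin_QR_exists:
  assumes M: "M \<in> carrier_mat N n"
    and inj: "\<And>x. x \<in> carrier_vec n \<Longrightarrow> M *\<^sub>v x = 0\<^sub>v N \<Longrightarrow> x = 0\<^sub>v n"
  shows "\<exists>Q R. thin_QR M Q R"
proof -
  have "c j = 0" if c: "\<And>i. i < N \<Longrightarrow> (\<Sum>j<n. c j * M $$ (i,j)) = 0" and j: "j < n" for c j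
  proof -
    have "M *\<^sub>v vec n c = 0\<^sub>v N"
    proof (rule eq_vecI)
      fix i assume "i < dim_vec (0\<^sub>v N :: complex vec)"
      then show "(M *\<^sub>v vec n c) $ i = 0\<^sub>v N $ i"
        using c[of i] mult_mat_vec_index[OF M vec_carrier[of n c], of i] by (simp add: mult.commute)
    qed (use M in auto)
    from inj[OF vec_carrier this] have "vec n c $ j = 0" using j by simp
    then show ?thesis using j by simp
  qed
  then have "\<forall>c. (\<forall>i<N. (\<Sum>j<n. c j * M $$ (i,j)) = 0) \<longrightarrow> (\<forall>j<n. c j = 0)" by blast
  from gram_schmidt_coordinates[where v = "\<lambda>j i. M $$ (i,j)", OF this]
  obtain q r where "\<forall>a<n. \<forall>b<n. (\<Sum>i<N. cnj (q a i) * q b i) = (if a = b then 1 else 0)"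
    "\<forall>j<n. \<forall>i<N. M $$ (i,j) = (\<Sum>a<Suc j. r a j * q a i)" by (elim exE conjE)
  note q = this(1)[rule_format] and r = this(2)[rule_format]
  define Q where "Q = mat N n (\<lambda>(i,a). q a i)"
  define R where "R = mat n n (\<lambda>(a,j). if a \<le> j then r a j else 0)"
  have Qc: "Q \<in> carrier_mat N n" and Rc: "R \<in> carrier_mat n n" by (auto simp: Q_def R_def)
  have Qa: "cadj Q \<in> carrier_mat n N" using Qc by (auto simp: cadj_def)
  have "cadj Q * Q = 1\<^sub>m n"
  proof (rule eq_matI)
    fix a b assume "a < dim_row (1\<^sub>m n :: complex mat)" "b < dim_col (1\<^sub>m n :: complex mat)"
    then have ab: "a < n" "b < n" by auto
    have "(cadj Q * Q) $$ (a,b) = (\<Sum>i<N. cnj (q a i) * q b i)"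
      unfolding mult_mat_index[OF Qa Qc ab] using ab by (intro sum.cong) (auto simp: cadj_def Q_def)
    then show "(cadj Q * Q) $$ (a,b) = 1\<^sub>m n $$ (a,b)" using q[OF ab] ab by simp
  qed (use Qa Qc in auto)
  moreover have "M = Q * R"
  proof (rule eq_matI)
    fix i j assume "i < dim_row (Q * R)" "j < dim_col (Q * R)"
    then have ij: "i < N" "j < n" using Qc Rc by auto
    have "(Q * R) $$ (i,j) = (\<Sum>a<n. if a < Suc j then r a j * q a i else 0)"
      unfolding mult_mat_index[OF Qc Rc ij] using ij by (intro sum.cong) (auto simp: Q_def R_def)
    also have "\<dots> = (\<Sum>a<Suc j. r a j * q a i)"
      using ij by (intro sum.mono_neutral_cong_right) auto
    finally show "M $$ (i,j) = (Q * R) $$ (i,j)" using r[OF ij(2,1)] by simp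
  qed (use Qc Rc M in auto)
  moreover have "upper_triangular R" by (auto simp: R_def upper_triangular_def)
  ultimately show ?thesis using M Qc Rc unfolding thin_QR_def by auto
qed

lemma back_substitution:
  fixes r :: "nat \<Rightarrow> nat \<Rightarrow> complex"
  assumes "\<And>i. i < p \<Longrightarrow> r i i \<noteq> 0"
  shows "\<exists>u. \<forall>i<p. (\<Sum>j\<in>{i..<p}. r i j * u j) = g i"
  using assms
proof (induction p arbitrary: g)
  case (Suc p)
  define t where "t = g p / r p p"
  from Suc.IH[of "\<lambda>i. g i - r i p * t"] Suc.prems
  obtain u where u: "\<And>i. i < p \<Longrightarrow> (\<Sum>j\<in>{i..<p}. r i j * u j) = g i - r i p * t" by auto
  have "(\<Sum>j\<in>{i..<Suc p}. r i j * (u(p := t)) j) = g i" if "i < Suc p" for i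
  proof (cases "i = p")
    case True
    then show ?thesis using Suc.prems[of p] by (simp add: t_def)
  next
    case False
    then have "i < p" using that by simp
    then have "(\<Sum>j\<in>{i..<p}. r i j * (u(p := t)) j) = (\<Sum>j\<in>{i..<p}. r i j * u j)"
      by (intro sum.cong) auto
    then show ?thesis using u[OF \<open>i < p\<close>] \<open>i < p\<close> by simp
  qed
  then show ?case by blast
qed simp

text \<open>The first n - k coordinates are chosen, over the complex numbers and not in the
  constellation, so that the upper rows of R x vanish. Then R x has only the entries of
  \<open>lr_block k R\<close> times \<open>d\<close>, and a small partial residual gives a small
  full image M x.\<close>

lemma thin_QR_lift:
  assumes M: "M \<in> carrier_mat N n" and QR: "thin_QR M Q R"
    and inj: "\<And>x. x \<in> carrier_vec n \<Longrightarrow> M *\<^sub>v x = 0\<^sub>v N \<Longrightarrow> x = 0\<^sub>v n"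
    and d: "d \<in> carrier_vec k" "k \<le> n" and "0 \<le> Y"
    and Y: "\<And>i. i < k \<Longrightarrow> cmod ((lr_block k R *\<^sub>v d) $ i) \<le> Y"
  shows "\<exists>x\<in>carrier_vec n. last_k k x = d \<and> (\<forall>a<N. cmod ((M *\<^sub>v x) $ a) \<le> real n * Y)"
proof -
  have Q: "Q \<in> carrier_mat N n" and R: "R \<in> carrier_mat n n" and orth: "cadj Q * Q = 1\<^sub>m n"
    and ut: "upper_triangular R" and eq: "M = Q * R"
    using QR M by (auto simp: thin_QR_def)
  have "Determinant.det R \<noteq> 0"
  proof
    assume "Determinant.det R = 0"
    then obtain v where v: "v \<in> carrier_vec n" "v \<noteq> 0\<^sub>v n" "R *\<^sub>v v = 0\<^sub>v n"
      using det_0_iff_vec_prod_zero[OF R] by auto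
    have "M *\<^sub>v v = Q *\<^sub>v (R *\<^sub>v v)" unfolding eq using Q R v(1) by (rule assoc_mult_mat_vec)
    also have "\<dots> = 0\<^sub>v N" unfolding v(3) using Q by auto
    finally show False using inj v by blast
  qed
  then have diag: "R $$ (i,i) \<noteq> 0" if "i < n" for i
    using that R unfolding det_upper_triangular[OF ut R] by (auto simp: prod_list_zero_iff diag_mat_def)
  have low: "R $$ (i,j) = 0" if "j < i" "i < n" for i j
    using ut that R unfolding upper_triangular_def by auto
  define p where "p = n - k"
  have np: "n = p + k" using d(2) by (simp add: p_def)
  \<comment> \<open>The free coordinates cancel the contribution of \<open>d\<close> to the first
    \<open>p\<close> rows, by solving a triangular system with nonzero diagonal.\<close>
  obtain u where u: "\<And>i. i < p \<Longrightarrow> (\<Sum>j\<in>{i..<p}. R $$ (i,j) * u j) = - (\<Sum>j<k. R $$ (i,p+j) * d $ j)"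
    using back_substitution[of p "\<lambda>i j. R $$ (i,j)" "\<lambda>i. - (\<Sum>j<k. R $$ (i,p+j) * d $ j)"] diag np by auto
  define x where "x = vec n (\<lambda>j. if j < p then u j else d $ (j - p))"
  have x: "x \<in> carrier_vec n" by (simp add: x_def)
  have split: "(\<Sum>j<n. f j) = (\<Sum>j<p. f j) + (\<Sum>j<k. f (p + j))" for f :: "nat \<Rightarrow> complex"
    unfolding np by (induction k) (auto simp: add.assoc)
  have Rx: "(R *\<^sub>v x) $ i = (\<Sum>j<p. R $$ (i,j) * u j) + (\<Sum>j<k. R $$ (i,p+j) * d $ j)" if "i < n" for i
    unfolding mult_mat_vec_index[OF R x that] split using np by (simp add: x_def)
  have Rx_bound: "cmod ((R *\<^sub>v x) $ i) \<le> Y" if i: "i < n" for i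
  proof (cases "i < p")
    case True
    have "(\<Sum>j<p. R $$ (i,j) * u j) = (\<Sum>j\<in>{i..<p}. R $$ (i,j) * u j)"
      using low i by (intro sum.mono_neutral_right) auto
    then show ?thesis using Rx[OF i] u[OF True] \<open>0 \<le> Y\<close> by simp
  next
    case False
    then obtain l where l: "i = p + l" "l < k" using i np by (metis le_add_diff_inverse nat_add_left_cancel_less not_less)
    have "(\<Sum>j<p. R $$ (i,j) * u j) = 0" using low i False by (intro sum.neutral) auto
    moreover have "(lr_block k R *\<^sub>v d) $ l = (\<Sum>j<k. R $$ (i,p+j) * d $ j)"
      using mult_mat_vec_index[of "lr_block k R" k k d l] d(1) l R
      by (simp add: lr_block_def p_def)
    ultimately show ?thesis using Rx[OF i] Y[OF l(2)] by simp
  qed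
  \<comment> \<open>The columns of Q are unit vectors; this yields the factor n when passing from R
    x to Q R x.\<close>
  have Q1: "cmod (Q $$ (a,b)) \<le> 1" if "a < N" "b < n" for a b
  proof -
    have Qa: "cadj Q \<in> carrier_mat n N" using Q by (auto simp: cadj_def)
    have "(\<Sum>i<N. cnj (Q $$ (i,b)) * Q $$ (i,b)) = (cadj Q * Q) $$ (b,b)"
      unfolding mult_mat_index[OF Qa Q that(2) that(2)] using that Q by (intro sum.cong) (auto simp: cadj_def)
    also have "\<dots> = 1" unfolding orth using that by simp
    finally have "of_real (\<Sum>i<N. (cmod (Q $$ (i,b)))\<^sup>2) = (1::complex)"
      by (simp add: complex_norm_square mult.commute del: of_real_power)
    then have "(\<Sum>i<N. (cmod (Q $$ (i,b)))\<^sup>2) = 1" by (simp only: of_real_eq_1_iff)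
    then have "(cmod (Q $$ (a,b)))\<^sup>2 \<le> 1"
      using member_le_sum[of a "{..<N}" "\<lambda>i. (cmod (Q $$ (i,b)))\<^sup>2"] that by simp
    then show ?thesis by (simp add: abs_square_le_1)
  qed
  have "cmod ((M *\<^sub>v x) $ a) \<le> real n * Y" if a: "a < N" for a
  proof -
    have Rxc: "R *\<^sub>v x \<in> carrier_vec n" by (rule mult_mat_vec_carrier[OF R x])
    have "(M *\<^sub>v x) $ a = (Q *\<^sub>v (R *\<^sub>v x)) $ a" unfolding eq using assoc_mult_mat_vec[OF Q R x] by simp
    also have "\<dots> = (\<Sum>b<n. Q $$ (a,b) * (R *\<^sub>v x) $ b)" by (rule mult_mat_vec_index[OF Q Rxc a])
    also have "cmod \<dots> \<le> (\<Sum>b<n. Y)"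
    proof (rule sum_norm_le)
      fix b assume b: "b \<in> {..<n}"
      then show "cmod (Q $$ (a,b) * (R *\<^sub>v x) $ b) \<le> Y"
        using mult_mono[OF Q1[OF a, of b] Rx_bound[of b]] by (simp add: norm_mult)
    qed
    finally show ?thesis by simp
  qed
  moreover have "last_k k x = d"
    using d np by (intro eq_vecI) (auto simp: last_k_def x_def)
  ultimately show ?thesis using x by blast
qed

section \<open>Counting the points visited by the sphere decoder\<close>

lemma sum_blocks: "(\<Sum>e<nt * T. f e) = (\<Sum>t<T. \<Sum>i<nt. f (t * nt + i))" for f :: "nat \<Rightarrow> 'a::comm_monoid_add"
proof -
  have "(\<Sum>e<nt * T. f e) = (\<Sum>t<T. sum f {t * nt..<t * nt + nt})"
    by (simp add: sum.nat_group mult.commute)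
  also have "\<dots> = (\<Sum>t<T. \<Sum>i<nt. f (t * nt + i))"
  proof (rule sum.cong[OF refl])
    fix t
    show "sum f {t * nt..<t * nt + nt} = (\<Sum>i<nt. f (t * nt + i))"
      using sum.shift_bounds_nat_ivl[of f 0 "t * nt" nt] by (simp add: add.commute lessThan_atLeast0)
  qed
  finally show ?thesis .
qed

lemma block_index_less: "t * n + i < n * T" if "t < T" "i < n" for t n i T :: nat
proof -
  have "t * n + i < Suc t * n" using that by simp
  also have "\<dots> \<le> T * n" using that by (intro mult_le_mono1) simp
  finally show ?thesis by (simp add: mult.commute)
qed

lemma Mmat_carrier:
  assumes "G \<in> carrier_mat (nt * T) (nt * T)"
  shows "Mmat T G th (Hmat nr nt h) \<in> carrier_mat (nr * T) (nt * T)"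
  using assms by (auto simp: Mmat_def kron_I_def Hmat_def mult.commute)

lemma Mmat_apply:
  assumes G: "G \<in> carrier_mat (nt * T) (nt * T)" and x: "x \<in> carrier_vec (nt * T)"
    and "t < T" "i < nr"
  shows "(Mmat T G th (Hmat nr nt h) *\<^sub>v x) $ (t * nr + i) =
    of_real th * (\<Sum>j<nt. h (i,j) * (G *\<^sub>v x) $ (t * nt + j))"
proof -
  let ?K = "kron_I T (Hmat nr nt h)"
  have K: "?K \<in> carrier_mat (nr * T) (nt * T)" by (auto simp: kron_I_def Hmat_def mult.commute)
  have Gx: "G *\<^sub>v x \<in> carrier_vec (nt * T)" using G x by (rule mult_mat_vec_carrier)
  have lt: "t * nr + i < nr * T" using block_index_less assms by blast
  have KG: "?K * G \<in> carrier_mat (nr * T) (nt * T)" using K G by (rule mult_carrier_mat)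
  have "Mmat T G th (Hmat nr nt h) *\<^sub>v x = of_real th \<cdot>\<^sub>v (?K *\<^sub>v (G *\<^sub>v x))"
    unfolding Mmat_def assoc_mult_mat_vec[OF K G x, symmetric]
  proof (rule eq_vecI)
    fix e assume e0: "e < dim_vec (complex_of_real th \<cdot>\<^sub>v (?K * G *\<^sub>v x))"
    then have e: "e < nr * T" using K by simp
    have sKG: "complex_of_real th \<cdot>\<^sub>m (?K * G) \<in> carrier_mat (nr * T) (nt * T)" using KG by simp
    show "(complex_of_real th \<cdot>\<^sub>m (?K * G) *\<^sub>v x) $ e = (complex_of_real th \<cdot>\<^sub>v (?K * G *\<^sub>v x)) $ e"
      unfolding mult_mat_vec_index[OF sKG x e] index_smult_vec(1)[OF e0[unfolded index_smult_vec(2)]]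
        mult_mat_vec_index[OF KG x e] sum_distrib_left
      using K G e by (intro sum.cong) auto
  qed simp
  then have "(Mmat T G th (Hmat nr nt h) *\<^sub>v x) $ (t * nr + i) = of_real th * (?K *\<^sub>v (G *\<^sub>v x)) $ (t * nr + i)"
    using lt K by simp
  also have "(?K *\<^sub>v (G *\<^sub>v x)) $ (t * nr + i) = (\<Sum>e<nt * T. ?K $$ (t * nr + i, e) * (G *\<^sub>v x) $ e)"
    by (rule mult_mat_vec_index[OF K Gx lt])
  also have "\<dots> = (\<Sum>t'<T. \<Sum>j<nt. ?K $$ (t * nr + i, t' * nt + j) * (G *\<^sub>v x) $ (t' * nt + j))"
    by (rule sum_blocks)
  also have "\<dots> = (\<Sum>t'<T. if t' = t then \<Sum>j<nt. h (i,j) * (G *\<^sub>v x) $ (t * nt + j) else 0)"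
  proof (rule sum.cong[OF refl])
    fix t' assume t': "t' \<in> {..<T}"
    have "?K $$ (t * nr + i, t' * nt + j) = (if t' = t then h (i,j) else 0)" if "j < nt" for j
      using lt block_index_less[of t' T j nt] t' that assms(4)
      by (simp add: kron_I_def Hmat_def mult.commute)
    then show "(\<Sum>j<nt. ?K $$ (t * nr + i, t' * nt + j) * (G *\<^sub>v x) $ (t' * nt + j)) =
      (if t' = t then \<Sum>j<nt. h (i,j) * (G *\<^sub>v x) $ (t * nt + j) else 0)" by simp
  qed
  also have "\<dots> = (\<Sum>j<nt. h (i,j) * (G *\<^sub>v x) $ (t * nt + j))" using assms(3) by simp
  finally show ?thesis .
qed

text \<open>The permutations and pivots are parameters, so the counting bound holds for every
  complete pivoting of the channel.\<close>

definition pivot_profile :: "nat \<Rightarrow> nat \<Rightarrow> (nat \<times> nat \<Rightarrow> complex) \<Rightarrow> (nat \<Rightarrow> nat) \<Rightarrow> (nat \<Rightarrow> nat) \<Rightarrow> (nat \<Rightarrow> complex) \<Rightarrow> bool" where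
  "pivot_profile nr nt h \<sigma> \<tau> p \<longleftrightarrow> \<sigma> permutes {..<nr} \<and> \<tau> permutes {..<nt} \<and>
     pivoted nr nt (\<lambda>a b. h (\<sigma> a, \<tau> b)) \<and> (\<forall>m. p m = schur (\<lambda>a b. h (\<sigma> a, \<tau> b)) m m m) \<and> (\<forall>m<nt. p m \<noteq> 0)"

text \<open>In each time slot, G x is recovered from its elimination coordinates, and x from G x. So
  x is a combination of \<kappa> directions bounded independently of the channel, with coefficients
  controlled by the size of the image divided by the pivots.\<close>

lemma coordinates_from_image:
  assumes G: "G \<in> carrier_mat (nt * T) (nt * T)" and Gi: "Gi \<in> carrier_mat (nt * T) (nt * T)"
    and inv: "Gi * G = 1\<^sub>m (nt * T)"
    and \<gamma>: "\<And>i j. i < nt * T \<Longrightarrow> j < nt * T \<Longrightarrow> cmod (Gi $$ (i,j)) \<le> \<gamma>"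
    and "nt \<le> nr" "th \<noteq> 0" and prof: "pivot_profile nr nt h \<sigma> \<tau> p"
  obtains c where "\<And>j l. l < nt * T \<Longrightarrow> j \<in> {..<nt} \<times> {..<T} \<Longrightarrow> cmod (c j l) \<le> real nt * (\<gamma> * (real nt + 1) ^ nt)"
    and "\<And>x Y. x \<in> carrier_vec (nt * T) \<Longrightarrow> (\<And>a. a < nr * T \<Longrightarrow> cmod ((Mmat T G th (Hmat nr nt h) *\<^sub>v x) $ a) \<le> Y) \<Longrightarrow>
      \<exists>w. (\<forall>(m,t)\<in>{..<nt} \<times> {..<T}. cmod (w (m,t)) \<le> 2 ^ nt * (Y / \<bar>th\<bar>) / cmod (p m)) \<and>
        (\<forall>l<nt * T. x $ l = (\<Sum>j\<in>{..<nt} \<times> {..<T}. w j * c j l))"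
proof -
  let ?\<kappa> = "nt * T"
  define B where "B = (\<lambda>a b. h (\<sigma> a, \<tau> b))"
  have \<sigma>: "\<sigma> permutes {..<nr}" and \<tau>: "\<tau> permutes {..<nt}" and piv: "pivoted nr nt B"
    and p: "\<And>m. p m = schur B m m m" and p0: "\<And>m. m < nt \<Longrightarrow> p m \<noteq> 0"
    using prof by (auto simp: pivot_profile_def B_def)
  have nz: "\<And>m. m < nt \<Longrightarrow> schur B m m m \<noteq> 0" using p0 p by simp
  obtain V where V: "\<And>i j. i < nt \<Longrightarrow> cmod (V i j) \<le> (real nt + 1) ^ nt"
    "\<And>x i. i < nt \<Longrightarrow> (\<Sum>j<nt. V i j * elim_coord nt B x j) = x i"
    using elim_coord_inverse[OF piv nz \<open>nt \<le> nr\<close>] by blast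
  have \<tau>lt: "\<tau> b < nt" if "b < nt" for b using permutes_in_image[OF \<tau>] that by auto
  have \<sigma>lt: "\<sigma> a < nr" if "a < nr" for a using permutes_in_image[OF \<sigma>] that by auto
  \<comment> \<open>Direction \<open>(m, t)\<close>: column \<open>m\<close> of the inverse upper
    factor, with the column permutation undone, placed in slot \<open>t\<close> and mapped through
    the inverse generator.\<close>
  define c where "c = (\<lambda>(m,t) l. \<Sum>b<nt. Gi $$ (l, t * nt + \<tau> b) * V b m)"
  show thesis
  proof (rule that[of c])
    fix j l assume l: "l < ?\<kappa>" and j: "j \<in> {..<nt} \<times> {..<T}"
    obtain m t where mt: "j = (m,t)" "m < nt" "t < T" using j by auto
    have "cmod (c j l) \<le> (\<Sum>b<nt. \<gamma> * (real nt + 1) ^ nt)"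
      unfolding mt c_def prod.case
    proof (rule sum_norm_le)
      fix b assume "b \<in> {..<nt}"
      then have b: "b < nt" by simp
      have "cmod (Gi $$ (l, t * nt + \<tau> b)) \<le> \<gamma>" using \<gamma>[OF l] block_index_less[OF mt(3) \<tau>lt[OF b]] by blast
      moreover from this have "0 \<le> \<gamma>" using norm_ge_zero order_trans by blast
      ultimately show "cmod (Gi $$ (l, t * nt + \<tau> b) * V b m) \<le> \<gamma> * (real nt + 1) ^ nt"
        unfolding norm_mult using V(1)[OF b] by (intro mult_mono) auto
    qed
    then show "cmod (c j l) \<le> real nt * (\<gamma> * (real nt + 1) ^ nt)" by simp
  next
    fix x Y assume x: "x \<in> carrier_vec ?\<kappa>"
      and Y: "\<And>a. a < nr * T \<Longrightarrow> cmod ((Mmat T G th (Hmat nr nt h) *\<^sub>v x) $ a) \<le> Y"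
    define X where "X t b = (G *\<^sub>v x) $ (t * nt + \<tau> b)" for t b
    define w where "w = (\<lambda>(m,t). elim_coord nt B (X t) m)"
    have "cmod (w (m,t)) \<le> 2 ^ nt * (Y / \<bar>th\<bar>) / cmod (p m)" if mt: "m < nt" "t < T" for m t
    proof -
      have row: "cmod (\<Sum>b<nt. B a b * X t b) \<le> Y / \<bar>th\<bar>" if a: "a < nr" for a
      proof -
        have "(\<Sum>b<nt. B a b * X t b) = (\<Sum>j<nt. h (\<sigma> a, j) * (G *\<^sub>v x) $ (t * nt + j))"
          unfolding B_def X_def
          using sum.permute[OF \<tau>, of "\<lambda>j. h (\<sigma> a, j) * (G *\<^sub>v x) $ (t * nt + j)"] by (simp add: o_def)
        moreover have "cmod (of_real th * (\<Sum>j<nt. h (\<sigma> a, j) * (G *\<^sub>v x) $ (t * nt + j))) \<le> Y"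
          using Mmat_apply[OF G x mt(2) \<sigma>lt[OF a], of th h] Y[OF block_index_less[OF mt(2) \<sigma>lt[OF a]]]
          by simp
        ultimately show ?thesis using \<open>th \<noteq> 0\<close> by (simp add: norm_mult field_simps)
      qed
      have "0 \<le> Y / \<bar>th\<bar>" using order_trans[OF norm_ge_zero row[of m]] mt \<open>nt \<le> nr\<close> by simp
      have "cmod (w (m,t)) \<le> 2 ^ m * (Y / \<bar>th\<bar>) / cmod (p m)"
        unfolding w_def prod.case p using elim_coord_bound[OF piv nz \<open>nt \<le> nr\<close> row mt(1)] .
      also have "\<dots> \<le> 2 ^ nt * (Y / \<bar>th\<bar>) / cmod (p m)"
        using mt(1) \<open>0 \<le> Y / \<bar>th\<bar>\<close> by (intro divide_right_mono mult_right_mono power_increasing) auto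
      finally show ?thesis .
    qed
    moreover have "x $ l = (\<Sum>j\<in>{..<nt} \<times> {..<T}. w j * c j l)" if l: "l < ?\<kappa>" for l
    proof -
      have Gx: "G *\<^sub>v x \<in> carrier_vec ?\<kappa>" using G x by (rule mult_mat_vec_carrier)
      have "x = Gi *\<^sub>v (G *\<^sub>v x)"
        using assoc_mult_mat_vec[OF Gi G x] inv x by simp
      then have "x $ l = (Gi *\<^sub>v (G *\<^sub>v x)) $ l" by simp
      also have "\<dots> = (\<Sum>e<?\<kappa>. Gi $$ (l,e) * (G *\<^sub>v x) $ e)" by (rule mult_mat_vec_index[OF Gi Gx l])
      also have "\<dots> = (\<Sum>t<T. \<Sum>i<nt. Gi $$ (l,t * nt + i) * (G *\<^sub>v x) $ (t * nt + i))" by (rule sum_blocks)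
      also have "\<dots> = (\<Sum>t<T. \<Sum>b<nt. Gi $$ (l,t * nt + \<tau> b) * X t b)"
      proof (rule sum.cong[OF refl])
        fix t
        show "(\<Sum>i<nt. Gi $$ (l,t * nt + i) * (G *\<^sub>v x) $ (t * nt + i)) =
            (\<Sum>b<nt. Gi $$ (l,t * nt + \<tau> b) * X t b)"
          using sum.permute[OF \<tau>, of "\<lambda>i. Gi $$ (l,t * nt + i) * (G *\<^sub>v x) $ (t * nt + i)"]
          by (simp add: o_def X_def)
      qed
      also have "\<dots> = (\<Sum>t<T. \<Sum>b<nt. \<Sum>m<nt. Gi $$ (l,t * nt + \<tau> b) * (V b m * w (m,t)))"
        using V(2) by (intro sum.cong refl) (simp add: w_def sum_distrib_left[symmetric])
      also have "\<dots> = (\<Sum>t<T. \<Sum>m<nt. \<Sum>b<nt. Gi $$ (l,t * nt + \<tau> b) * (V b m * w (m,t)))"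
        by (intro sum.cong refl sum.swap)
      also have "\<dots> = (\<Sum>m<nt. \<Sum>t<T. w (m,t) * c (m,t) l)"
        by (subst sum.swap) (simp add: c_def sum_distrib_left mult_ac)
      also have "\<dots> = (\<Sum>j\<in>{..<nt} \<times> {..<T}. w j * c j l)"
        by (simp add: sum.cartesian_product case_prod_beta)
      finally show ?thesis .
    qed
    ultimately show "\<exists>w. (\<forall>(m,t)\<in>{..<nt} \<times> {..<T}. cmod (w (m,t)) \<le> 2 ^ nt * (Y / \<bar>th\<bar>) / cmod (p m)) \<and>
        (\<forall>l<?\<kappa>. x $ l = (\<Sum>j\<in>{..<nt} \<times> {..<T}. w j * c j l))"
      by (intro exI[of _ w]) auto
  qed
qed

lemma det_nonzero_left_inverse:
  fixes G :: "complex mat"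
  assumes "G \<in> carrier_mat n n" "Determinant.det G \<noteq> 0"
  obtains Gi where "Gi \<in> carrier_mat n n" "Gi * G = 1\<^sub>m n"
  using det_non_zero_imp_unit[OF assms, of "()"] unfolding Units_def ring_mat_def by auto

lemma cmod_index_le_sqnorm:
  fixes v :: "complex vec"
  assumes "sqnorm v \<le> y" "i < dim_vec v"
  shows "cmod (v $ i) \<le> sqrt y"
proof -
  have "cmod (v $ i) * cmod (v $ i) \<le> sqnorm v"
    unfolding sqnorm_def using assms(2) by (intro member_le_sum) auto
  then have "(cmod (v $ i))\<^sup>2 \<le> y" using assms(1) by (simp add: power2_eq_square)
  then show ?thesis by (rule real_le_rsqrt)
qed

lemma Qalph_separated:
  assumes "x \<in> Qalph \<eta>" "y \<in> Qalph \<eta>" "x \<noteq> y"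
  shows "1 \<le> cmod (x - y)"
proof -
  have ints: "Re (x - y) \<in> \<int>" "Im (x - y) \<in> \<int>" using assms by (auto simp: Qalph_def)
  have one: "1 \<le> \<bar>t\<bar>" if "t \<in> \<int>" "t \<noteq> 0" for t :: real using that by (auto elim!: Ints_cases)
  have "Re (x - y) \<noteq> 0 \<or> Im (x - y) \<noteq> 0" using assms(3) by (auto simp: complex_eq_iff)
  then show ?thesis
    using one ints abs_Re_le_cmod[of "x - y"] abs_Im_le_cmod[of "x - y"] order_trans by blast
qed

lemma Qalph_diameter:
  assumes "x \<in> Qalph \<eta>" "y \<in> Qalph \<eta>"
  shows "cmod (x - y) \<le> 4 * \<eta>"
  using cmod_le[of "x - y"] assms by (auto simp: Qalph_def)

text \<open>Only differences of visited points enter, so the received vector cancels and with it the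
  dependence on symbol and noise. Each pivot serves \<open>T\<close> directions, one per slot, and
  each complex direction contributes a square: hence the power \<open>2 * T\<close>.\<close>

lemma SD_count_bound:
  assumes G: "G \<in> carrier_mat (nt * T) (nt * T)" "Determinant.det G \<noteq> 0" and "nt \<le> nr"
  shows "\<exists>C>0. \<forall>\<eta> th \<xi> s h w \<sigma> \<tau> p. th \<noteq> 0 \<longrightarrow> 0 \<le> \<xi> \<longrightarrow> 0 \<le> \<eta> \<longrightarrow> pivot_profile nr nt h \<sigma> \<tau> p \<longrightarrow>
    real (SD_count nt nr T G \<eta> th (\<xi>\<^sup>2) s (h, w)) \<le>
      C * (\<Prod>m<nt. (1 + min (C * \<xi> / (\<bar>th\<bar> * cmod (p m))) (4 * \<eta>)) ^ (2 * T))"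
proof -
  let ?\<kappa> = "nt * T" and ?J = "{..<nt} \<times> {..<T}"
  obtain Gi where Gi: "Gi \<in> carrier_mat ?\<kappa> ?\<kappa>" "Gi * G = 1\<^sub>m ?\<kappa>"
    using det_nonzero_left_inverse[OF G] by blast
  define \<gamma> where "\<gamma> = (\<Sum>(i,j)\<in>{..<?\<kappa>} \<times> {..<?\<kappa>}. cmod (Gi $$ (i,j)))"
  have \<gamma>: "cmod (Gi $$ (i,j)) \<le> \<gamma>" if "i < ?\<kappa>" "j < ?\<kappa>" for i j
    using member_le_sum[of "(i,j)" "{..<?\<kappa>} \<times> {..<?\<kappa>}" "\<lambda>(i,j). cmod (Gi $$ (i,j))"] that
    by (auto simp: \<gamma>_def)
  have \<gamma>0: "0 \<le> \<gamma>" unfolding \<gamma>_def by (intro sum_nonneg) auto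
  define \<beta> where "\<beta> = real nt * (\<gamma> * (real nt + 1) ^ nt)"
  have \<beta>0: "0 \<le> \<beta>" using \<gamma>0 by (simp add: \<beta>_def)
  obtain C where "C > 0" and C: "\<And>S b W D c k. 0 < k \<Longrightarrow> 0 \<le> D \<Longrightarrow> separated k 1 D S \<Longrightarrow> (\<forall>j\<in>?J. 0 \<le> W j) \<Longrightarrow>
      (\<forall>j\<in>?J. \<forall>i<k. cmod (b j i) \<le> \<beta>) \<Longrightarrow> (\<forall>d\<in>S. spanned k ?J c b W d) \<Longrightarrow>
      real (card S) \<le> C * (\<Prod>j\<in>?J. (1 + min (W j) D)\<^sup>2)"
    using card_separated_spanned[of ?J 1 \<beta>] \<beta>0 by auto
  \<comment> \<open>The factor 2 comes from the difference of two residuals, \<kappa> from the lift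
    through the QR factorisation, \<open>2 ^ nt\<close> from forward substitution.\<close>
  define C2 where "C2 = 2 ^ nt * (real ?\<kappa> * 2)"
  define C3 where "C3 = max (real ?\<kappa> * C) C2 + 1"
  have C2: "0 \<le> C2" by (simp add: C2_def)
  have C3: "0 < C3" "real ?\<kappa> * C \<le> C3" "C2 \<le> C3" using C2 by (auto simp: C3_def)
  show ?thesis
  proof (intro exI[of _ C3] conjI allI impI C3(1))
    fix \<eta> th \<xi> :: real and s h w \<sigma> \<tau> p
    assume th: "th \<noteq> 0" and \<xi>: "0 \<le> \<xi>" and \<eta>: "0 \<le> \<eta>" and prof: "pivot_profile nr nt h \<sigma> \<tau> p"
    define M where "M = Mmat T G th (Hmat nr nt h)"
    have M: "M \<in> carrier_mat (nr * T) ?\<kappa>" unfolding M_def by (rule Mmat_carrier[OF G(1)])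
    obtain c where c: "\<And>j l. l < ?\<kappa> \<Longrightarrow> j \<in> ?J \<Longrightarrow> cmod (c j l) \<le> \<beta>"
      and rep: "\<And>x Y. x \<in> carrier_vec ?\<kappa> \<Longrightarrow> (\<And>a. a < nr * T \<Longrightarrow> cmod ((M *\<^sub>v x) $ a) \<le> Y) \<Longrightarrow>
        \<exists>w. (\<forall>(m,t)\<in>?J. cmod (w (m,t)) \<le> 2 ^ nt * (Y / \<bar>th\<bar>) / cmod (p m)) \<and>
        (\<forall>l<?\<kappa>. x $ l = (\<Sum>j\<in>?J. w j * c j l))"
      using coordinates_from_image[OF G(1) Gi \<gamma> \<open>nt \<le> nr\<close> th prof, of thesis] unfolding \<beta>_def M_def by blast
    \<comment> \<open>A zero image forces all coefficients to be zero, so nonzero pivots make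
      \<open>M\<close> injective and the QR results apply.\<close>
    have inj: "x = 0\<^sub>v ?\<kappa>" if x: "x \<in> carrier_vec ?\<kappa>" and Mx: "M *\<^sub>v x = 0\<^sub>v (nr * T)" for x
    proof -
      obtain w where w: "\<forall>(m,t)\<in>?J. cmod (w (m,t)) \<le> 2 ^ nt * (0 / \<bar>th\<bar>) / cmod (p m)"
        "\<forall>l<?\<kappa>. x $ l = (\<Sum>j\<in>?J. w j * c j l)"
        using rep[OF x, of 0] Mx by auto
      have "w j = 0" if "j \<in> ?J" for j using w(1) that by auto
      then have "x $ l = 0" if "l < ?\<kappa>" for l using w(2) that by (auto intro: sum.neutral)
      then show ?thesis using x by (intro eq_vecI) auto
    qed
    define QR where "QR = (SOME QR. thin_QR M (fst QR) (snd QR))"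
    have QR: "thin_QR M (fst QR) (snd QR)"
      unfolding QR_def using thin_QR_exists[OF M inj] by (intro someI_ex[of "\<lambda>QR. thin_QR M (fst QR) (snd QR)"]) auto
    define rv where "rv = cadj (fst QR) *\<^sub>v recv nt nr T G th s (h, w)"
    define W where "W m = C2 * \<xi> / (\<bar>th\<bar> * cmod (p m))" for m
    have W0: "0 \<le> W m" for m using C2 \<xi> by (simp add: W_def)
    let ?S = "\<lambda>k. {sk \<in> Qvecs \<eta> k. sqnorm (last_k k rv - lr_block k (snd QR) *\<^sub>v sk) \<le> \<xi>\<^sup>2}"
    let ?P = "\<Prod>j\<in>?J. (1 + min (W (fst j)) (4 * \<eta>))\<^sup>2"
    have P0: "0 \<le> ?P" by (intro prod_nonneg) auto
    have bound: "real (card (?S k)) \<le> C * ?P" if k: "k \<in> {1..?\<kappa>}" for k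
    proof (cases "finite (?S k) \<and> ?S k \<noteq> {}")
      case False
      \<comment> \<open>An infinite set would also have \<open>card\<close> 0, so this case covers
        both.\<close>
      then have "card (?S k) = 0" by (auto simp del: Collect_empty_eq)
      then show ?thesis using \<open>C > 0\<close> P0 by simp
    next
      case True
      then obtain s0 where s0: "s0 \<in> ?S k" by blast
      have dimS: "dim_vec sk = k" if "sk \<in> ?S k" for sk using that by (auto simp: Qvecs_def)
      have QS: "sk $ i \<in> Qalph \<eta>" if "sk \<in> ?S k" "i < k" for sk :: "complex vec" and i using that by (auto simp: Qvecs_def)
      have injS: "inj_on vec_index (?S k)"
        by (rule inj_onI) (metis dimS eq_vecI)
      have lr: "lr_block k (snd QR) \<in> carrier_mat k k" by (simp add: lr_block_def)
      have "real (card (vec_index ` ?S k)) \<le> C * ?P"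
      proof (rule C[of k "4 * \<eta>" _ "\<lambda>j. W (fst j)" "\<lambda>j i. c j (?\<kappa> - k + i)" "vec_index s0"])
        show "0 < k" using k by simp
        show "0 \<le> 4 * \<eta>" using \<eta> by simp
        show "\<forall>j\<in>?J. 0 \<le> W (fst j)" using W0 by blast
        show "\<forall>j\<in>?J. \<forall>i<k. cmod (c j (?\<kappa> - k + i)) \<le> \<beta>" using c k by auto
        show "separated k 1 (4 * \<eta>) (vec_index ` ?S k)"
          unfolding separated_def
        proof (intro conjI ballI impI allI)
          show "finite (vec_index ` ?S k)" using True by blast
          fix d d' assume "d \<in> vec_index ` ?S k" "d' \<in> vec_index ` ?S k"
          then obtain a a' where a: "a \<in> ?S k" "d = vec_index a" "a' \<in> ?S k" "d' = vec_index a'" by blast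
          show "cmod (d i - d' i) \<le> 4 * \<eta>" if "i < k" for i
            unfolding a using Qalph_diameter QS a that by blast
          assume "d \<noteq> d'"
          then have "a \<noteq> a'" using a by blast
          then have "\<exists>i<k. a $ i \<noteq> a' $ i"
            using eq_vecI[of a' a] dimS[OF a(1)] dimS[OF a(3)] by auto
          then obtain i where "i < k" "a $ i \<noteq> a' $ i" by blast
          then show "\<exists>i<k. 1 \<le> cmod (d i - d' i)"
            unfolding a using Qalph_separated QS a by blast
        qed
        show "\<forall>d\<in>vec_index ` ?S k. spanned k ?J (vec_index s0) (\<lambda>j i. c j (?\<kappa> - k + i)) (\<lambda>j. W (fst j)) d"
        proof
          fix d assume "d \<in> vec_index ` ?S k"
          then obtain sk where sk: "sk \<in> ?S k" "d = vec_index sk" by blast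
          have carr: "sk \<in> carrier_vec k" "s0 \<in> carrier_vec k" using dimS sk s0 by (auto intro: carrier_vecI)
          have near: "cmod ((last_k k rv - lr_block k (snd QR) *\<^sub>v v) $ i) \<le> \<xi>" if "v \<in> ?S k" "i < k" for v i
            using cmod_index_le_sqnorm[of "last_k k rv - lr_block k (snd QR) *\<^sub>v v" "\<xi>\<^sup>2" i] that \<xi> lr by simp
          have small: "cmod ((lr_block k (snd QR) *\<^sub>v (sk - s0)) $ i) \<le> 2 * \<xi>" if i: "i < k" for i
          proof -
            have "lr_block k (snd QR) *\<^sub>v (sk - s0) = lr_block k (snd QR) *\<^sub>v sk - lr_block k (snd QR) *\<^sub>v s0"
              by (rule mult_minus_distrib_mat_vec[OF lr carr])
            then have "(lr_block k (snd QR) *\<^sub>v (sk - s0)) $ i =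
                (last_k k rv - lr_block k (snd QR) *\<^sub>v s0) $ i - (last_k k rv - lr_block k (snd QR) *\<^sub>v sk) $ i"
              using i lr by (simp add: last_k_def)
            then show ?thesis
              using norm_triangle_ineq4[of "(last_k k rv - lr_block k (snd QR) *\<^sub>v s0) $ i" "(last_k k rv - lr_block k (snd QR) *\<^sub>v sk) $ i"]
                near[OF s0 i] near[OF sk(1) i] by simp
          qed
          obtain x where x: "x \<in> carrier_vec ?\<kappa>" "last_k k x = sk - s0"
            "\<forall>a<nr * T. cmod ((M *\<^sub>v x) $ a) \<le> real ?\<kappa> * (2 * \<xi>)"
            using thin_QR_lift[OF M QR inj _ _ _ small] carr k \<xi> by (auto simp: minus_carrier_vec)
          obtain w where w: "\<forall>(m,t)\<in>?J. cmod (w (m,t)) \<le> 2 ^ nt * (real ?\<kappa> * (2 * \<xi>) / \<bar>th\<bar>) / cmod (p m)"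
            "\<forall>l<?\<kappa>. x $ l = (\<Sum>j\<in>?J. w j * c j l)"
            using rep[OF x(1), of "real ?\<kappa> * (2 * \<xi>)"] x(3) by blast
          show "spanned k ?J (vec_index s0) (\<lambda>j i. c j (?\<kappa> - k + i)) (\<lambda>j. W (fst j)) d"
            unfolding spanned_def
          proof (intro exI[of _ w] conjI ballI allI impI)
            fix j assume "j \<in> ?J"
            then show "cmod (w j) \<le> W (fst j)" using w(1) by (auto simp: W_def C2_def mult.assoc)
          next
            fix i assume i: "i < k"
            have "(sk - s0) $ i = x $ (?\<kappa> - k + i)"
              unfolding x(2)[symmetric] using i x(1) by (simp add: last_k_def)
            also have "\<dots> = (\<Sum>j\<in>?J. w j * c j (?\<kappa> - k + i))" using w(2) i k by auto
            finally show "d i = s0 $ i + (\<Sum>j\<in>?J. w j * c j (?\<kappa> - k + i))"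
              using carr i by (simp add: sk(2) algebra_simps)
          qed
        qed
      qed
      then show ?thesis using card_image[OF injS] by simp
    qed
    have "real (SD_count nt nr T G \<eta> th (\<xi>\<^sup>2) s (h, w)) = (\<Sum>k\<in>{1..?\<kappa>}. real (card (?S k)))"
      unfolding SD_count_def Let_def fst_conv M_def[symmetric] QR_def[symmetric] rv_def[symmetric] by simp
    also have "\<dots> \<le> (\<Sum>k\<in>{1..?\<kappa>}. C * ?P)" by (rule sum_mono[OF bound])
    also have "\<dots> = (real ?\<kappa> * C) * ?P" by simp
    also have "?P = (\<Prod>m<nt. (1 + min (W m) (4 * \<eta>)) ^ (2 * T))"
      by (simp add: prod.cartesian_product[symmetric] power_mult case_prod_beta split_def
          prod.cartesian_product[of "\<lambda>m t. (1 + min (W m) (4 * \<eta>))\<^sup>2", unfolded split_def, symmetric])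
    also have "(real ?\<kappa> * C) * \<dots> \<le> C3 * (\<Prod>m<nt. (1 + min (C3 * \<xi> / (\<bar>th\<bar> * cmod (p m))) (4 * \<eta>)) ^ (2 * T))"
    proof (intro mult_mono prod_mono conjI power_mono add_left_mono min.mono order_refl C3(2))
      fix m assume "m \<in> {..<nt}"
      show "W m \<le> C3 * \<xi> / (\<bar>th\<bar> * cmod (p m))"
        unfolding W_def using C3(3) \<xi> by (intro divide_right_mono mult_right_mono) auto
      show "0 \<le> 1 + min (W m) (4 * \<eta>)" using W0[of m] \<eta> by simp
      then show "0 \<le> (1 + min (W m) (4 * \<eta>)) ^ (2 * T)" by simp
    qed (use C3 W0 \<eta> in \<open>auto intro!: prod_nonneg\<close>)
    finally show "real (SD_count nt nr T G \<eta> th (\<xi>\<^sup>2) s (h, w)) \<le>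
      C3 * (\<Prod>m<nt. (1 + min (C3 * \<xi> / (\<bar>th\<bar> * cmod (p m))) (4 * \<eta>)) ^ (2 * T))" .
  qed
qed

section \<open>The optimisation problem\<close>

text \<open>With c = nr - nt and p = nt - k this is the corner value (nt - k)(nr - k) of the optimal
  tradeoff.\<close>

lemma sum_odd_weights: "(\<Sum>i=1..<Suc p. (c + 2 * real i - 1)) = real p * (c + real p)"
  by (induction p) (auto simp: algebra_simps)

text \<open>With p = nt - k, the corners at k and k + 1 differ by nr - nt + 2p - 1. So the slope of
  the tradeoff is minus the weight of variable p in the budget.\<close>

lemma dstar_floor:
  assumes "real_of_int \<lfloor>r\<rfloor> = real k" "k \<le> nt"
  shows "dstar nt nr r = real (nt - k) * (real nr - real nt + real (nt - k)) -
     (r - real k) * (real nr - real nt + 2 * real (nt - k) - 1)"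
  using assms by (simp add: dstar_def Let_def of_nat_diff algebra_simps)

text \<open>For r < nt this displays the optimum: nt - k - 1 variables equal to 1 contribute
  \<open>r / nt\<close> each, and one equal to 1 - (r - k) contributes the positive part.\<close>

lemma cbar_floor:
  assumes "real_of_int \<lfloor>r\<rfloor> = real k" "k \<le> nt" "0 < nt"
  shows "cbar nt T r = real T * ((real (nt - k) - 1) * (r / real nt) + max (r / real nt - (r - real k)) 0)"
proof -
  have "max (real nt * real k - r * (real nt - 1)) 0 = real nt * max (r / real nt - (r - real k)) 0"
  proof -
    have "real nt * real k - r * (real nt - 1) = real nt * (r / real nt - (r - real k))"
      using assms(3) by (simp add: field_simps)
    then show ?thesis by (simp only: max_mult_distrib_left) simp
  qed
  then show ?thesis using assms by (simp add: cbar_def of_nat_diff field_simps)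
qed

lemma floor_nat_obtain:
  assumes "0 \<le> r" "r \<le> real nt"
  obtains k where "real_of_int \<lfloor>r\<rfloor> = real k" "k \<le> nt" "real k \<le> r" "r < real k + 1"
proof
  show k: "real_of_int \<lfloor>r\<rfloor> = real (nat \<lfloor>r\<rfloor>)" using assms by simp
  show "real (nat \<lfloor>r\<rfloor>) \<le> r" "r < real (nat \<lfloor>r\<rfloor>) + 1" unfolding k[symmetric] by linarith+
  then show "nat \<lfloor>r\<rfloor> \<le> nt" using assms by linarith
qed

text \<open>Relaxing the budget to a bound on the plain sum of the (clipped) variables loses nothing, since
  the weights increase; for that relaxation only the number of variables above the threshold
  \<open>1 - r / nt\<close> matters.\<close>

lemma opt_obj_le_cbar:
  assumes "0 < nt" "nt \<le> nr" "0 \<le> r" "r \<le> real nt" "0 \<le> \<epsilon>"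
    and pos: "\<And>i. i \<in> {1..nt} \<Longrightarrow> 0 \<le> \<alpha> i"
    and budget: "(\<Sum>i=1..nt. (real nr - real nt + 2 * real i - 1) * \<alpha> i) \<le> dstar nt nr r + \<epsilon>"
  shows "opt_obj nt T r \<alpha> \<le> cbar nt T r + real T * \<epsilon>"
proof -
  obtain k where k: "real_of_int \<lfloor>r\<rfloor> = real k" "k \<le> nt" "real k \<le> r" "r < real k + 1"
    using floor_nat_obtain assms by blast
  define y where "y = r / real nt"
  have y: "0 \<le> y" "y \<le> 1" using assms by (auto simp: y_def)
  define w where "w i = real nr - real nt + 2 * real i - 1" for i :: nat
  have w1: "1 \<le> w i" if "1 \<le> i" for i using that assms(2) by (simp add: w_def)
  \<comment> \<open>Each summand of the objective saturates at 1, so clipping keeps the objective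
    and can only lower the cost.\<close>
  define \<beta> where "\<beta> i = min (\<alpha> i) 1" for i
  have \<beta>: "0 \<le> \<beta> i" "\<beta> i \<le> 1" "\<beta> i \<le> \<alpha> i" if "i \<in> {1..nt}" for i
    using pos[OF that] by (auto simp: \<beta>_def)
  have obj: "opt_obj nt T r \<alpha> = real T * (\<Sum>i=1..nt. max (y - 1 + \<beta> i) 0)"
    unfolding opt_obj_def sum_distrib_left[symmetric] y_def[symmetric]
    by (intro arg_cong[where f = "\<lambda>u. real T * u"] sum.cong refl) (auto simp: \<beta>_def min_def)
  have w\<beta>: "(\<Sum>i=1..nt. w i * \<beta> i) \<le> dstar nt nr r + \<epsilon>"
  proof -
    have "(\<Sum>i=1..nt. w i * \<beta> i) \<le> (\<Sum>i=1..nt. w i * \<alpha> i)"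
      using \<beta>(3) w1 by (intro sum_mono mult_left_mono) (auto intro: order_trans[OF zero_le_one])
    then show ?thesis using budget by (simp add: w_def)
  qed
  have "(\<Sum>i=1..nt. max (y - 1 + \<beta> i) 0) \<le> (real (nt - k) - 1) * y + max (y - (r - real k)) 0 + \<epsilon>"
  \<comment> \<open>Here p = nt - k is 0 and \<open>w 0\<close> may be negative. The budget is only
    \<epsilon>, and weights at least 1 settle the case directly.\<close>
  proof (cases "k = nt")
    case True
    then have "r = real nt" using k assms by simp
    then have "y = 1" using assms by (simp add: y_def)
    have "dstar nt nr r = 0" using dstar_floor[OF k(1,2), of nr] True \<open>r = real nt\<close> by simp
    have "(\<Sum>i=1..nt. max (y - 1 + \<beta> i) 0) \<le> (\<Sum>i=1..nt. w i * \<beta> i)"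
    proof (rule sum_mono)
      fix i assume i: "i \<in> {1..nt}"
      then have "1 * \<beta> i \<le> w i * \<beta> i" using w1[of i] \<beta>(1)[OF i] by (intro mult_right_mono) auto
      then show "max (y - 1 + \<beta> i) 0 \<le> w i * \<beta> i" using \<beta>(1)[OF i] \<open>y = 1\<close> by simp
    qed
    also have "\<dots> \<le> \<epsilon>" using w\<beta> \<open>dstar nt nr r = 0\<close> by simp
    finally show ?thesis using True \<open>y = 1\<close> \<open>r = real nt\<close> by simp
  next
    case False
    define p where "p = nt - k"
    have p: "1 \<le> p" "p \<le> nt" using False k(2) by (auto simp: p_def)
    define fr where "fr = r - real k"
    have fr: "0 \<le> fr" "fr < 1" using k by (auto simp: fr_def)
    \<comment> \<open>Termwise, (w i - w p) * (\<beta> i - 1) \<ge> 0 for i < p and (w i - w p) *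
      \<beta> i \<ge> 0 otherwise. Equality holds when the indices below p are filled and those
      above p are empty.\<close>
    have "w p * (\<Sum>i=1..nt. \<beta> i) + (\<Sum>i=1..nt. if i < p then w i - w p else 0) \<le> (\<Sum>i=1..nt. w i * \<beta> i)"
      unfolding sum_distrib_left sum.distrib[symmetric]
    proof (rule sum_mono)
      fix i assume i: "i \<in> {1..nt}"
      show "w p * \<beta> i + (if i < p then w i - w p else 0) \<le> w i * \<beta> i"
      proof (cases "i < p")
        case True
        then have "0 \<le> (w p - w i) * (1 - \<beta> i)" using \<beta>(2)[OF i] by (intro mult_nonneg_nonneg) (auto simp: w_def)
        then show ?thesis using True by (simp add: algebra_simps)
      next
        case False
        then have "0 \<le> (w i - w p) * \<beta> i" using \<beta>(1)[OF i] by (intro mult_nonneg_nonneg) (auto simp: w_def)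
        then show ?thesis using False by (simp add: algebra_simps)
      qed
    qed
    moreover have "(\<Sum>i=1..nt. if i < p then w i - w p else 0) = real p * (real nr - real nt + real p) - real p * w p"
    proof -
      have "(\<Sum>i=1..nt. if i < p then w i - w p else 0) = (\<Sum>i\<in>{i\<in>{1..nt}. i < p}. w i - w p)"
        by (subst sum.inter_filter) auto
      also have "{i\<in>{1..nt}. i < p} = {1..<p}" using p by auto
      also have "(\<Sum>i\<in>{1..<p}. w i - w p) = (\<Sum>i=1..<Suc p. w i - w p)" using p by simp
      also have "\<dots> = (\<Sum>i=1..<Suc p. w i) - real p * w p" unfolding sum_subtractf by simp
      also have "(\<Sum>i=1..<Suc p. w i) = real p * (real nr - real nt + real p)"
        unfolding w_def by (rule sum_odd_weights)
      finally show ?thesis .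
    qed
    moreover have "dstar nt nr r = real p * (real nr - real nt + real p) - fr * w p"
      using dstar_floor[OF k(1,2), of nr] by (simp add: p_def fr_def w_def)
    ultimately have "w p * ((\<Sum>i=1..nt. \<beta> i) - real p + fr) \<le> \<epsilon>" using w\<beta> by (simp add: algebra_simps)
    then have total: "(\<Sum>i=1..nt. \<beta> i) \<le> real p - fr + \<epsilon>"
    proof -
      assume a: "w p * ((\<Sum>i=1..nt. \<beta> i) - real p + fr) \<le> \<epsilon>"
      have "((\<Sum>i=1..nt. \<beta> i) - real p + fr) \<le> \<epsilon>"
      proof (cases "0 \<le> (\<Sum>i=1..nt. \<beta> i) - real p + fr")
        case True
        then have "1 * ((\<Sum>i=1..nt. \<beta> i) - real p + fr) \<le> w p * ((\<Sum>i=1..nt. \<beta> i) - real p + fr)"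
          using w1[OF p(1)] by (intro mult_right_mono) auto
        then show ?thesis using a by simp
      qed (use \<open>0 \<le> \<epsilon>\<close> in simp)
      then show ?thesis by simp
    qed
    define I where "I = {i\<in>{1..nt}. 1 - y < \<beta> i}"
    have fI: "finite I" by (simp add: I_def)
    have split: "(\<Sum>i=1..nt. max (y - 1 + \<beta> i) 0) = (\<Sum>i\<in>I. y - 1 + \<beta> i)"
      unfolding I_def by (subst sum.inter_filter) (auto intro!: sum.cong)
    have "(\<Sum>i\<in>I. y - 1 + \<beta> i) \<le> (real p - 1) * y + max (y - fr) 0 + \<epsilon>"
    proof (cases "card I < p")
      case True
      have "(\<Sum>i\<in>I. y - 1 + \<beta> i) \<le> (\<Sum>i\<in>I. y)"
        using \<beta>(2) by (intro sum_mono) (auto simp: I_def)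
      also have "\<dots> \<le> (real p - 1) * y"
        using True y by (simp add: mult_right_mono)
      finally show ?thesis using \<open>0 \<le> \<epsilon>\<close> by simp
    next
      case False
      \<comment> \<open>At least p indices each pay 1 - y out of a total of at most p - fr +
        \<epsilon>, which leaves p * y - fr + \<epsilon>.\<close>
      have "(\<Sum>i\<in>I. y - 1 + \<beta> i) = (\<Sum>i\<in>I. \<beta> i) - real (card I) * (1 - y)"
        by (simp add: sum.distrib sum_subtractf algebra_simps)
      also have "\<dots> \<le> (\<Sum>i=1..nt. \<beta> i) - real p * (1 - y)"
        using False y \<beta>(1) by (intro diff_mono sum_mono2 mult_right_mono) (auto simp: I_def)
      also have "\<dots> \<le> (real p - 1) * y + max (y - fr) 0 + \<epsilon>"
        using total by (simp add: algebra_simps)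
      finally show ?thesis .
    qed
    then show ?thesis unfolding split p_def fr_def .
  qed
  from mult_left_mono[OF this, of "real T"] show ?thesis
    unfolding obj cbar_floor[OF k(1,2) assms(1)] y_def by (simp add: algebra_simps)
qed

lemma opt_attained:
  assumes "0 < nt" "nt \<le> nr" "0 \<le> r" "r \<le> real nt"
  shows "\<exists>\<alpha>. opt_feasible nt nr (ereal (dstar nt nr r)) \<alpha> \<and> opt_obj nt T r \<alpha> = cbar nt T r"
proof -
  obtain k where k: "real_of_int \<lfloor>r\<rfloor> = real k" "k \<le> nt" "real k \<le> r" "r < real k + 1"
    using floor_nat_obtain assms by blast
  define p where "p = nt - k"
  define fr where "fr = r - real k"
  have fr: "0 \<le> fr" "fr < 1" "p = 0 \<Longrightarrow> fr = 0" using k assms by (auto simp: fr_def p_def)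
  define y where "y = r / real nt"
  have y: "0 \<le> y" "y \<le> 1" "p = 0 \<Longrightarrow> y = 1" using assms k by (auto simp: y_def p_def)
  \<comment> \<open>Greedy point: the cheapest variables are filled up to 1, and the partial one at
    p exhausts the budget exactly.\<close>
  define \<alpha> where "\<alpha> i = (if i < p then 1 else if i = p then 1 - fr else 0)" for i
  have sum\<alpha>: "(\<Sum>i=1..nt. g i (\<alpha> i)) = (\<Sum>i=1..<Suc p. g i 1) - g p 1 + g p (1 - fr)"
    if "p \<noteq> 0" "\<And>i. i \<in> {1..nt} \<Longrightarrow> g i 0 = 0" for g :: "nat \<Rightarrow> real \<Rightarrow> real"
  proof -
    have "(\<Sum>i=1..nt. g i (\<alpha> i)) = (\<Sum>i=1..<Suc p. g i (\<alpha> i))"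
      using that by (intro sum.mono_neutral_right) (auto simp: \<alpha>_def p_def)
    also have "\<dots> = (\<Sum>i=1..<p. g i (\<alpha> i)) + g p (1 - fr)"
      using that by (simp add: \<alpha>_def)
    also have "(\<Sum>i=1..<p. g i (\<alpha> i)) = (\<Sum>i=1..<p. g i 1)"
      by (intro sum.cong) (auto simp: \<alpha>_def)
    finally show ?thesis using that by simp
  qed
  have "(\<Sum>i=1..nt. (real nr - real nt + 2 * real i - 1) * \<alpha> i) = dstar nt nr r"
  proof (cases "p = 0")
    case True
    then show ?thesis using dstar_floor[OF k(1,2), of nr] fr by (auto simp: \<alpha>_def p_def fr_def intro!: sum.neutral)
  next
    case False
    show ?thesis
      unfolding sum\<alpha>[of "\<lambda>i a. (real nr - real nt + 2 * real i - 1) * a", OF False, simplified mult_zero_right, OF refl]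
      using sum_odd_weights[of "real nr - real nt" p] dstar_floor[OF k(1,2), of nr]
      by (simp add: p_def[symmetric] fr_def[symmetric] algebra_simps)
  qed
  moreover have "opt_obj nt T r \<alpha> = cbar nt T r"
  proof (cases "p = 0")
    case True
    then have "k = nt" using k(2) by (simp add: p_def)
    then show ?thesis unfolding cbar_floor[OF k(1,2) assms(1)] opt_obj_def y_def[symmetric] fr_def[symmetric]
      using True y fr by (auto simp: \<alpha>_def intro!: sum.neutral)
  next
    case False
    show ?thesis
      unfolding cbar_floor[OF k(1,2) assms(1)] opt_obj_def y_def[symmetric] fr_def[symmetric] p_def[symmetric]
      using sum\<alpha>[of "\<lambda>i a. real T * max (min (y - 1 + a) y) 0", OF False] y fr
      by (simp add: algebra_simps min_def)
  qed
  ultimately show ?thesis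
    using fr by (intro exI[of _ \<alpha>]) (auto simp: opt_feasible_def \<alpha>_def)
qed

lemma opt_feasible_nonneg:
  assumes "opt_feasible nt nr d \<alpha>" "i \<in> {1..nt}"
  shows "0 \<le> \<alpha> i"
proof -
  have "0 \<le> \<alpha> (nt - j)" if "j < nt" for j
    using that
  proof (induction j)
    case (Suc j)
    then have "\<alpha> (nt - Suc j + 1) \<le> \<alpha> (nt - Suc j)"
      using assms(1) unfolding opt_feasible_def by auto
    then show ?case using Suc by (simp add: Suc_diff_Suc)
  qed (use assms(1) in \<open>simp add: opt_feasible_def\<close>)
  from this[of "nt - i"] assms(2) show ?thesis by simp
qed

lemma cbar_integer:
  assumes "k \<le> nt" "0 < nt"
  shows "cbar nt T (real k) = real T * real k * (real nt - real k) / real nt"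
  using cbar_floor[of "real k" k nt T] assms by (simp add: of_nat_diff field_simps)

section \<open>Asymptotics\<close>

lemma dot_eq_upper:
  assumes "dot_eq f a" "0 < e"
  shows "\<forall>\<^sub>F \<rho> in at_top. 0 < f \<rho> \<and> f \<rho> \<le> \<rho> powr (a + e)"
proof -
  have "\<forall>\<^sub>F \<rho> in at_top. log 2 (f \<rho>) / log 2 \<rho> < a + e"
    using assms unfolding dot_eq_def by (intro order_tendstoD(2)) auto
  moreover have "\<forall>\<^sub>F \<rho> in at_top. 0 < f \<rho>" using assms by (simp add: dot_eq_def)
  moreover have "\<forall>\<^sub>F \<rho>::real in at_top. 1 < \<rho>" by (rule eventually_gt_at_top)
  ultimately show ?thesis
  proof eventually_elim
    case (elim \<rho>)
    then have "log 2 (f \<rho>) \<le> log 2 (\<rho> powr (a + e))" by (simp add: log_powr divide_less_eq)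
    then show ?case using elim by simp
  qed
qed

lemma dot_eq_lower:
  assumes "dot_eq f a" "0 < e"
  shows "\<forall>\<^sub>F \<rho> in at_top. \<rho> powr (a - e) \<le> f \<rho>"
proof -
  have "\<forall>\<^sub>F \<rho> in at_top. a - e < log 2 (f \<rho>) / log 2 \<rho>"
    using assms unfolding dot_eq_def by (intro order_tendstoD(1)) auto
  moreover have "\<forall>\<^sub>F \<rho> in at_top. 0 < f \<rho>" using assms by (simp add: dot_eq_def)
  moreover have "\<forall>\<^sub>F \<rho>::real in at_top. 1 < \<rho>" by (rule eventually_gt_at_top)
  ultimately show ?thesis
  proof eventually_elim
    case (elim \<rho>)
    then have "log 2 (\<rho> powr (a - e)) \<le> log 2 (f \<rho>)" by (simp add: log_powr less_divide_eq)
    then show ?case using elim by simp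
  qed
qed

lemma eventually_le_powr: "0 < e \<Longrightarrow> \<forall>\<^sub>F \<rho>::real in at_top. A \<le> \<rho> powr e"
proof -
  assume "0 < e"
  then have "filterlim (\<lambda>\<rho>::real. \<rho> powr e) at_top at_top" by real_asymp
  then show ?thesis by (simp add: filterlim_at_top)
qed

lemma eventually_log_le_powr:
  assumes "0 < e" shows "\<forall>\<^sub>F \<rho>::real in at_top. A * log 2 \<rho> \<le> \<rho> powr e"
proof -
  have "\<forall>\<^sub>F \<rho>::real in at_top. log 2 \<rho> \<le> \<rho> powr (e / 2)" using assms by real_asymp
  moreover have "\<forall>\<^sub>F \<rho>::real in at_top. \<bar>A\<bar> \<le> \<rho> powr (e / 2)" using assms by (intro eventually_le_powr) simp
  moreover have "\<forall>\<^sub>F \<rho>::real in at_top. 1 < \<rho>" by (rule eventually_gt_at_top)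
  ultimately show ?thesis
  proof eventually_elim
    case (elim \<rho>)
    have "A * log 2 \<rho> \<le> \<bar>A\<bar> * log 2 \<rho>" using elim by (intro mult_right_mono) auto
    also have "\<dots> \<le> \<rho> powr (e / 2) * \<rho> powr (e / 2)" using elim by (intro mult_mono) auto
    also have "\<dots> = \<rho> powr e" by (simp add: powr_add[symmetric])
    finally show ?case .
  qed
qed

section \<open>Exponents of the counting bound and their discretisation\<close>

definition obj_term :: "real \<Rightarrow> real \<Rightarrow> real" where
  "obj_term y a = max (min (y - 1 + a) y) 0"

text \<open>Since r T / \<kappa> = r / nt, the bounds control the squared constellation diameter and
  the squared coefficient range apart from the pivot. The slack \<open>e\<close> absorbs constants
  and the logarithm in the radius.\<close>

lemma LD_code_scaling:
  assumes code: "LD_code nt T G \<eta> \<theta>" and "0 < nt" "0 < T" "0 \<le> r" "r \<le> real nt" "0 < e"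
  shows "\<forall>\<^sub>F \<rho> in at_top. 1 < \<rho> \<and> 0 \<le> \<eta> r \<rho> \<and> \<theta> r \<rho> \<noteq> 0 \<and> 0 \<le> log 2 \<rho> \<and>
     (4 * \<eta> r \<rho>)\<^sup>2 \<le> \<rho> powr (r / nt + e) \<and>
     A * log 2 \<rho> / (\<theta> r \<rho>)\<^sup>2 \<le> \<rho> powr (r / nt - 1 + e) \<and> B \<le> \<rho> powr e"
proof -
  have expo: "r * real T / (2 * real (nt * T)) = r / nt / 2" "r * real T / real (nt * T) = r / nt"
    using assms by auto
  have "dot_eq (\<eta> r) (r * real T / (2 * real (nt * T)))"
    "dot_eq (\<lambda>\<rho>. \<theta> r \<rho> * \<theta> r \<rho>) (1 - r * real T / real (nt * T))"
    using code \<open>0 \<le> r\<close> \<open>r \<le> real nt\<close> unfolding LD_code_def by blast+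
  then have \<eta>: "dot_eq (\<eta> r) (r / nt / 2)" and \<theta>: "dot_eq (\<lambda>\<rho>. \<theta> r \<rho> * \<theta> r \<rho>) (1 - r / nt)"
    unfolding expo by blast+
  have "\<forall>\<^sub>F \<rho> in at_top. 0 < \<eta> r \<rho> \<and> \<eta> r \<rho> \<le> \<rho> powr (r / nt / 2 + e / 4)"
    using \<open>0 < e\<close> by (intro dot_eq_upper[OF \<eta>]) simp
  moreover have "\<forall>\<^sub>F \<rho> in at_top. \<rho> powr (1 - r / nt - e / 2) \<le> \<theta> r \<rho> * \<theta> r \<rho>"
    using \<open>0 < e\<close> by (intro dot_eq_lower[OF \<theta>]) simp
  moreover have "\<forall>\<^sub>F \<rho>::real in at_top. 16 \<le> \<rho> powr (e / 2)" using \<open>0 < e\<close> by (intro eventually_le_powr) simp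
  moreover have "\<forall>\<^sub>F \<rho>::real in at_top. \<bar>A\<bar> * log 2 \<rho> \<le> \<rho> powr (e / 2)" using \<open>0 < e\<close> by (intro eventually_log_le_powr) simp
  moreover have "\<forall>\<^sub>F \<rho>::real in at_top. B \<le> \<rho> powr e" using \<open>0 < e\<close> by (intro eventually_le_powr)
  moreover have "\<forall>\<^sub>F \<rho>::real in at_top. 1 < \<rho>" by (rule eventually_gt_at_top)
  ultimately show ?thesis
  proof eventually_elim
    case (elim \<rho>)
    have "(4 * \<eta> r \<rho>)\<^sup>2 = 16 * (\<eta> r \<rho>)\<^sup>2" by (simp add: power_mult_distrib)
    also have "\<dots> \<le> \<rho> powr (e / 2) * (\<rho> powr (r / nt / 2 + e / 4))\<^sup>2"
      using elim by (intro mult_mono power_mono) auto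
    also have "\<dots> = \<rho> powr (r / nt + e)"
      by (simp add: power2_eq_square powr_add[symmetric] add.commute)
    finally have 1: "(4 * \<eta> r \<rho>)\<^sup>2 \<le> \<rho> powr (r / nt + e)" .
    have pos: "0 < \<rho> powr (1 - r / nt - e / 2)" using elim by simp
    have \<theta>2: "\<rho> powr (1 - r / nt - e / 2) \<le> (\<theta> r \<rho>)\<^sup>2" using elim by (simp add: power2_eq_square)
    have "A * log 2 \<rho> \<le> \<bar>A\<bar> * log 2 \<rho>" using elim by (intro mult_right_mono) auto
    then have "A * log 2 \<rho> \<le> \<rho> powr (e / 2)" using elim by linarith
    then have "A * log 2 \<rho> / (\<theta> r \<rho>)\<^sup>2 \<le> \<rho> powr (e / 2) / (\<theta> r \<rho>)\<^sup>2" by (intro divide_right_mono) auto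
    also have "\<dots> \<le> \<rho> powr (e / 2) / \<rho> powr (1 - r / nt - e / 2)"
      using pos \<theta>2 by (intro divide_left_mono mult_pos_pos) (simp, simp, linarith, simp)
    also have "\<dots> = \<rho> powr (r / nt - 1 + e)" by (simp add: powr_diff[symmetric] add.commute)
    finally have 2: "A * log 2 \<rho> / (\<theta> r \<rho>)\<^sup>2 \<le> \<rho> powr (r / nt - 1 + e)" .
    show ?case using 1 2 elim pos \<theta>2 by auto
  qed
qed

text \<open>From (1 + u)^2 \<le> 2 + 2 u^2 with u the minimum of the two ranges; the additive 1 is
  why the exponent is clipped below at 0.\<close>

lemma count_factor_powr:
  assumes "1 < \<rho>" "0 \<le> W" "0 \<le> D" "0 \<le> e" "W\<^sup>2 \<le> \<rho> powr (y - 1 + \<alpha> + e)" "D\<^sup>2 \<le> \<rho> powr (y + e)"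
  shows "(1 + min W D) ^ (2 * T) \<le> 4 ^ T * \<rho> powr (real T * (obj_term y \<alpha> + e))"
proof -
  have "(min W D)\<^sup>2 \<le> \<rho> powr (obj_term y \<alpha> + e)"
  proof -
    have "(min W D)\<^sup>2 \<le> min (\<rho> powr (y - 1 + \<alpha> + e)) (\<rho> powr (y + e))"
    proof -
      have "(min W D)\<^sup>2 \<le> W\<^sup>2" "(min W D)\<^sup>2 \<le> D\<^sup>2" using assms by (auto intro!: power_mono)
      then show ?thesis using assms(5,6) by (intro min.boundedI) linarith+
    qed
    also have "\<dots> = \<rho> powr (min (y - 1 + \<alpha>) y + e)" using assms(1) by (auto simp: min_def)
    also have "\<dots> \<le> \<rho> powr (obj_term y \<alpha> + e)" using assms(1) by (intro powr_mono) (auto simp: obj_term_def)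
    finally show ?thesis .
  qed
  moreover have "1 \<le> \<rho> powr (obj_term y \<alpha> + e)"
    using assms by (intro ge_one_powr_ge_zero) (auto simp: obj_term_def)
  moreover have "(1 + min W D)\<^sup>2 \<le> 2 * 1 + 2 * (min W D)\<^sup>2"
    using sum_squares_ge_zero[of "1 - min W D" 0] by (simp add: power2_eq_square algebra_simps)
  ultimately have "(1 + min W D)\<^sup>2 \<le> 4 * \<rho> powr (obj_term y \<alpha> + e)" by linarith
  then have "((1 + min W D)\<^sup>2) ^ T \<le> (4 * \<rho> powr (obj_term y \<alpha> + e)) ^ T"
    by (intro power_mono) auto
  then show ?thesis using assms(1)
    by (simp add: power_mult power_mult_distrib powr_power mult.commute[of "real T"])
qed

text \<open>For y in [0, 1] a summand depends on \<alpha> only through its clipping to [0, 1], where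
  it is nondecreasing and 1-Lipschitz. Rounding down to a grid thus costs at most the mesh.\<close>

lemma obj_term_grid:
  assumes "0 \<le> y" "y \<le> 1" "0 \<le> a" "a \<le> 1" "0 \<le> c" "max 0 (min 1 \<alpha>) \<le> a + c"
  shows "obj_term y \<alpha> \<le> obj_term y a + c"
  using assms unfolding obj_term_def by (auto simp: min_def max_def split: if_splits)

text \<open>Pivots are indexed in the opposite direction to the \<alpha> of the optimisation
  problem; i = nt - m turns the weight nr - nt + 2i - 1 into the hook size nr + nt - 2m - 1.\<close>

lemma opt_obj_reversed:
  "opt_obj nt T r (\<lambda>i. a (nt - i)) = real T * (\<Sum>m<nt. obj_term (r / real nt) (a m))"
  "(\<Sum>i=1..nt. (real nr - real nt + 2 * real i - 1) * a (nt - i)) =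
     (\<Sum>m<nt. (real nr + real nt - 2 * real m - 1) * a m)"
proof -
  have rev: "(\<Sum>i=1..nt. f i (nt - i)) = (\<Sum>m<nt. f (nt - m) m)" for f :: "nat \<Rightarrow> nat \<Rightarrow> real"
    by (rule sum.reindex_bij_witness[of _ "\<lambda>m. nt - m" "\<lambda>i. nt - i"]) auto
  show "opt_obj nt T r (\<lambda>i. a (nt - i)) = real T * (\<Sum>m<nt. obj_term (r / real nt) (a m))"
    unfolding opt_obj_def obj_term_def sum_distrib_left
    by (rule rev[of "\<lambda>i m. real T * max (min (r / real nt - 1 + a m) (r / real nt)) 0"])
  show "(\<Sum>i=1..nt. (real nr - real nt + 2 * real i - 1) * a (nt - i)) =
     (\<Sum>m<nt. (real nr + real nt - 2 * real m - 1) * a m)"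
    unfolding rev[of "\<lambda>i m. (real nr - real nt + 2 * real i - 1) * a m"]
    by (intro sum.cong) (auto simp: of_nat_diff algebra_simps)
qed

section \<open>The exceptional channels\<close>

definition grid_fun :: "nat \<Rightarrow> nat \<Rightarrow> (nat \<Rightarrow> nat) \<Rightarrow> nat \<Rightarrow> real" where
  "grid_fun n J g m = (if m < n then real (g m) / real J else 0)"

definition perm_pairs :: "nat \<Rightarrow> nat \<Rightarrow> ((nat \<Rightarrow> nat) \<times> (nat \<Rightarrow> nat)) set" where
  "perm_pairs k n = {\<sigma>. \<sigma> permutes {..<k}} \<times> {\<tau>. \<tau> permutes {..<n}}"

definition heavy_grid :: "nat \<Rightarrow> nat \<Rightarrow> nat \<Rightarrow> real \<Rightarrow> (nat \<Rightarrow> nat) set" where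
  "heavy_grid k n J d = {g \<in> {..<n} \<rightarrow>\<^sub>E {..J}.
     d < (\<Sum>m<n. (real k + real n - 2 * real m - 1) * grid_fun n J g m)}"

text \<open>The pivoting permutations depend on the channel, so the union runs over all pairs. The
  first part is the null set of zero pivots; the second collects the grid profiles beyond the budget
  \<open>d\<close>, whose number does not depend on \<open>\<rho>\<close>.\<close>

definition bad_channels :: "nat \<Rightarrow> nat \<Rightarrow> nat \<Rightarrow> real \<Rightarrow> real \<Rightarrow> (nat \<times> nat \<Rightarrow> complex) set" where
  "bad_channels k n J d \<rho> =
     (\<Union>x\<in>perm_pairs k n \<times> {..<n}. small_schur k n (fst (fst x)) (snd (fst x)) (\<lambda>l. if l = snd x then 0 else 1)) \<union>
     (\<Union>x\<in>perm_pairs k n \<times> heavy_grid k n J d.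
        small_schur k n (fst (fst x)) (snd (fst x)) (\<lambda>m. \<rho> powr (- grid_fun n J (snd x) m / 2)))"

lemma finite_perm_pairs: "finite (perm_pairs k n)"
  by (auto simp: perm_pairs_def finite_permutations)

lemma finite_heavy_grid: "finite (heavy_grid k n J d)"
  by (auto simp: heavy_grid_def finite_PiE)

lemma bad_channels_sets: "bad_channels k n J d \<rho> \<in> sets (gauss_mat k n)"
  unfolding bad_channels_def
  by (intro sets.Un sets.finite_UN finite_cartesian_product finite_perm_pairs finite_heavy_grid
      finite_lessThan small_schur_measurable)

lemma measure_bad_channels:
  assumes "n \<le> k" "1 < \<rho>"
  shows "measure (gauss_mat k n) (bad_channels k n J d \<rho>) \<le>
     real (card (perm_pairs k n \<times> heavy_grid k n J d)) * \<rho> powr (- d)"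
proof -
  interpret prob_space "gauss_mat k n" by (rule prob_space_gauss_mat)
  let ?N = "\<lambda>x. small_schur k n (fst (fst x)) (snd (fst x)) (\<lambda>l. if l = snd x then 0 else 1)"
  let ?E = "\<lambda>x. small_schur k n (fst (fst x)) (snd (fst x)) (\<lambda>m. \<rho> powr (- grid_fun n J (snd x) m / 2))"
  let ?I = "perm_pairs k n \<times> {..<n}" and ?H = "perm_pairs k n \<times> heavy_grid k n J d"
  have fin: "finite ?I" "finite ?H" using finite_perm_pairs finite_heavy_grid by auto
  have "prob (bad_channels k n J d \<rho>) \<le> prob (\<Union>x\<in>?I. ?N x) + prob (\<Union>x\<in>?H. ?E x)"
    unfolding bad_channels_def using fin by (intro measure_Un_le sets.finite_UN small_schur_measurable) auto
  also have "prob (\<Union>x\<in>?I. ?N x) \<le> (\<Sum>x\<in>?I. prob (?N x))"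
    using fin by (intro finite_measure_subadditive_finite) (auto intro: small_schur_measurable)
  also have "\<dots> = 0"
    using null_small_schur[of _ k _ n] assms(1) by (intro sum.neutral) (auto simp: perm_pairs_def measure_def)
  also have "prob (\<Union>x\<in>?H. ?E x) \<le> (\<Sum>x\<in>?H. prob (?E x))"
    using fin by (intro finite_measure_subadditive_finite) (auto intro: small_schur_measurable)
  also have "\<dots> \<le> (\<Sum>x\<in>?H. \<rho> powr (- d))"
  proof (rule sum_mono)
    fix x assume x: "x \<in> ?H"
    have "prob (?E x) \<le> \<rho> powr (- (\<Sum>m<n. (real k + real n - 2 * real m - 1) * grid_fun n J (snd x) m))"
      using x assms by (intro measure_small_schur_powr) (auto simp: perm_pairs_def grid_fun_def)
    also have "\<dots> \<le> \<rho> powr (- d)"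
    proof (rule powr_mono)
      have "snd x \<in> heavy_grid k n J d" using x by auto
      then show "- (\<Sum>m<n. (real k + real n - 2 * real m - 1) * grid_fun n J (snd x) m) \<le> - d"
        unfolding heavy_grid_def by simp
    qed (use assms in simp)
    finally show "prob (?E x) \<le> \<rho> powr (- d)" .
  qed
  finally show ?thesis by simp
qed

text \<open>The event \<open>E s\<close> need not be measurable (\<open>SD_count\<close> involves a choice of QR factorisation);
  its \<open>measure\<close> is then 0.\<close>

lemma Prob_le_measure:
  assumes B: "B \<in> sets (gauss_mat nr nt)"
    and sub: "\<And>s h w. h \<in> space (gauss_mat nr nt) \<Longrightarrow> E s (h, w) \<Longrightarrow> h \<in> B"
  shows "Prob nt nr T \<eta> E \<le> measure (gauss_mat nr nt) B"
proof -
  interpret H: prob_space "gauss_mat nr nt" by (rule prob_space_gauss_mat)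
  interpret W: prob_space "gauss_mat nr T" by (rule prob_space_gauss_mat)
  interpret P: pair_prob_space "gauss_mat nr nt" "gauss_mat nr T" ..
  let ?M = "chan_space nt nr T"
  have le: "measure ?M {hw \<in> space ?M. E s hw} \<le> measure (gauss_mat nr nt) B" for s
  proof (cases "{hw \<in> space ?M. E s hw} \<in> sets ?M")
    case True
    have "measure ?M {hw \<in> space ?M. E s hw} \<le> measure ?M (B \<times> space (gauss_mat nr T))"
      using sub B unfolding chan_space_def
      by (intro P.finite_measure_mono) (auto simp: space_pair_measure)
    also have "\<dots> = measure (gauss_mat nr nt) B"
      unfolding chan_space_def measure_def using B
      by (simp add: W.emeasure_pair_measure_Times W.emeasure_space_1)
    finally show ?thesis .
  qed (simp add: measure_notin_sets)
  have "(\<Sum>s\<in>Qvecs \<eta> (nt * T). measure ?M {hw \<in> space ?M. E s hw}) \<le>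
      real (card (Qvecs \<eta> (nt * T))) * measure (gauss_mat nr nt) B"
    using sum_bounded_above[of "Qvecs \<eta> (nt * T)" "\<lambda>s. measure ?M {hw \<in> space ?M. E s hw}", OF le] by simp
  \<comment> \<open>If the denominator is 0, division by zero makes the probability 0.\<close>
  then show ?thesis
    unfolding Prob_def by (cases "card (Qvecs \<eta> (nt * T)) = 0") (auto simp: field_simps)
qed

text \<open>A large count forces a large objective at the exponents of the pivots, hence at the grid
  point just below them. By the optimisation bound that grid point exceeds the budget, and the
  channel lies in its event.\<close>

lemma many_points_bad_channel:
  assumes "0 < nt" "0 < T" "nt \<le> nr" "0 \<le> r" "r \<le> real nt" "0 < C" "0 < J" "0 \<le> \<gamma>" "0 \<le> e"
    and bound: "\<And>\<sigma> \<tau> p. pivot_profile nr nt h \<sigma> \<tau> p \<Longrightarrow> N \<le>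
      C * (\<Prod>m<nt. (1 + min (C * \<xi> / (\<bar>th\<bar> * cmod (p m))) (4 * \<eta>)) ^ (2 * T))"
    and \<rho>: "1 < \<rho>" and "0 \<le> \<xi>" "0 \<le> \<eta>" "th \<noteq> 0"
    and D: "(4 * \<eta>)\<^sup>2 \<le> \<rho> powr (r / nt + e)"
    and W: "C\<^sup>2 * \<xi>\<^sup>2 / th\<^sup>2 \<le> \<rho> powr (r / nt - 1 + e)"
    and Ce: "C * 4 ^ (nt * T) \<le> \<rho> powr e"
    and x: "cbar nt T r + \<gamma> + e * (1 + real (nt * T)) + real (nt * T) / real J < x"
    and h: "h \<in> space (gauss_mat nr nt)" and N: "\<rho> powr x \<le> N"
  shows "h \<in> bad_channels nr nt J (dstar nt nr r + \<gamma> / T) \<rho>"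
proof -
  obtain \<sigma> \<tau> where \<sigma>: "\<sigma> permutes {..<nr}" and \<tau>: "\<tau> permutes {..<nt}"
    and piv: "pivoted nr nt (\<lambda>a b. h (\<sigma> a, \<tau> b))"
    using complete_pivoting[OF \<open>nt \<le> nr\<close>, of "\<lambda>a b. h (a,b)"] by blast
  define B where "B = (\<lambda>a b. h (\<sigma> a, \<tau> b))"
  have le_pivot: "cmod (schur B (min a b) a b) \<le> cmod (schur B (min a b) (min a b) (min a b))"
    if "a < nr" "b < nt" for a b
    using piv that by (auto simp: pivoted_def B_def)
  have perm: "(\<sigma>, \<tau>) \<in> perm_pairs nr nt" using \<sigma> \<tau> by (simp add: perm_pairs_def)
  show ?thesis
  proof (cases "\<exists>m<nt. schur B m m m = 0")
    case True
    then obtain m where m: "m < nt" "schur B m m m = 0" by blast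
    have "h \<in> small_schur nr nt \<sigma> \<tau> (\<lambda>l. if l = m then 0 else 1)"
      using h le_pivot m unfolding small_schur_def B_def by fastforce
    then show ?thesis using perm m unfolding bad_channels_def by force
  next
    case False
    define p where "p m = schur B m m m" for m
    have p0: "0 < cmod (p m)" if "m < nt" for m using False that by (simp add: p_def)
    have prof: "pivot_profile nr nt h \<sigma> \<tau> p"
      using \<sigma> \<tau> piv False by (auto simp: pivot_profile_def p_def B_def)
    define y where "y = r / real nt"
    have y: "0 \<le> y" "y \<le> 1" using assms by (auto simp: y_def)
    \<comment> \<open>Chosen so that the squared modulus of pivot \<open>m\<close> is
      \<open>\<rho> powr (- \<alpha> m)\<close>.\<close>
    define \<alpha> where "\<alpha> m = - (2 * ln (cmod (p m)) / ln \<rho>)" for m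
    have p_\<alpha>: "cmod (p m) = \<rho> powr (- \<alpha> m / 2)" if "m < nt" for m
      using p0[OF that] \<rho> by (simp add: \<alpha>_def powr_def)
    have "N \<le> C * (\<Prod>m<nt. (1 + min (C * \<xi> / (\<bar>th\<bar> * cmod (p m))) (4 * \<eta>)) ^ (2 * T))"
      by (rule bound[OF prof])
    also have "\<dots> \<le> C * (\<Prod>m<nt. 4 ^ T * \<rho> powr (real T * (obj_term y (\<alpha> m) + e)))"
    proof (intro mult_left_mono prod_mono conjI)
      fix m assume "m \<in> {..<nt}"
      then have m: "m < nt" by simp
      have "(C * \<xi> / (\<bar>th\<bar> * cmod (p m)))\<^sup>2 = (C\<^sup>2 * \<xi>\<^sup>2 / th\<^sup>2) / (cmod (p m))\<^sup>2"
        by (simp add: power_divide power_mult_distrib)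
      also have "\<dots> \<le> \<rho> powr (y - 1 + e) / (cmod (p m))\<^sup>2"
        using W by (intro divide_right_mono) (auto simp: y_def)
      also have "(cmod (p m))\<^sup>2 = \<rho> powr (- \<alpha> m)"
        unfolding p_\<alpha>[OF m] power2_eq_square powr_add[symmetric] by simp
      also have "\<rho> powr (y - 1 + e) / \<rho> powr (- \<alpha> m) = \<rho> powr (y - 1 + \<alpha> m + e)"
        by (simp add: powr_diff[symmetric] algebra_simps)
      finally have "(C * \<xi> / (\<bar>th\<bar> * cmod (p m)))\<^sup>2 \<le> \<rho> powr (y - 1 + \<alpha> m + e)" .
      then show "(1 + min (C * \<xi> / (\<bar>th\<bar> * cmod (p m))) (4 * \<eta>)) ^ (2 * T) \<le>
          4 ^ T * \<rho> powr (real T * (obj_term y (\<alpha> m) + e))"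
        using assms by (intro count_factor_powr) (auto simp: y_def)
      show "0 \<le> (1 + min (C * \<xi> / (\<bar>th\<bar> * cmod (p m))) (4 * \<eta>)) ^ (2 * T)"
        using assms by (intro zero_le_power add_nonneg_nonneg) auto
    qed (use assms in auto)
    also have "\<dots> = C * 4 ^ (nt * T) * \<rho> powr (\<Sum>m<nt. real T * (obj_term y (\<alpha> m) + e))"
      using \<rho> by (simp add: prod.distrib powr_sum power_mult[symmetric] mult.commute[of T])
    also have "\<dots> \<le> \<rho> powr e * \<rho> powr (\<Sum>m<nt. real T * (obj_term y (\<alpha> m) + e))"
      using Ce by (intro mult_right_mono) auto
    also have "\<dots> = \<rho> powr (e * (1 + real (nt * T)) + real T * (\<Sum>m<nt. obj_term y (\<alpha> m)))"
      by (simp add: powr_add[symmetric] sum.distrib sum_distrib_left algebra_simps)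
    finally have "\<rho> powr x \<le> \<rho> powr (e * (1 + real (nt * T)) + real T * (\<Sum>m<nt. obj_term y (\<alpha> m)))"
      using N by simp
    then have x_le: "x \<le> e * (1 + real (nt * T)) + real T * (\<Sum>m<nt. obj_term y (\<alpha> m))"
      using \<rho> by simp
    define \<beta> where "\<beta> m = max 0 (min 1 (\<alpha> m))" for m
    define g where "g = restrict (\<lambda>m. nat \<lfloor>real J * \<beta> m\<rfloor>) {..<nt}"
    define a where "a = grid_fun nt J g"
    have \<beta>: "0 \<le> \<beta> m" "\<beta> m \<le> 1" for m by (auto simp: \<beta>_def)
    have a_eq: "a m = real_of_int \<lfloor>real J * \<beta> m\<rfloor> / real J" if "m < nt" for m
      using that \<beta>(1)[of m] by (simp add: a_def grid_fun_def g_def)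
    have a_le: "a m \<le> \<beta> m" and a_ge: "\<beta> m \<le> a m + 1 / real J" if "m < nt" for m
    proof -
      have "real_of_int \<lfloor>real J * \<beta> m\<rfloor> \<le> real J * \<beta> m" "real J * \<beta> m \<le> real_of_int \<lfloor>real J * \<beta> m\<rfloor> + 1"
        by linarith+
      then show "a m \<le> \<beta> m" "\<beta> m \<le> a m + 1 / real J"
        using \<open>0 < J\<close> unfolding a_eq[OF that] by (simp_all add: field_simps)
    qed
    have a0: "0 \<le> a m" for m by (simp add: a_def grid_fun_def)
    have g_in: "g \<in> {..<nt} \<rightarrow>\<^sub>E {..J}"
    proof -
      have "nat \<lfloor>real J * \<beta> m\<rfloor> \<le> J" for m
      proof -
        have "real J * \<beta> m \<le> real J" using \<beta>[of m] by (simp add: mult_left_le)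
        then have "\<lfloor>real J * \<beta> m\<rfloor> \<le> int J" by linarith
        then show ?thesis by linarith
      qed
      then show ?thesis by (auto simp: g_def)
    qed
    have "(\<Sum>m<nt. obj_term y (\<alpha> m)) \<le> (\<Sum>m<nt. obj_term y (a m) + 1 / real J)"
      using y a0 a_le a_ge \<beta>(2) order_trans unfolding \<beta>_def
      by (intro sum_mono obj_term_grid) (fastforce simp: \<beta>_def)+
    then have "real T * (\<Sum>m<nt. obj_term y (\<alpha> m)) \<le> real T * (\<Sum>m<nt. obj_term y (a m) + 1 / real J)"
      by (intro mult_left_mono) auto
    then have T_sum: "real T * (\<Sum>m<nt. obj_term y (\<alpha> m)) \<le> real T * (\<Sum>m<nt. obj_term y (a m)) + real (nt * T) / real J"
      by (simp add: sum.distrib algebra_simps)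
    have "dstar nt nr r + \<gamma> / T < (\<Sum>m<nt. (real nr + real nt - 2 * real m - 1) * a m)"
    proof (rule ccontr)
      assume "\<not> ?thesis"
      then have "(\<Sum>i=1..nt. (real nr - real nt + 2 * real i - 1) * a (nt - i)) \<le> dstar nt nr r + \<gamma> / T"
        unfolding opt_obj_reversed by simp
      \<comment> \<open>Slack \<open>\<gamma> / T\<close> in the budget costs only
        \<open>\<gamma>\<close> in the objective, less than the margin of \<open>x\<close>.\<close>
      from opt_obj_le_cbar[OF assms(1,3,4,5) _ _ this, of T] a0 assms
      have "opt_obj nt T r (\<lambda>i. a (nt - i)) \<le> cbar nt T r + \<gamma>" by simp
      then show False using x x_le T_sum unfolding opt_obj_reversed y_def by simp
    qed
    then have heavy: "g \<in> heavy_grid nr nt J (dstar nt nr r + \<gamma> / T)"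
      using g_in by (simp add: heavy_grid_def a_def)
    have "h \<in> small_schur nr nt \<sigma> \<tau> (\<lambda>m. \<rho> powr (- grid_fun nt J g m / 2))"
      unfolding small_schur_def a_def[symmetric]
    proof (intro CollectI conjI allI impI h)
      fix i j assume ij: "i < nr" "j < nt" and lt: "\<rho> powr (- a (min i j) / 2) < 1"
      define m where "m = min i j"
      have m: "m < nt" using ij by (simp add: m_def)
      \<comment> \<open>A grid exponent 0 means threshold 1, hence no constraint. This takes care of
        pivots above 1, whose negative exponent was clipped up to 0.\<close>
      have "a m \<noteq> 0" using lt \<rho> by (auto simp: m_def)
      then have "0 < \<beta> m" using a0[of m] a_le[OF m] by linarith
      then have "\<beta> m \<le> \<alpha> m" by (auto simp: \<beta>_def)
      then have "a m \<le> \<alpha> m" using a_le[OF m] by simp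
      have "cmod (schur B m i j) \<le> cmod (p m)" using le_pivot[OF ij] by (simp add: m_def p_def)
      also have "\<dots> \<le> \<rho> powr (- a m / 2)"
        unfolding p_\<alpha>[OF m] using \<open>a m \<le> \<alpha> m\<close> \<rho> by (intro powr_mono) auto
      finally show "cmod (schur (\<lambda>a b. h (\<sigma> a, \<tau> b)) (min i j) i j) \<le> \<rho> powr (- a (min i j) / 2)"
        by (simp only: m_def B_def)
    qed
    then show ?thesis using perm heavy unfolding bad_channels_def by force
  qed
qed

section \<open>From exceptional channels to the complexity exponent\<close>

lemma Psi_seq_bound:
  assumes "0 < nt" "0 < T" "nt \<le> nr" and code: "LD_code nt T G \<eta> \<theta>"
    and "0 \<le> r" "r \<le> real nt" "0 < z" "cbar nt T r < x"
  shows "\<exists>\<epsilon>>0. \<exists>K. \<forall>\<^sub>F \<rho> in at_top. 1 < \<rho> \<and>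
    Psi_seq nt nr T G \<eta> \<theta> r z x \<rho> \<le> K * \<rho> powr (- (dstar nt nr r + \<epsilon>))"
proof -
  have G: "G \<in> carrier_mat (nt * T) (nt * T)" "Determinant.det G \<noteq> 0" using code by (auto simp: LD_code_def)
  obtain C where "0 < C" and C: "\<And>\<eta> th \<xi> s h w \<sigma> \<tau> p. th \<noteq> 0 \<Longrightarrow> 0 \<le> \<xi> \<Longrightarrow> 0 \<le> \<eta> \<Longrightarrow> pivot_profile nr nt h \<sigma> \<tau> p \<Longrightarrow>
    real (SD_count nt nr T G \<eta> th (\<xi>\<^sup>2) s (h, w)) \<le>
      C * (\<Prod>m<nt. (1 + min (C * \<xi> / (\<bar>th\<bar> * cmod (p m))) (4 * \<eta>)) ^ (2 * T))"
    using SD_count_bound[OF G \<open>nt \<le> nr\<close>] by blast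
  \<comment> \<open>The margin is split into four: budget slack, scaling slack \<open>e\<close>,
    grid mesh, and one part kept for strictness.\<close>
  define \<gamma> where "\<gamma> = (x - cbar nt T r) / 4"
  have \<gamma>: "0 < \<gamma>" using assms by (simp add: \<gamma>_def)
  define e where "e = \<gamma> / (1 + real (nt * T))"
  have "0 < 1 + real (nt * T)" by (intro add_pos_nonneg) auto
  then have e: "0 < e" "e * (1 + real (nt * T)) = \<gamma>" using \<gamma> by (simp_all add: e_def del: of_nat_mult)
  obtain J :: nat where J: "real (nt * T) / \<gamma> < real J" using reals_Archimedean2 by blast
  have "0 \<le> real (nt * T) / \<gamma>" using \<gamma> by (intro divide_nonneg_nonneg) auto
  then have J0: "0 < J" using J by linarith
  have J1: "real (nt * T) / real J \<le> \<gamma>" using J J0 \<gamma> by (simp add: field_simps)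
  define d where "d = dstar nt nr r + \<gamma> / T"
  let ?K = "real (card (perm_pairs nr nt \<times> heavy_grid nr nt J d))"
  have "\<forall>\<^sub>F \<rho> in at_top. 1 < \<rho> \<and> 0 \<le> \<eta> r \<rho> \<and> \<theta> r \<rho> \<noteq> 0 \<and> 0 \<le> log 2 \<rho> \<and>
     (4 * \<eta> r \<rho>)\<^sup>2 \<le> \<rho> powr (r / nt + e) \<and>
     C\<^sup>2 * z * log 2 \<rho> / (\<theta> r \<rho>)\<^sup>2 \<le> \<rho> powr (r / nt - 1 + e) \<and> C * 4 ^ (nt * T) \<le> \<rho> powr e"
    using LD_code_scaling[OF code assms(1,2,5,6) e(1)] .
  then have "\<forall>\<^sub>F \<rho> in at_top. 1 < \<rho> \<and> Psi_seq nt nr T G \<eta> \<theta> r z x \<rho> \<le> ?K * \<rho> powr (- d)"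
  proof eventually_elim
    case (elim \<rho>)
    define \<xi> where "\<xi> = sqrt (z * log 2 \<rho>)"
    have \<xi>: "0 \<le> \<xi>" "\<xi>\<^sup>2 = z * log 2 \<rho>" using elim \<open>0 < z\<close> by (auto simp: \<xi>_def)
    have "Psi_seq nt nr T G \<eta> \<theta> r z x \<rho> \<le> measure (gauss_mat nr nt) (bad_channels nr nt J d \<rho>)"
      unfolding Psi_seq_def
    proof (rule Prob_le_measure[OF bad_channels_sets])
      fix s h w
      assume h: "h \<in> space (gauss_mat nr nt)"
        and N: "\<rho> powr x \<le> real (SD_count nt nr T G (\<eta> r \<rho>) (\<theta> r \<rho>) (z * log 2 \<rho>) s (h, w))"
      show "h \<in> bad_channels nr nt J d \<rho>"
        unfolding d_def
      proof (rule many_points_bad_channel[OF assms(1-3,5,6) \<open>0 < C\<close> J0 _ _ _ _ \<xi>(1) _ _ _ _ _ _ h N])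
        show "cbar nt T r + \<gamma> + e * (1 + real (nt * T)) + real (nt * T) / real J < x"
        proof -
          have "x = cbar nt T r + 4 * \<gamma>" by (simp add: \<gamma>_def field_simps)
          then show ?thesis unfolding e(2) using J1 \<gamma> by linarith
        qed
        show "C\<^sup>2 * \<xi>\<^sup>2 / (\<theta> r \<rho>)\<^sup>2 \<le> \<rho> powr (r / nt - 1 + e)" unfolding \<xi>(2) using elim by (simp add: mult.assoc)
        fix \<sigma> \<tau> p assume "pivot_profile nr nt h \<sigma> \<tau> p"
        then show "real (SD_count nt nr T G (\<eta> r \<rho>) (\<theta> r \<rho>) (z * log 2 \<rho>) s (h, w)) \<le>
          C * (\<Prod>m<nt. (1 + min (C * \<xi> / (\<bar>\<theta> r \<rho>\<bar> * cmod (p m))) (4 * \<eta> r \<rho>)) ^ (2 * T))"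
          unfolding \<xi>(2)[symmetric] using elim \<xi>(1) by (intro C) auto
      qed (use elim \<gamma> e in auto)
    qed
    also have "\<dots> \<le> ?K * \<rho> powr (- d)" using elim by (intro measure_bad_channels[OF \<open>nt \<le> nr\<close>]) simp
    finally show ?case using elim by simp
  qed
  moreover have "0 < \<gamma> / T" using \<gamma> \<open>0 < T\<close> by simp
  ultimately show ?thesis unfolding d_def by blast
qed

text \<open>Half of \<epsilon> absorbs the constant \<open>K\<close>, the other half keeps the
  inequality strict in the limit. Where \<open>f\<close> vanishes, \<open>neg_exp\<close> is
  infinite and the bound is trivial.\<close>

lemma exponent_gt:
  assumes bound: "\<forall>\<^sub>F \<rho> in at_top. 1 < \<rho> \<and> f \<rho> \<le> K * \<rho> powr (- (d + \<epsilon>))" and "0 < \<epsilon>"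
    and pos: "\<And>\<rho>. 0 \<le> f \<rho>" and lim: "((\<lambda>\<rho>. neg_exp (f \<rho>) \<rho>) \<longlongrightarrow> L) at_top"
  shows "ereal d < exponent f"
proof -
  have "\<forall>\<^sub>F \<rho>::real in at_top. \<bar>K\<bar> \<le> \<rho> powr (\<epsilon> / 2)" using \<open>0 < \<epsilon>\<close> by (intro eventually_le_powr) simp
  with bound have "\<forall>\<^sub>F \<rho> in at_top. ereal (d + \<epsilon> / 2) \<le> neg_exp (f \<rho>) \<rho>"
  proof eventually_elim
    case (elim \<rho>)
    show ?case
    proof (cases "f \<rho> = 0")
      case False
      then have f0: "0 < f \<rho>" using pos[of \<rho>] by simp
      have "f \<rho> \<le> K * \<rho> powr (- (d + \<epsilon>))" using elim by simp
      also have "\<dots> \<le> \<rho> powr (\<epsilon> / 2) * \<rho> powr (- (d + \<epsilon>))"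
        using elim by (intro mult_right_mono) auto
      also have "\<dots> = \<rho> powr (- (d + \<epsilon> / 2))"
      proof -
        have "\<epsilon> / 2 + - (d + \<epsilon>) = - (d + \<epsilon> / 2)" by (simp add: field_simps)
        then show ?thesis by (simp only: powr_add[symmetric])
      qed
      finally have "log 2 (f \<rho>) \<le> log 2 (\<rho> powr (- (d + \<epsilon> / 2)))" using f0 elim by simp
      then have "log 2 (f \<rho>) \<le> - (d + \<epsilon> / 2) * log 2 \<rho>" using elim by (simp add: log_powr)
      then have "d + \<epsilon> / 2 \<le> - log 2 (f \<rho>) / log 2 \<rho>" using elim by (simp add: field_simps)
      then show ?thesis using False by (simp add: neg_exp_def)
    qed (simp add: neg_exp_def)
  qed
  then have "ereal (d + \<epsilon> / 2) \<le> L" using tendsto_lowerbound[OF lim] by simp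
  moreover have "exponent f = L" unfolding exponent_def using lim by (intro tendsto_Lim) auto
  ultimately show ?thesis using \<open>0 < \<epsilon>\<close> by (metis add_strict_left_mono half_gt_zero add.right_neutral less_ereal.simps(1) order_less_le_trans)
qed

lemma Psi_seq_nonneg: "0 \<le> Psi_seq nt nr T G \<eta> \<theta> r z x \<rho>"
  unfolding Psi_seq_def Prob_def by (intro divide_nonneg_nonneg sum_nonneg) auto

text \<open>Makes every admissible \<open>z\<close> positive, so that the squared radius is
  nonnegative for \<open>\<rho> > 1\<close>.\<close>

lemma dstar_nonneg:
  assumes "0 \<le> r" "r \<le> real nt" "nt \<le> nr"
  shows "0 \<le> dstar nt nr r"
proof -
  obtain k where k: "real_of_int \<lfloor>r\<rfloor> = real k" "k \<le> nt" "real k \<le> r" "r < real k + 1"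
    using floor_nat_obtain assms by blast
  show ?thesis
  proof (cases "k = nt")
    case True
    then show ?thesis using dstar_floor[OF k(1,2), of nr] k(3) assms by simp
  next
    case False
    define p where "p = real (nt - k)"
    have p: "1 \<le> p" using False k(2) by (simp add: p_def)
    have "(r - real k) * (real nr - real nt + 2 * p - 1) \<le> 1 * (real nr - real nt + 2 * p - 1)"
      using k p assms by (intro mult_right_mono) auto
    also have "\<dots> \<le> p * (real nr - real nt + p)"
    proof -
      have "0 \<le> (p - 1) * (real nr - real nt) + (p - 1) * (p - 1)" using p assms by simp
      then show ?thesis by (simp add: algebra_simps)
    qed
    finally show ?thesis using dstar_floor[OF k(1,2), of nr] by (simp add: p_def)
  qed
qed

theorem theorem3:
  fixes nt nr T :: nat and G :: "complex mat" and \<eta> \<theta> :: "real \<Rightarrow> real \<Rightarrow> real"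
  assumes "0 < nt" and "0 < T" and "nt \<le> nr"
    and code: "LD_code nt T G \<eta> \<theta>"
    and dmt_opt: "\<forall>r. 0 \<le> r \<and> r \<le> real nt \<longrightarrow>
        diversity nt nr T G \<eta> \<theta> r = ereal (dstar nt nr r)"
    and Psi_lim: "\<forall>r z x. 0 \<le> r \<and> r \<le> real nt \<and> ereal z > diversity nt nr T G \<eta> \<theta> r \<longrightarrow>
        (\<exists>L. ((\<lambda>\<rho>. neg_exp (Psi_seq nt nr T G \<eta> \<theta> r z x \<rho>) \<rho>) \<longlongrightarrow> L) at_top)"
  shows "(\<forall>k::nat. k \<le> nt \<longrightarrow> (\<forall>z. ereal z > diversity nt nr T G \<eta> \<theta> (real k) \<longrightarrow>
            SD_exp nt nr T G \<eta> \<theta> (real k) z \<le> ereal (real T * real k * (real nt - real k) / real nt)))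
       \<and> (\<forall>r. 0 \<le> r \<and> r \<le> real nt \<longrightarrow>
            (\<forall>z. ereal z > diversity nt nr T G \<eta> \<theta> r \<longrightarrow>
               SD_exp nt nr T G \<eta> \<theta> r z \<le> ereal (cbar nt T r))
            \<and> (\<exists>\<alpha>. opt_feasible nt nr (diversity nt nr T G \<eta> \<theta> r) \<alpha> \<and> opt_obj nt T r \<alpha> = cbar nt T r)
            \<and> (\<forall>\<alpha>. opt_feasible nt nr (diversity nt nr T G \<eta> \<theta> r) \<alpha> \<longrightarrow> opt_obj nt T r \<alpha> \<le> cbar nt T r))"
proof -
  have main: "SD_exp nt nr T G \<eta> \<theta> r z \<le> ereal (cbar nt T r)"
    if r: "0 \<le> r" "r \<le> real nt" and z: "ereal z > diversity nt nr T G \<eta> \<theta> r" for r z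
  proof -
    have div: "diversity nt nr T G \<eta> \<theta> r = ereal (dstar nt nr r)" using dmt_opt r by blast
    have "0 < z" using z div dstar_nonneg[OF r \<open>nt \<le> nr\<close>] by simp
    have "SD_exp nt nr T G \<eta> \<theta> r z \<le> ereal x" if x: "cbar nt T r < x" for x
    proof -
      obtain \<epsilon> K where "0 < \<epsilon>" and ev: "\<forall>\<^sub>F \<rho> in at_top. 1 < \<rho> \<and>
          Psi_seq nt nr T G \<eta> \<theta> r z x \<rho> \<le> K * \<rho> powr (- (dstar nt nr r + \<epsilon>))"
        using Psi_seq_bound[OF assms(1-3) code r \<open>0 < z\<close> x] by blast
      obtain L where "((\<lambda>\<rho>. neg_exp (Psi_seq nt nr T G \<eta> \<theta> r z x \<rho>) \<rho>) \<longlongrightarrow> L) at_top"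
        using Psi_lim r z by blast
      from exponent_gt[OF ev \<open>0 < \<epsilon>\<close> Psi_seq_nonneg this]
      have "diversity nt nr T G \<eta> \<theta> r < Psi nt nr T G \<eta> \<theta> r z x" unfolding Psi_def div .
      then show ?thesis unfolding SD_exp_def by (intro Inf_lower) simp
    qed
    note le = this
    show ?thesis
    \<comment> \<open>\<open>Psi\<close> is controlled only at points strictly above
      \<open>cbar\<close>; density passes the bound to the infimum.\<close>
    proof (rule dense_ge)
      fix u assume "ereal (cbar nt T r) < u"
      then show "SD_exp nt nr T G \<eta> \<theta> r z \<le> u" using le by (cases u) auto
    qed
  qed
  moreover have "opt_obj nt T r \<alpha> \<le> cbar nt T r"
    if r: "0 \<le> r" "r \<le> real nt" and f: "opt_feasible nt nr (diversity nt nr T G \<eta> \<theta> r) \<alpha>" for r \<alpha>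
    using opt_obj_le_cbar[OF assms(1,3) r order_refl opt_feasible_nonneg[OF f], where T = T] f dmt_opt r
    by (simp add: opt_feasible_def)
  moreover have "\<exists>\<alpha>. opt_feasible nt nr (diversity nt nr T G \<eta> \<theta> r) \<alpha> \<and> opt_obj nt T r \<alpha> = cbar nt T r"
    if r: "0 \<le> r" "r \<le> real nt" for r
    using opt_attained[OF assms(1,3) r] dmt_opt r by simp
  moreover have "SD_exp nt nr T G \<eta> \<theta> (real k) z \<le> ereal (real T * real k * (real nt - real k) / real nt)"
    if "k \<le> nt" "ereal z > diversity nt nr T G \<eta> \<theta> (real k)" for k z
    using main[of "real k" z] cbar_integer[OF that(1) assms(1), of T] that by simp
  ultimately show ?thesis by blast
qed

end
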